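(* Let $H$ be a hypergroup with a left (translation) invariant mean on $WUCB_r(H)$. The following are equivalent: (1) There is a left Haar measure on $H$. (2) $H$ has the positivity property of translations of $f$ for every non-zero $f\in C_C(H)^+$. (3) $H$ has the positivity property of translations of $f$ for some non-zero $f\in C_C(H)^+$.
   Context: Hypergroup: a non-empty locally compact Hausdorff space $H$ such that: (1) there is a binary operation $\ast$ (convolution) on the vector space $M(H)$ of bounded complex regular Borel (Radon) measures making it an algebra (as usual, convolution is determined by its values on point masses: $\mu\ast\nu=\int\int \delta_x\ast\delta_y\,d\mu(x)\,d\nu(y)$ weakly); (2) for $x,y\in H$, $\delta_x\ast\delta_y$ is a probability measure with compact support; (3) the map $(x,y)\mapsto\delta_x\ast\delta_y$ from $H\times H$ to the compactly supported probability measures is continuous (for the weak topology given by integration against bounded continuous functions); (4) the map $(x,y)\mapsto \mathrm{supp}(\delta_x\ast\delta_y)$ is continuous into the space of non-empty compact subsets of $H$ with the Michael topology (generated by the sets $\{C: C\cap U\neq\emptyset,\ C\subset V\}$, $U,V\subset H$ open); (5) there is a unique $e\in H$ with $\delta_x\ast\delta_e=\delta_e\ast\delta_x=\delta_x$ for all $x\in H$; (6) there is a homeomorphism $x\mapsto\check{x}$ of $H$ with $\check{\check{x}}=x$ which, extended to $M(H)$ by $\check{\mu}(A)=\mu(\{x\in H:\check{x}\in A\})$, satisfies $(\mu\ast\nu)\check{}=\check{\nu}\ast\check{\mu}$; (7) for $x,y\in H$, $e\in\mathrm{supp}(\delta_x\ast\delta_y)$ if and only if $y=\check{x}$. $C(H)$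 is the space of bounded continuous complex-valued functions on $H$ with the supremum norm; $C_C(H)$ is the subspace of compactly supported functions; $C_C(H)^+$ is the set of functions in $C_C(H)$ with non-negative real values. $M^+(H)$ is the set of non-negative measures in $M(H)$, and $\|\mu\|$ is the total variation norm (so $\|\mu\|=\mu(H)$ for $\mu\in M^+(H)$). For $\mu\in M(H)$ and $f\in C(H)$, $(\mu\ast f)(y)=\int_H\int_H f\,d(\delta_{\check{x}}\ast\delta_y)\,d\mu(x)$; in particular $(\delta_x\ast f)(y)=\int_H f\,d(\delta_{\check{x}}\ast\delta_y)$. For a non-zero $f\in C_C(H)^+$, $H$ has the positivity property of translations of $f$ if for all $\mu,\nu\in M^+(H)$: $\mu\ast f\le\nu\ast f$ pointwise on $H$ implies $\|\mu\|\le\|\nu\|$. $WUCB_r(H)$ is the space of $f\in C(H)$ such that $H\ni x\mapsto\delta_x\ast f\in C(H)$ is continuous for the weak topology $\sigma(C(H),C(H)^* )$ on $C(H)$. A left invariant mean on $WUCB_r(H)$ is a linear functional $m$ on it with $\|m\|=m(1)=1$ and $m(\delta_x\ast f)=m(f)$ for all $f\in WUCB_r(H)$, $x\in H$. A left Haar measure for $H$ is a non-zero regular Borel measure $\lambda$ on $H$ with values in $[0,\infty]$ (regular includes being finite on compact sets) such that, writing $\lambda(f)=\int_H f\,d\lambda$, $\lambda(\delta_x\ast f)=\lambda(f)$ for all $f\in C_C(H)$ and $x\in H$. *)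

theory Defs
  imports "HOL-Analysis.Analysis" "HOL-Library.Complex_Order"
begin

section \<open>Bounded complex Radon measures\<close>

text \<open>
  A complex Borel measure is represented as a set function \<open>\<mu> :: 'a set \<Rightarrow> complex\<close>. It is required
  to vanish outside the Borel sets, so that equality of measures is equality of functions.
\<close>

definition total_variation :: "('a::topological_space set \<Rightarrow> complex) \<Rightarrow> 'a set \<Rightarrow> ennreal" where
  "total_variation \<mu> A =
     (SUP P\<in>{P. finite P \<and> P \<subseteq> sets borel \<and> disjoint P \<and> \<Union>P \<subseteq> A}. \<Sum>B\<in>P. ennreal (norm (\<mu> B)))"

definition complex_borel_measure :: "('a::topological_space set \<Rightarrow> complex) \<Rightarrow> bool" where
  "complex_borel_measure \<mu> \<longleftrightarrow>
     (\<forall>A. A \<notin> sets borel \<longrightarrow> \<mu> A = 0) \<and>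
     (\<forall>A :: nat \<Rightarrow> 'a set. range A \<subseteq> sets borel \<longrightarrow> disjoint_family A \<longrightarrow>
        (\<lambda>n. \<mu> (A n)) sums \<mu> (\<Union>n. A n))"

text \<open>The space \<open>M(H)\<close>; regularity is regularity of the (finite) total variation measure.\<close>

definition radon_measures :: "('a::topological_space set \<Rightarrow> complex) set" where
  "radon_measures = {\<mu>. complex_borel_measure \<mu> \<and>
     (\<forall>A\<in>sets borel. \<forall>\<epsilon>>0. \<exists>K U. compact K \<and> open U \<and> K \<subseteq> A \<and> A \<subseteq> U \<and>
        total_variation \<mu> (U - K) < \<epsilon>)}"

definition nonneg_radon_measures :: "('a::topological_space set \<Rightarrow> complex) set" where
  "nonneg_radon_measures = {\<mu>\<in>radon_measures. \<forall>A. 0 \<le> \<mu> A}"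

definition measure_norm :: "('a::topological_space set \<Rightarrow> complex) \<Rightarrow> ennreal" where
  "measure_norm \<mu> = total_variation \<mu> UNIV"

definition measure_supp :: "('a::topological_space set \<Rightarrow> complex) \<Rightarrow> 'a set" where
  "measure_supp \<mu> = {x. \<forall>U. open U \<and> x \<in> U \<longrightarrow> total_variation \<mu> U \<noteq> 0}"

definition point_mass :: "'a::topological_space \<Rightarrow> 'a set \<Rightarrow> complex" where
  "point_mass x = (\<lambda>A. if A \<in> sets borel \<and> x \<in> A then 1 else 0)"

text \<open>The positive part in the Jordan decomposition of a finite signed measure \<open>\<phi>\<close>
  (\<open>ennreal\<close> maps negative reals to 0).\<close>

definition jordan_pos :: "('a::topological_space set \<Rightarrow> real) \<Rightarrow> 'a measure" where
  "jordan_pos \<phi> =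
     measure_of UNIV (sets borel) (\<lambda>A. SUP B\<in>{B\<in>sets borel. B \<subseteq> A}. ennreal (\<phi> B))"

definition cintegral :: "('a::topological_space set \<Rightarrow> complex) \<Rightarrow> ('a \<Rightarrow> complex) \<Rightarrow> complex" where
  "cintegral \<mu> f =
     (integral\<^sup>L (jordan_pos (\<lambda>A. Re (\<mu> A))) f - integral\<^sup>L (jordan_pos (\<lambda>A. - Re (\<mu> A))) f) +
     \<i> * (integral\<^sup>L (jordan_pos (\<lambda>A. Im (\<mu> A))) f - integral\<^sup>L (jordan_pos (\<lambda>A. - Im (\<mu> A))) f)"


section \<open>Hypergroups\<close>

definition compact_probs :: "('a::topological_space set \<Rightarrow> complex) set" where
  "compact_probs =
     {\<mu>\<in>nonneg_radon_measures. \<mu> UNIV = 1 \<and> compact (measure_supp \<mu>)}"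

text \<open>Initial topology for integration against the bounded continuous functions; the library set
  \<^const>\<open>bcontfun\<close>, at result type \<^typ>\<open>complex\<close>, is \<open>C(H)\<close>.\<close>

definition compact_probs_topology :: "('a::topological_space set \<Rightarrow> complex) topology" where
  "compact_probs_topology =
     pullback_topology compact_probs (\<lambda>\<mu>. \<lambda>f\<in>bcontfun. cintegral \<mu> f)
       (product_topology (\<lambda>_. euclidean) bcontfun)"

definition michael_topology :: "'a::topological_space set topology" where
  "michael_topology = topology_generated_by
     {{C. compact C \<and> C \<noteq> {} \<and> C \<inter> U \<noteq> {} \<and> C \<subseteq> V} | U V. open U \<and> open V}"

text \<open>The underlying space is the whole type \<^typ>\<open>'a\<close>. Only the values of \<open>conv\<close> on
  \<^const>\<open>radon_measures\<close> matter.\<close>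

locale hypergroup =
  fixes conv :: "('a::t2_space set \<Rightarrow> complex) \<Rightarrow> ('a set \<Rightarrow> complex) \<Rightarrow> ('a set \<Rightarrow> complex)"
    and e :: 'a
    and invol :: "'a \<Rightarrow> 'a"
  assumes locally_compact: "locally_compact_space (euclidean :: 'a topology)"
    and conv_closed:
      "\<lbrakk>\<mu> \<in> radon_measures; \<nu> \<in> radon_measures\<rbrakk> \<Longrightarrow> conv \<mu> \<nu> \<in> radon_measures"
    and conv_assoc:
      "\<lbrakk>\<mu> \<in> radon_measures; \<nu> \<in> radon_measures; \<rho> \<in> radon_measures\<rbrakk> \<Longrightarrow>
         conv (conv \<mu> \<nu>) \<rho> = conv \<mu> (conv \<nu> \<rho>)"
    and conv_add_left:
      "\<lbrakk>\<mu> \<in> radon_measures; \<nu> \<in> radon_measures; \<rho> \<in> radon_measures\<rbrakk> \<Longrightarrow>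
         conv (\<lambda>A. \<mu> A + \<nu> A) \<rho> = (\<lambda>A. conv \<mu> \<rho> A + conv \<nu> \<rho> A)"
    and conv_add_right:
      "\<lbrakk>\<mu> \<in> radon_measures; \<nu> \<in> radon_measures; \<rho> \<in> radon_measures\<rbrakk> \<Longrightarrow>
         conv \<rho> (\<lambda>A. \<mu> A + \<nu> A) = (\<lambda>A. conv \<rho> \<mu> A + conv \<rho> \<nu> A)"
    and conv_scale_left:
      "\<lbrakk>\<mu> \<in> radon_measures; \<nu> \<in> radon_measures\<rbrakk> \<Longrightarrow>
         conv (\<lambda>A. c * \<mu> A) \<nu> = (\<lambda>A. c * conv \<mu> \<nu> A)"
    and conv_scale_right:
      "\<lbrakk>\<mu> \<in> radon_measures; \<nu> \<in> radon_measures\<rbrakk> \<Longrightarrow>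
         conv \<mu> (\<lambda>A. c * \<nu> A) = (\<lambda>A. c * conv \<mu> \<nu> A)"
    and conv_weak:
      "\<lbrakk>\<mu> \<in> radon_measures; \<nu> \<in> radon_measures; f \<in> bcontfun\<rbrakk> \<Longrightarrow>
         cintegral (conv \<mu> \<nu>) f =
         cintegral \<nu> (\<lambda>y. cintegral \<mu> (\<lambda>x. cintegral (conv (point_mass x) (point_mass y)) f))"
    and conv_point_mass: "conv (point_mass x) (point_mass y) \<in> compact_probs"
    and conv_continuous:
      "continuous_map (euclidean :: ('a \<times> 'a) topology) compact_probs_topology
         (\<lambda>(x, y). conv (point_mass x) (point_mass y))"
    and supp_continuous:
      "continuous_map (euclidean :: ('a \<times> 'a) topology) michael_topology
         (\<lambda>(x, y). measure_supp (conv (point_mass x) (point_mass y)))"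
    and identity:
      "conv (point_mass x) (point_mass e) = point_mass x"
      "conv (point_mass e) (point_mass x) = point_mass x"
    and identity_unique:
      "(\<And>x. conv (point_mass x) (point_mass e') = point_mass x \<and>
            conv (point_mass e') (point_mass x) = point_mass x) \<Longrightarrow> e' = e"
    and invol_homeomorphic: "homeomorphic_map euclidean euclidean invol"
    and invol_invol: "invol (invol x) = x"
    and invol_conv:
      "\<lbrakk>\<mu> \<in> radon_measures; \<nu> \<in> radon_measures\<rbrakk> \<Longrightarrow>
         (\<lambda>A. conv \<mu> \<nu> {x. invol x \<in> A}) =
         conv (\<lambda>A. \<nu> {x. invol x \<in> A}) (\<lambda>A. \<mu> {x. invol x \<in> A})"
    and identity_in_supp:
      "e \<in> measure_supp (conv (point_mass x) (point_mass y)) \<longleftrightarrow> y = invol x"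


section \<open>Function spaces and translations\<close>

definition compactly_supported :: "('a::topological_space \<Rightarrow> complex) set" where
  "compactly_supported = {f\<in>bcontfun. compact (closure {x. f x \<noteq> 0})}"

definition nonneg_compactly_supported :: "('a::topological_space \<Rightarrow> complex) set" where
  "nonneg_compactly_supported = {f\<in>compactly_supported. \<forall>x. 0 \<le> f x}"

definition sup_norm :: "('a \<Rightarrow> complex) \<Rightarrow> real" where
  "sup_norm f = (SUP x. norm (f x))"

text \<open>\<open>translate conv invol x f\<close> is \<open>\<delta>\<^sub>x * f\<close>, and \<open>conv_fun conv invol \<mu> f\<close> is \<open>\<mu> * f\<close>.\<close>

definition translate ::
  "(('a::topological_space set \<Rightarrow> complex) \<Rightarrow> ('a set \<Rightarrow> complex) \<Rightarrow> ('a set \<Rightarrow> complex)) \<Rightarrow>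
   ('a \<Rightarrow> 'a) \<Rightarrow> 'a \<Rightarrow> ('a \<Rightarrow> complex) \<Rightarrow> 'a \<Rightarrow> complex" where
  "translate conv invol x f =
     (\<lambda>y. cintegral (conv (point_mass (invol x)) (point_mass y)) f)"

definition conv_fun ::
  "(('a::topological_space set \<Rightarrow> complex) \<Rightarrow> ('a set \<Rightarrow> complex) \<Rightarrow> ('a set \<Rightarrow> complex)) \<Rightarrow>
   ('a \<Rightarrow> 'a) \<Rightarrow> ('a set \<Rightarrow> complex) \<Rightarrow> ('a \<Rightarrow> complex) \<Rightarrow> 'a \<Rightarrow> complex" where
  "conv_fun conv invol \<mu> f = (\<lambda>y. cintegral \<mu> (\<lambda>x. translate conv invol x f y))"

definition positivity_property ::
  "(('a::topological_space set \<Rightarrow> complex) \<Rightarrow> ('a set \<Rightarrow> complex) \<Rightarrow> ('a set \<Rightarrow> complex)) \<Rightarrow>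
   ('a \<Rightarrow> 'a) \<Rightarrow> ('a \<Rightarrow> complex) \<Rightarrow> bool" where
  "positivity_property conv invol f \<longleftrightarrow>
     (\<forall>\<mu>\<in>nonneg_radon_measures. \<forall>\<nu>\<in>nonneg_radon_measures.
        (\<forall>y. conv_fun conv invol \<mu> f y \<le> conv_fun conv invol \<nu> f y) \<longrightarrow>
        measure_norm \<mu> \<le> measure_norm \<nu>)"


section \<open>Invariant means and Haar measures\<close>

definition linear_functional_on ::
  "('a \<Rightarrow> complex) set \<Rightarrow> (('a \<Rightarrow> complex) \<Rightarrow> complex) \<Rightarrow> bool" where
  "linear_functional_on S \<phi> \<longleftrightarrow>
     (\<forall>f\<in>S. \<forall>g\<in>S. \<phi> (\<lambda>x. f x + g x) = \<phi> f + \<phi> g) \<and>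
     (\<forall>c. \<forall>f\<in>S. \<phi> (\<lambda>x. c * f x) = c * \<phi> f)"

definition functional_norm ::
  "('a \<Rightarrow> complex) set \<Rightarrow> (('a \<Rightarrow> complex) \<Rightarrow> complex) \<Rightarrow> ennreal" where
  "functional_norm S \<phi> = (SUP f\<in>{f\<in>S. sup_norm f \<le> 1}. ennreal (norm (\<phi> f)))"

definition dual_space :: "(('a::topological_space \<Rightarrow> complex) \<Rightarrow> complex) set" where
  "dual_space = {\<phi>. linear_functional_on bcontfun \<phi> \<and> functional_norm bcontfun \<phi> < \<infinity>}"

definition weak_topology :: "('a::topological_space \<Rightarrow> complex) topology" where
  "weak_topology =
     pullback_topology bcontfun (\<lambda>f. \<lambda>\<phi>\<in>dual_space. \<phi> f)
       (product_topology (\<lambda>_. euclidean) dual_space)"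

definition WUCB_r ::
  "(('a::topological_space set \<Rightarrow> complex) \<Rightarrow> ('a set \<Rightarrow> complex) \<Rightarrow> ('a set \<Rightarrow> complex)) \<Rightarrow>
   ('a \<Rightarrow> 'a) \<Rightarrow> ('a \<Rightarrow> complex) set" where
  "WUCB_r conv invol =
     {f\<in>bcontfun. continuous_map euclidean weak_topology (\<lambda>x. translate conv invol x f)}"

definition left_invariant_mean ::
  "(('a::topological_space set \<Rightarrow> complex) \<Rightarrow> ('a set \<Rightarrow> complex) \<Rightarrow> ('a set \<Rightarrow> complex)) \<Rightarrow>
   ('a \<Rightarrow> 'a) \<Rightarrow> (('a \<Rightarrow> complex) \<Rightarrow> complex) \<Rightarrow> bool" where
  "left_invariant_mean conv invol m \<longleftrightarrow>
     linear_functional_on (WUCB_r conv invol) m \<and>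
     functional_norm (WUCB_r conv invol) m = 1 \<and> m (\<lambda>_. 1) = 1 \<and>
     (\<forall>f\<in>WUCB_r conv invol. \<forall>x. m (translate conv invol x f) = m f)"

text \<open>For possibly infinite measures, regularity means: finite on compact sets, outer regular on
  Borel sets and inner regular on open sets.\<close>

definition regular_borel_measure :: "'a::topological_space measure \<Rightarrow> bool" where
  "regular_borel_measure M \<longleftrightarrow>
     sets M = sets borel \<and>
     (\<forall>K. compact K \<longrightarrow> emeasure M K < \<infinity>) \<and>
     (\<forall>A\<in>sets borel. emeasure M A = (INF U\<in>{U. open U \<and> A \<subseteq> U}. emeasure M U)) \<and>
     (\<forall>U. open U \<longrightarrow> emeasure M U = (SUP K\<in>{K. compact K \<and> K \<subseteq> U}. emeasure M K))"

definition left_haar_measure ::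
  "(('a::topological_space set \<Rightarrow> complex) \<Rightarrow> ('a set \<Rightarrow> complex) \<Rightarrow> ('a set \<Rightarrow> complex)) \<Rightarrow>
   ('a \<Rightarrow> 'a) \<Rightarrow> 'a measure \<Rightarrow> bool" where
  "left_haar_measure conv invol M \<longleftrightarrow>
     regular_borel_measure M \<and> emeasure M UNIV \<noteq> 0 \<and>
     (\<forall>f\<in>compactly_supported. \<forall>x.
        integral\<^sup>L M (translate conv invol x f) = integral\<^sup>L M f)"

end

theory Submission
  imports Defs
begin

text \<open>
  Write \<open>\<delta>\<^sub>x * g\<close> for translates and let \<open>\<mu> * f\<close> be the corresponding average of translates of \<open>f\<close>.

  A Haar measure \<open>\<lambda>\<close> satisfies \<open>\<lambda>(\<mu> * f) = \<parallel>\<mu>\<parallel> \<lambda>(f)\<close> with \<open>0 < \<lambda>(f) < \<infinity>\<close>, so \<open>\<mu> * f \<le> \<nu> * f\<close> forces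
  \<open>\<parallel>\<mu>\<parallel> \<le> \<parallel>\<nu>\<parallel>\<close>; since \<open>\<lambda>\<close> need not be \<open>\<sigma>\<close>-finite, Tonelli is replaced by cutting \<open>\<mu>\<close> and \<open>\<nu>\<close> down to
  compact sets.

  Conversely, if \<open>f\<close> has the positivity property, then
  \<open>p g = inf {\<parallel>\<mu>\<parallel> - \<parallel>\<nu>\<parallel> | g + \<nu> * f \<le> \<mu> * f}\<close> is a finite sublinear functional on the continuous
  functions with compact support, and every linear \<open>\<phi> \<le> p\<close> is positive and takes the value \<open>1\<close> on all
  \<open>\<delta>\<^sub>x * \<delta>\<^sub>y * f\<close>. Every \<open>g\<close> with support in a fixed compact set is dominated by a multiple of
  \<open>\<parallel>g\<parallel>\<close> times a finite sum of translates of \<open>f\<close>, with a factor that does not depend on \<open>g\<close>. Hence the function sending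
  \<open>x\<close> to the value of \<open>\<phi>\<close> at the translate of \<open>g\<close> by the involute of \<open>x\<close> is bounded, and it depends
  on \<open>g\<close> continuously in norm, so it lies in \<open>WUCB\<^sub>r\<close>. Applying the invariant mean to it gives an
  invariant positive functional that takes the value \<open>1\<close> at \<open>f\<close>; Riesz representation turns it into a
  Haar measure.
\<close>

section \<open>Continuous functions with compact support\<close>

text \<open>The functional \<open>\<phi>\<close> comes from Hahn-Banach and has no reason to be
  invariant; only its values near the translates of \<open>f\<close> are controlled. Double
  translates enter because bounding \<open>\<phi>\<close> on a translate of \<open>g\<close> means
  translating a sum of translates of \<open>f\<close>. A double translate is
  \<open>\<rho> * f\<close> for a probability measure \<open>\<rho>\<close>, a product of two point
  masses. The pairs (\<open>\<rho>\<close>, 0) and (0, \<open>\<rho>\<close>) therefore bound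
  \<open>p\<close> by 1 there and by -1 at the negative, which is what the measure
  \<open>\<nu>\<close> in the infimum achieves. The positivity property bounds the infimum from
  below: it says that no admissible pair for the function 0 has a negative difference of norms.
  Forming the function of \<open>x\<close> from \<open>g\<close> commutes with translation although
  \<open>\<phi>\<close> is not invariant, once \<open>\<phi>\<close> may be taken under the integral
  over a product of two point masses. Compact supports make this possible. Translation is no point
  map here, so supports of translates cannot be found by solving equations as in a group. The cyclic
  symmetry of supports in \<open>psupp_rotate\<close> takes over that task.\<close>

definition Cc :: "('a::topological_space \<Rightarrow> real) set" where
  "Cc = {f. continuous_on UNIV f \<and> compact (closure {x. f x \<noteq> 0})}"

lemma Cc_continuous: "f \<in> Cc \<Longrightarrow> continuous_on UNIV f"
  by (simp add: Cc_def)

lemma Cc_compact_support: "f \<in> Cc \<Longrightarrow> compact (closure {x. f x \<noteq> 0})"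
  by (simp add: Cc_def)

lemma zero_outside_closure: "x \<notin> closure {x. f x \<noteq> 0} \<Longrightarrow> f x = 0"
  by (metis (mono_tags, lifting) closure_subset mem_Collect_eq subsetD)

lemma CcI:
  fixes f :: "'a::t2_space \<Rightarrow> real"
  assumes "continuous_on UNIV f" "compact K" "\<And>x. x \<notin> K \<Longrightarrow> f x = 0"
  shows "f \<in> Cc"
proof -
  have "closure {x. f x \<noteq> 0} \<subseteq> K"
    by (rule closure_minimal) (use assms compact_imp_closed in auto)
  then have "compact (closure {x. f x \<noteq> 0})"
    using compact_Int_closed[OF assms(2) closed_closure, of "{x. f x \<noteq> 0}"] by (simp add: Int_absorb1)
  with assms show ?thesis by (simp add: Cc_def)
qed

lemma Cc_cases:
  assumes "f \<in> Cc"
  obtains K where "compact K" "\<And>x. x \<notin> K \<Longrightarrow> f x = 0"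
  using Cc_compact_support[OF assms] zero_outside_closure by metis

lemma Cc_add:
  fixes f :: "'a::t2_space \<Rightarrow> real"
  assumes "f \<in> Cc" "g \<in> Cc"
  shows "(\<lambda>x. f x + g x) \<in> Cc"
proof -
  obtain K L where "compact K" "\<And>x. x \<notin> K \<Longrightarrow> f x = 0" "compact L" "\<And>x. x \<notin> L \<Longrightarrow> g x = 0"
    using assms Cc_cases by metis
  with assms show ?thesis
    by (intro CcI[of _ "K \<union> L"]) (auto intro!: continuous_on_add dest: Cc_continuous)
qed

lemma Cc_mult:
  fixes f :: "'a::t2_space \<Rightarrow> real"
  assumes "f \<in> Cc" "continuous_on UNIV g"
  shows "(\<lambda>x. g x * f x) \<in> Cc"
proof -
  obtain K where "compact K" "\<And>x. x \<notin> K \<Longrightarrow> f x = 0"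
    using assms Cc_cases by metis
  with assms show ?thesis
    by (intro CcI[of _ K]) (auto intro!: continuous_on_mult dest: Cc_continuous)
qed

lemma Cc_scale: "f \<in> Cc \<Longrightarrow> (\<lambda>x. c * f x) \<in> Cc" for f :: "'a::t2_space \<Rightarrow> real"
  by (rule Cc_mult) auto

lemma Cc_diff: "f \<in> Cc \<Longrightarrow> g \<in> Cc \<Longrightarrow> (\<lambda>x. f x - g x) \<in> Cc" for f :: "'a::t2_space \<Rightarrow> real"
  using Cc_add[OF _ Cc_scale, of f g "-1"] by simp

lemma Cc_zero: "(\<lambda>x::'a::t2_space. 0) \<in> Cc"
  by (rule CcI[of _ "{}"]) auto

lemma Cc_sum:
  fixes f :: "'i \<Rightarrow> 'a::t2_space \<Rightarrow> real"
  assumes "\<And>i. i \<in> I \<Longrightarrow> f i \<in> Cc"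
  shows "(\<lambda>x. \<Sum>i\<in>I. f i x) \<in> Cc"
  using assms by (induction I rule: infinite_finite_induct) (auto intro: Cc_add Cc_zero)

lemma Cc_comp:
  fixes f :: "'a::t2_space \<Rightarrow> real"
  assumes "f \<in> Cc" "continuous_on UNIV r" "r 0 = 0"
  shows "(\<lambda>x. r (f x)) \<in> Cc"
proof -
  obtain K where "compact K" "\<And>x. x \<notin> K \<Longrightarrow> f x = 0"
    using assms Cc_cases by metis
  with assms show ?thesis
    by (intro CcI[of _ K]) (auto intro!: continuous_on_compose2[OF assms(2)] dest: Cc_continuous)
qed

lemma Cc_bounded:
  assumes "f \<in> Cc"
  obtains B where "0 \<le> B" "\<And>x. \<bar>f x\<bar> \<le> B"
proof -
  obtain K where K: "compact K" "\<And>x. x \<notin> K \<Longrightarrow> f x = 0"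
    using assms Cc_cases by metis
  have "bounded (f ` K)"
    by (intro compact_imp_bounded compact_continuous_image K)
       (meson Cc_continuous assms continuous_on_subset subset_UNIV)
  then obtain B where B: "\<And>x. x \<in> K \<Longrightarrow> \<bar>f x\<bar> \<le> B"
    by (auto simp: bounded_iff)
  have "\<bar>f x\<bar> \<le> \<bar>B\<bar>" for x
    by (cases "x \<in> K") (use B[of x] K in auto)
  then show thesis using that[of "\<bar>B\<bar>"] by auto
qed

text \<open>Besides the closed support inside \<open>U\<close>, the value 1 is wanted on a whole
  neighbourhood of \<open>K\<close>: it keeps the closed support of \<open>1 - h\<close> away from
  \<open>K\<close>.\<close>

lemma Urysohn_Cc:
  fixes K :: "'a::t2_space set"
  assumes lc: "locally_compact_space (euclidean :: 'a topology)"
    and K: "compact K" and U: "open U" "K \<subseteq> U"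
  obtains h W where "h \<in> Cc" "\<And>x. 0 \<le> h x" "\<And>x. h x \<le> 1" "closure {x. h x \<noteq> 0} \<subseteq> U"
    "open W" "K \<subseteq> W" "\<And>x. x \<in> W \<Longrightarrow> h x = 1"
proof -
  have H: "Hausdorff_space (euclidean :: 'a topology)"
    using hausdorff by (auto simp: Hausdorff_space_def disjnt_def)
  then have cr: "completely_regular_space (euclidean :: 'a topology)"
    by (simp add: lc locally_compact_Hausdorff_imp_regular_space
        locally_compact_regular_imp_completely_regular_space)
  obtain V L where V: "open V" "compact L" "K \<subseteq> V" "V \<subseteq> L"
    using lc K H by (auto simp: locally_compact_space_compact_closed_compact)
  have "closed (- (U \<inter> V))" "disjnt K (- (U \<inter> V))"
    using U V by (auto simp: disjnt_def)
  then obtain f where f: "continuous_map euclidean (subtopology euclidean {0..1::real}) f"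
      "f ` (- (U \<inter> V)) \<subseteq> {0}" "f ` K \<subseteq> {1}"
    using Urysohn_completely_regular_compact_closed[OF _ cr, of 0 1 K "- (U \<inter> V)"] K by auto
  then have cf: "continuous_on UNIV f" by (simp add: continuous_map_in_subtopology)
  \<comment> \<open>\<open>3 * f x - 1\<close>, cut off to [0, 1], vanishes for
    \<open>f x \<le> 1/3\<close> and is 1 for \<open>f x \<ge> 2/3\<close>. The two margins give the
    closed support and the neighbourhood \<open>W\<close>.\<close>
  define h where "h = (\<lambda>x. min 1 (max 0 (3 * f x - 1)))"
  define W where "W = {x. 2/3 < f x}"
  have ch: "continuous_on UNIV h"
    unfolding h_def by (intro continuous_intros cf)
  have sub: "closure {x. h x \<noteq> 0} \<subseteq> {x. 1/3 \<le> f x}"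
    by (rule closure_minimal) (auto simp: h_def intro!: closed_Collect_le continuous_intros cf)
  have UV: "x \<in> U \<inter> V" if "1/3 \<le> f x" for x
  proof (rule ccontr)
    assume "x \<notin> U \<inter> V"
    then have "f x = 0" using f(2) by auto
    with that show False by simp
  qed
  show thesis
  proof
    show "h \<in> Cc"
    proof (rule CcI[OF ch V(2)])
      fix x assume "x \<notin> L"
      then have "\<not> 1/3 \<le> f x" using UV V by blast
      then show "h x = 0" by (auto simp: h_def)
    qed
    show "closure {x. h x \<noteq> 0} \<subseteq> U" using sub UV by blast
    show "open W" unfolding W_def by (intro open_Collect_less continuous_intros cf)
    show "K \<subseteq> W" using f(3) by (auto simp: W_def)
  qed (auto simp: h_def W_def)
qed

locale positive_functional =
  fixes \<phi> :: "('a::t2_space \<Rightarrow> real) \<Rightarrow> real"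
  assumes lc: "locally_compact_space (euclidean :: 'a topology)"
    and add: "f \<in> Cc \<Longrightarrow> g \<in> Cc \<Longrightarrow> \<phi> (\<lambda>x. f x + g x) = \<phi> f + \<phi> g"
    and scale: "f \<in> Cc \<Longrightarrow> \<phi> (\<lambda>x. c * f x) = c * \<phi> f"
    and nonneg: "f \<in> Cc \<Longrightarrow> (\<And>x. 0 \<le> f x) \<Longrightarrow> 0 \<le> \<phi> f"
begin

lemma diff: "f \<in> Cc \<Longrightarrow> g \<in> Cc \<Longrightarrow> \<phi> (\<lambda>x. f x - g x) = \<phi> f - \<phi> g"
  using add[of f "\<lambda>x. (-1) * g x"] scale[of g "-1"] Cc_scale[of g "-1"] by simp

lemma zero: "\<phi> (\<lambda>x. 0) = 0"
  using scale[of "\<lambda>x. 0" 0] Cc_zero by simp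

lemma mono: "f \<in> Cc \<Longrightarrow> g \<in> Cc \<Longrightarrow> (\<And>x. f x \<le> g x) \<Longrightarrow> \<phi> f \<le> \<phi> g"
  using nonneg[of "\<lambda>x. g x - f x"] diff[of g f] Cc_diff[of g f] by simp

lemma sum: "(\<And>i. i \<in> I \<Longrightarrow> f i \<in> Cc) \<Longrightarrow> \<phi> (\<lambda>x. \<Sum>i\<in>I. f i x) = (\<Sum>i\<in>I. \<phi> (f i))"
  by (induction I rule: infinite_finite_induct) (auto simp: zero add Cc_sum)

lemma abs_le:
  assumes "f \<in> Cc" "h \<in> Cc" "\<And>x. \<bar>f x\<bar> \<le> c * h x"
  shows "\<bar>\<phi> f\<bar> \<le> c * \<phi> h"
proof -
  have "\<phi> f \<le> \<phi> (\<lambda>x. c * h x)"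
    by (rule mono) (use assms Cc_scale in \<open>auto simp: abs_le_iff\<close>)
  moreover have "\<phi> (\<lambda>x. (-1) * f x) \<le> \<phi> (\<lambda>x. c * h x)"
    by (rule mono) (use assms Cc_scale[of f "-1"] Cc_scale in \<open>auto simp: abs_le_iff\<close>)
  ultimately show ?thesis
    using scale[OF assms(1), of "-1"] scale[OF assms(2), of c] by (simp add: abs_le_iff)
qed

end

section \<open>The Riesz representation theorem\<close>

context positive_functional
begin

section \<open>The outer measure of a positive functional\<close>

definition subordinate :: "'a set \<Rightarrow> ('a \<Rightarrow> real) set" where
  "subordinate U = {g\<in>Cc. (\<forall>x. 0 \<le> g x \<and> g x \<le> 1) \<and> closure {x. g x \<noteq> 0} \<subseteq> U}"

definition open_content :: "'a set \<Rightarrow> ennreal" where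
  "open_content U = (SUP g\<in>subordinate U. ennreal (\<phi> g))"

definition outer_content :: "'a set \<Rightarrow> ennreal" where
  "outer_content A = (INF U\<in>{U. open U \<and> A \<subseteq> U}. open_content U)"

lemma subordinateD:
  assumes "g \<in> subordinate U"
  shows "g \<in> Cc" "0 \<le> g x" "g x \<le> 1" "closure {x. g x \<noteq> 0} \<subseteq> U" "0 \<le> \<phi> g"
  using assms by (auto simp: subordinate_def intro: nonneg)

lemma subordinate_zero: "(\<lambda>x. 0) \<in> subordinate U"
  by (simp add: subordinate_def Cc_zero)

lemma open_content_mono: "U \<subseteq> V \<Longrightarrow> open_content U \<le> open_content V"
  unfolding open_content_def by (rule SUP_subset_mono) (auto simp: subordinate_def)

lemma open_content_empty: "open_content {} = 0"
proof -
  have "\<phi> g = 0" if "g \<in> subordinate {}" for g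
  proof -
    have "g = (\<lambda>x. 0)" using subordinateD(4)[OF that] zero_outside_closure by fastforce
    then show ?thesis using zero by simp
  qed
  then show ?thesis
    unfolding open_content_def using subordinate_zero by (auto intro!: antisym SUP_least)
qed

lemma le_open_content: "g \<in> subordinate U \<Longrightarrow> ennreal (\<phi> g) \<le> open_content U"
  unfolding open_content_def by (rule SUP_upper)

text \<open>A two-member partition of unity: \<open>h\<close> takes care of the part of the support
  of \<open>g\<close> outside \<open>V\<close>. As \<open>h\<close> is 1 on the open set
  \<open>W\<close> around that part, \<open>(1 - h) g\<close> has its closed support in
  \<open>K - W\<close>, which lies in \<open>V\<close>.\<close>

lemma subordinate_split:
  assumes "open U" "open V" "g \<in> subordinate (U \<union> V)"
  obtains g1 g2 where "g1 \<in> subordinate U" "g2 \<in> subordinate V" "\<phi> g = \<phi> g1 + \<phi> g2"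
proof -
  note g = subordinateD[OF assms(3)]
  define K where "K = closure {x. g x \<noteq> 0}"
  have K: "compact K" "K \<subseteq> U \<union> V" unfolding K_def using Cc_compact_support g by auto
  have "compact (K - V)" "K - V \<subseteq> U" using K assms by (auto intro: compact_diff)
  then obtain h W where h: "h \<in> Cc" "\<And>x. 0 \<le> h x" "\<And>x. h x \<le> 1" "closure {x. h x \<noteq> 0} \<subseteq> U"
    "open W" "K - V \<subseteq> W" "\<And>x. x \<in> W \<Longrightarrow> h x = 1"
    using Urysohn_Cc[OF lc _ assms(1)] by metis
  define g1 g2 where "g1 = (\<lambda>x. h x * g x)" and "g2 = (\<lambda>x. (1 - h x) * g x)"
  have Cc: "g1 \<in> Cc" "g2 \<in> Cc"
    unfolding g1_def g2_def using h g by (auto intro!: Cc_mult continuous_on_diff dest: Cc_continuous)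
  have "closure {x. g1 x \<noteq> 0} \<subseteq> closure {x. h x \<noteq> 0}"
    by (rule closure_mono) (auto simp: g1_def)
  then have 1: "g1 \<in> subordinate U"
    using Cc h g by (auto simp: subordinate_def g1_def mult_le_one)
  have "closure {x. g2 x \<noteq> 0} \<subseteq> K - W"
  proof (rule closure_minimal)
    show "{x. g2 x \<noteq> 0} \<subseteq> K - W"
      using zero_outside_closure h(7) by (fastforce simp: g2_def K_def)
    show "closed (K - W)" using K h by (simp add: closed_Diff compact_imp_closed)
  qed
  then have 2: "g2 \<in> subordinate V"
    using Cc h g by (auto simp: subordinate_def g2_def mult_le_one)
  have "g = (\<lambda>x. g1 x + g2 x)" by (auto simp: g1_def g2_def algebra_simps)
  then show thesis using that[OF 1 2] add[OF Cc] by simp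
qed

lemma open_content_Un:
  assumes "open U" "open V"
  shows "open_content (U \<union> V) \<le> open_content U + open_content V"
  unfolding open_content_def[of "U \<union> V"]
proof (rule SUP_least)
  fix g assume "g \<in> subordinate (U \<union> V)"
  then obtain g1 g2 where g: "g1 \<in> subordinate U" "g2 \<in> subordinate V" "\<phi> g = \<phi> g1 + \<phi> g2"
    using subordinate_split assms by metis
  then have "ennreal (\<phi> g) = ennreal (\<phi> g1) + ennreal (\<phi> g2)"
    by (simp add: subordinateD)
  also have "\<dots> \<le> open_content U + open_content V"
    by (intro add_mono le_open_content g)
  finally show "ennreal (\<phi> g) \<le> open_content U + open_content V" .
qed

lemma open_content_finite_UN:
  fixes n :: nat
  assumes "\<And>i. open (U i)"
  shows "open_content (\<Union>i<n. U i) \<le> (\<Sum>i<n. open_content (U i))"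
proof (induction n)
  case 0 then show ?case by (simp add: open_content_empty)
next
  case (Suc n)
  have "open_content (\<Union>i<Suc n. U i) = open_content ((\<Union>i<n. U i) \<union> U n)"
    by (simp add: lessThan_Suc Un_commute)
  also have "\<dots> \<le> open_content (\<Union>i<n. U i) + open_content (U n)"
    by (rule open_content_Un) (use assms in auto)
  also have "\<dots> \<le> (\<Sum>i<Suc n. open_content (U i))" using Suc by (simp add: add_right_mono)
  finally show ?case .
qed

text \<open>The support of a subordinate function is compact, so it meets the union in finitely many
  of the sets that matter.\<close>

lemma open_content_UN:
  fixes U :: "nat \<Rightarrow> 'a set"
  assumes "\<And>i. open (U i)"
  shows "open_content (\<Union>i. U i) \<le> (\<Sum>i. open_content (U i))"
  unfolding open_content_def[of "\<Union>i. U i"]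
proof (rule SUP_least)
  fix g assume g: "g \<in> subordinate (\<Union>i. U i)"
  define K where "K = closure {x. g x \<noteq> 0}"
  have K: "compact K" "K \<subseteq> (\<Union>i\<in>UNIV. U i)"
    using subordinateD[OF g] Cc_compact_support unfolding K_def by auto
  obtain D where D: "finite D" "K \<subseteq> (\<Union>i\<in>D. U i)"
    by (rule compactE_image[OF K(1) _ K(2)]) (use assms in auto)
  obtain n where n: "D \<subseteq> {..<n}" using finite_nat_bounded[OF D(1)] by blast
  have "(\<Union>i\<in>D. U i) \<subseteq> (\<Union>i<n. U i)" using n by (rule UN_mono) simp
  with D(2) have "K \<subseteq> (\<Union>i<n. U i)" by (rule order_trans)
  then have "g \<in> subordinate (\<Union>i<n. U i)"
    using g by (simp add: subordinate_def K_def)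
  then have "ennreal (\<phi> g) \<le> open_content (\<Union>i<n. U i)" by (rule le_open_content)
  also have "\<dots> \<le> (\<Sum>i<n. open_content (U i))" using open_content_finite_UN assms by auto
  also have "\<dots> \<le> (\<Sum>i. open_content (U i))" by (rule sum_le_suminf) auto
  finally show "ennreal (\<phi> g) \<le> (\<Sum>i. open_content (U i))" .
qed

lemma outer_content_open: "open U \<Longrightarrow> outer_content U = open_content U"
  unfolding outer_content_def by (auto intro!: antisym INF_greatest INF_lower open_content_mono)

lemma outer_content_mono: "A \<subseteq> B \<Longrightarrow> outer_content A \<le> outer_content B"
  unfolding outer_content_def by (rule INF_superset_mono) auto

lemma outer_content_le: "open U \<Longrightarrow> A \<subseteq> U \<Longrightarrow> outer_content A \<le> open_content U"
  unfolding outer_content_def by (auto intro!: INF_lower)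

lemma outer_content_UN:
  fixes A :: "nat \<Rightarrow> 'a set"
  shows "outer_content (\<Union>i. A i) \<le> (\<Sum>i. outer_content (A i))"
proof (rule ennreal_le_epsilon)
  fix e :: real assume e: "0 < e" and fin: "(\<Sum>i. outer_content (A i)) < top"
  have "\<exists>U. open U \<and> A i \<subseteq> U \<and> open_content U \<le> outer_content (A i) + ennreal (e * (1/2)^Suc i)" for i
  proof -
    have "outer_content (A i) < top"
      using fin by (metis ennreal_suminf_lessD)
    then have "outer_content (A i) < outer_content (A i) + ennreal (e * (1/2)^Suc i)"
      using e by (metis add.right_neutral ennreal_add_left_cancel_less ennreal_less_zero_iff infinity_ennreal_def
          mult_pos_pos order_less_irrefl zero_less_divide_1_iff zero_less_numeral zero_less_power)
    then show ?thesis
      unfolding outer_content_def[of "A i"] INF_less_iff by (auto intro: less_imp_le)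
  qed
  then obtain U where U: "\<And>i. open (U i)" "\<And>i. A i \<subseteq> U i"
    "\<And>i. open_content (U i) \<le> outer_content (A i) + ennreal (e * (1/2)^Suc i)" by metis
  have "outer_content (\<Union>i. A i) \<le> open_content (\<Union>i. U i)"
    by (rule outer_content_le) (use U in auto)
  also have "\<dots> \<le> (\<Sum>i. open_content (U i))" using open_content_UN U by auto
  also have "\<dots> \<le> (\<Sum>i. outer_content (A i) + ennreal (e * (1/2)^Suc i))"
    by (intro suminf_le U) auto
  also have "\<dots> = (\<Sum>i. outer_content (A i)) + (\<Sum>i. ennreal (e * (1/2)^Suc i))"
    by (rule suminf_add[symmetric]) auto
  also have "(\<Sum>i. ennreal (e * (1/2)^Suc i)) = ennreal e"
    using e power_half_series sums_mult[OF power_half_series, of e]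
    by (subst suminf_ennreal_eq[where x=e]) auto
  finally show "outer_content (\<Union>i. A i) \<le> (\<Sum>i. outer_content (A i)) + ennreal e" .
qed

lemma outer_content_empty: "outer_content {} = 0"
  using outer_content_open[of "{}"] open_content_empty by simp

lemma outer_measure_space_outer_content: "outer_measure_space (Pow UNIV) outer_content"
  unfolding outer_measure_space_def
  by (auto simp: positive_def increasing_def countably_subadditive_def
      intro: outer_content_empty outer_content_mono outer_content_UN)

text \<open>This is the inequality behind Caratheodory measurability of open sets. If
  \<open>h\<close> is subordinate to \<open>V\<close> minus the support \<open>K\<close> of
  \<open>g\<close>, then \<open>g + h\<close> is still at most 1. Removing \<open>K\<close> instead
  of \<open>U\<close> leaves an open set that contains \<open>V - U\<close>.\<close>

lemma open_content_Int_Diff: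
  assumes "open U" "open V"
  shows "open_content (V \<inter> U) + outer_content (V - U) \<le> open_content V"
proof -
  have *: "ennreal (\<phi> g) + outer_content (V - U) \<le> open_content V" if g: "g \<in> subordinate (V \<inter> U)" for g
  proof -
    note gD = subordinateD[OF g]
    define K where "K = closure {x. g x \<noteq> 0}"
    have K: "K \<subseteq> V \<inter> U" "closed K" using gD by (auto simp: K_def)
    have "ennreal (\<phi> g) + ennreal (\<phi> h) \<le> open_content V" if h: "h \<in> subordinate (V - K)" for h
    proof -
      note hD = subordinateD[OF h]
      have "g x + h x \<le> 1" for x
      proof (cases "x \<in> K")
        case True
        then have "h x = 0" using hD(4) zero_outside_closure[of x h] by blast
        then show ?thesis using gD by simp
      next
        case False
        then have "g x = 0" using zero_outside_closure[of x g] by (auto simp: K_def)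
        then show ?thesis using hD by simp
      qed
      moreover have "closure {x. g x + h x \<noteq> 0} \<subseteq> closure ({x. g x \<noteq> 0} \<union> {x. h x \<noteq> 0})"
        by (rule closure_mono) auto
      ultimately have "(\<lambda>x. g x + h x) \<in> subordinate V"
        using gD hD Cc_add[OF gD(1) hD(1)] by (auto simp: subordinate_def closure_Un)
      then have "ennreal (\<phi> (\<lambda>x. g x + h x)) \<le> open_content V" by (rule le_open_content)
      then show ?thesis using gD hD by (simp add: add)
    qed
    then have "(SUP h\<in>subordinate (V - K). ennreal (\<phi> g) + ennreal (\<phi> h)) \<le> open_content V"
      by (rule SUP_least)
    then have "ennreal (\<phi> g) + open_content (V - K) \<le> open_content V"
      unfolding open_content_def using subordinate_zero by (subst ennreal_SUP_add_right) auto
    moreover have "outer_content (V - U) \<le> open_content (V - K)"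
      by (rule outer_content_le) (use K assms in auto)
    ultimately show ?thesis by (meson add_left_mono order_trans)
  qed
  have "(SUP g\<in>subordinate (V \<inter> U). ennreal (\<phi> g) + outer_content (V - U)) \<le> open_content V"
    using * by (rule SUP_least)
  then show ?thesis
    unfolding open_content_def[of "V \<inter> U"] using subordinate_zero by (subst (asm) ennreal_SUP_add_left) auto
qed

lemma open_in_lambda_system:
  assumes "open U"
  shows "U \<in> lambda_system UNIV (Pow UNIV) outer_content"
proof -
  interpret sigma_algebra UNIV "Pow UNIV" by (rule sigma_algebra_Pow)
  have "outer_content (A \<inter> U) + outer_content (A - U) = outer_content A" for A
  proof (rule antisym)
    show "outer_content (A \<inter> U) + outer_content (A - U) \<le> outer_content A"
      unfolding outer_content_def[of A]
    proof (rule INF_greatest)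
      fix V assume V: "V \<in> {V. open V \<and> A \<subseteq> V}"
      have "outer_content (A \<inter> U) \<le> open_content (V \<inter> U)" "outer_content (A - U) \<le> outer_content (V - U)"
        using V assms by (auto intro!: outer_content_le outer_content_mono)
      then have "outer_content (A \<inter> U) + outer_content (A - U) \<le> open_content (V \<inter> U) + outer_content (V - U)"
        by (rule add_mono)
      then show "outer_content (A \<inter> U) + outer_content (A - U) \<le> open_content V"
        using open_content_Int_Diff[OF assms, of V] V by auto
    qed
    have "subadditive (Pow UNIV) outer_content"
      using outer_measure_space_outer_content countably_subadditive_subadditive
      by (auto simp: outer_measure_space_def)
    then have "outer_content ((A \<inter> U) \<union> (A - U)) \<le> outer_content (A \<inter> U) + outer_content (A - U)"
      by (intro subadditiveD[of "Pow UNIV"]) auto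
    then show "outer_content A \<le> outer_content (A \<inter> U) + outer_content (A - U)"
      by (simp add: Un_Diff_Int Un_commute)
  qed
  then show ?thesis unfolding lambda_system_eq by auto
qed

section \<open>The Borel measure given by the outer measure\<close>

definition riesz_measure :: "'a measure" where
  "riesz_measure = measure_of UNIV (sets borel) outer_content"

lemma sets_riesz_measure [measurable_cong, simp]: "sets riesz_measure = sets borel"
  unfolding riesz_measure_def using sets.sets_measure_of_eq[of "borel :: 'a measure"] by (simp)

lemma emeasure_riesz_measure:
  assumes "A \<in> sets borel"
  shows "emeasure riesz_measure A = outer_content A"
proof -
  let ?L = "lambda_system UNIV (Pow UNIV) outer_content"
  interpret P: sigma_algebra UNIV "Pow UNIV" by (rule sigma_algebra_Pow)
  have L: "measure_space UNIV ?L outer_content"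
    by (rule P.caratheodory_lemma[OF outer_measure_space_outer_content])
  then have "sigma_algebra UNIV ?L" by (simp add: measure_space_def)
  then have sub: "sets borel \<subseteq> ?L"
    unfolding borel_def using open_in_lambda_system sigma_algebra.sigma_sets_subset
    by (metis mem_Collect_eq sets_measure_of subsetI top_greatest Pow_UNIV)
  show ?thesis
    unfolding riesz_measure_def
  proof (rule emeasure_measure_of_sigma)
    show "sigma_algebra UNIV (sets borel :: 'a set set)"
      using sets.sigma_algebra_axioms[of "borel :: 'a measure"] by simp
    show "positive (sets borel) outer_content" by (simp add: positive_def outer_content_empty)
    show "countably_additive (sets borel) outer_content"
      using L sub by (auto simp: measure_space_def countably_additive_def)
  qed fact
qed

end

lemma integrable_Cc:
  fixes g :: "'a::t2_space \<Rightarrow> real"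
  assumes [measurable_cong]: "sets M = sets borel"
    and fin: "\<And>K. compact K \<Longrightarrow> emeasure M K < \<infinity>" and g: "g \<in> Cc"
  shows "integrable M g"
proof -
  obtain K where K: "compact K" "\<And>x. x \<notin> K \<Longrightarrow> g x = 0" using Cc_cases g by metis
  obtain B where "\<And>x. \<bar>g x\<bar> \<le> B" using Cc_bounded g by metis
  then show ?thesis
    using K fin[OF K(1)] assms(1) borel_measurable_continuous_onI[OF Cc_continuous[OF g]]
    by (intro integrableI_bounded_set[of K M g B])
      (auto simp: compact_imp_closed borel_closed measurable_cong_sets[OF assms(1) refl])
qed

lemma support_subsetD: "closure {x. g x \<noteq> 0} \<subseteq> U \<Longrightarrow> g x \<noteq> 0 \<Longrightarrow> x \<in> U"
  using zero_outside_closure by fast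

lemma positive_functional_integral:
  fixes M :: "'a::t2_space measure"
  assumes "locally_compact_space (euclidean :: 'a topology)"
    and "sets M = sets borel" "\<And>K. compact K \<Longrightarrow> emeasure M K < \<infinity>"
  shows "positive_functional (integral\<^sup>L M)"
  by unfold_locales (use assms integrable_Cc[OF assms(2,3)] in auto)

section \<open>Integrals against the Riesz measure\<close>

context positive_functional
begin

text \<open>For \<open>a < 1\<close> the open set where \<open>h > a\<close> contains
  \<open>K\<close>, and every function subordinate to it is at most \<open>h / a\<close>. Letting
  \<open>a\<close> tend to 1 removes the factor.\<close>

lemma outer_content_compact_le:
  assumes h: "h \<in> Cc" "\<And>x. 0 \<le> h x" and K: "\<And>x. x \<in> K \<Longrightarrow> 1 \<le> h x"
  shows "outer_content K \<le> ennreal (\<phi> h)"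
proof -
  have *: "outer_content K \<le> ennreal (\<phi> h / a)" if a: "0 < a" "a < 1" for a
  proof -
    have "outer_content K \<le> open_content {x. a < h x}"
      by (rule outer_content_le) (use a K in \<open>force intro!: open_Collect_less Cc_continuous h continuous_on_const\<close>)+
    also have "\<dots> \<le> ennreal (\<phi> h / a)"
      unfolding open_content_def
    proof (rule SUP_least)
      fix g assume g: "g \<in> subordinate {x. a < h x}"
      note gD = subordinateD[OF g]
      have "a * g x \<le> h x" for x
      proof (cases "g x = 0")
        case False
        then have "a < h x" using support_subsetD[OF gD(4)] by simp
        moreover have "a * g x \<le> a" using gD(3)[of x] a by (simp add: mult_left_le)
        ultimately show ?thesis by simp
      qed (use h in simp)
      then have "\<phi> (\<lambda>x. a * g x) \<le> \<phi> h" by (intro mono Cc_scale gD h)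
      then show "ennreal (\<phi> g) \<le> ennreal (\<phi> h / a)"
        using a gD by (intro ennreal_leI) (simp add: scale field_simps)
    qed
    finally show ?thesis .
  qed
  have ph: "0 \<le> \<phi> h" using nonneg h by blast
  obtain c where c: "0 \<le> c" "outer_content K = ennreal c"
    using *[of "1/2"] by (cases "outer_content K") (auto simp: top_unique)
  have "z * c \<le> \<phi> h" if "0 < z" "z < 1" for z
    using *[OF that] c ph that by (simp add: ennreal_le_iff field_simps)
  then have "c \<le> \<phi> h" by (rule field_le_mult_one_interval)
  then show ?thesis using c by (simp add: ennreal_leI)
qed

lemma le_outer_content:
  assumes "g \<in> subordinate K"
  shows "ennreal (\<phi> g) \<le> outer_content K"
  unfolding outer_content_def
  by (rule INF_greatest, rule le_open_content) (use assms in \<open>auto simp: subordinate_def\<close>)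

lemma emeasure_riesz_measure_compact:
  assumes "compact K"
  shows "emeasure riesz_measure K < \<infinity>"
proof -
  obtain h W where "h \<in> Cc" "\<And>x. 0 \<le> h x" "K \<subseteq> W" "\<And>x. x \<in> W \<Longrightarrow> h x = 1"
    using Urysohn_Cc[OF lc assms open_UNIV] by (metis subset_UNIV)
  then have "outer_content K \<le> ennreal (\<phi> h)"
    by (intro outer_content_compact_le) force+
  then show ?thesis
    using assms by (simp add: emeasure_riesz_measure borel_closed compact_imp_closed order_le_less_trans)
qed

text \<open>The slice of \<open>f\<close> between the levels \<open>k / n\<close> and \<open>(k + 1) / n\<close> is, up to the factor \<open>n\<close>,
  squeezed between the indicators of two consecutive superlevel sets.\<close>

lemma layer_bounds:
  fixes c :: "'a set \<Rightarrow> real" and n :: nat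
  assumes f: "f \<in> Cc" "\<And>x. 0 \<le> f x" "\<And>x. f x \<le> 1" and n: "0 < n"
    and upper: "\<And>g K. compact K \<Longrightarrow> g \<in> subordinate K \<Longrightarrow> \<phi> g \<le> c K"
    and lower: "\<And>g K. compact K \<Longrightarrow> g \<in> Cc \<Longrightarrow> (\<And>x. 0 \<le> g x) \<Longrightarrow> (\<And>x. x \<in> K \<Longrightarrow> 1 \<le> g x) \<Longrightarrow> c K \<le> \<phi> g"
  defines "L \<equiv> \<lambda>k. closure {x. f x \<noteq> 0} \<inter> {x. real k / real n \<le> f x}"
  shows "(\<Sum>k<n. c (L (Suc k))) \<le> n * \<phi> f" "n * \<phi> f \<le> (\<Sum>k<n. c (L k))"
proof -
  define s where "s k x = real n * (min (f x) (real (Suc k) / n) - min (f x) (real k / n))" for k x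
  have L: "compact (L k)" for k
    unfolding L_def using f
    by (intro compact_Int_closed Cc_compact_support closed_Collect_le continuous_on_const Cc_continuous) auto
  have s: "s k \<in> Cc" for k
    unfolding s_def
    by (rule Cc_comp[OF f(1), of "\<lambda>t. real n * (min t (real (Suc k) / n) - min t (real k / n))"])
      (intro continuous_intros, simp)
  have s01: "0 \<le> s k x" "s k x \<le> 1" for k x
    using n by (auto simp: s_def min_def field_simps)
  have sS: "s k x = 1" if "x \<in> L (Suc k)" for k x
  proof -
    have "real (Suc k) / n \<le> f x" "real k / n \<le> real (Suc k) / n"
      using that by (auto simp: L_def divide_right_mono)
    then have "s k x = n * (real (Suc k) / n - real k / n)" by (simp add: s_def)
    then show ?thesis using n by (simp add: field_simps)
  qed
  have sub: "closure {x. s k x \<noteq> 0} \<subseteq> L k" for k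
  proof (rule closure_minimal)
    show "closed (L k)" using L compact_imp_closed by blast
    have "f x \<noteq> 0 \<and> real k / n \<le> f x" if "s k x \<noteq> 0" for x
      using that n by (auto simp: s_def min_def field_simps split: if_splits)
    then show "{x. s k x \<noteq> 0} \<subseteq> L k" using closure_subset[of "{x. f x \<noteq> 0}"] by (auto simp: L_def)
  qed
  have "(\<Sum>k<n. s k x) = n * f x" for x
  proof -
    have "(\<Sum>k<n. s k x) = n * (\<Sum>k<n. min (f x) (real (Suc k) / n) - min (f x) (real k / n))"
      unfolding s_def by (rule sum_distrib_left[symmetric])
    also have "\<dots> = n * (min (f x) (real n / n) - min (f x) (real 0 / n))"
      by (subst sum_lessThan_telescope) simp
    finally show ?thesis using n f(2,3)[of x] by simp
  qed
  then have "n * \<phi> f = (\<Sum>k<n. \<phi> (s k))"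
    using sum[of "{..<n}" s] s scale[OF f(1), of n] by simp
  moreover have "(\<Sum>k<n. c (L (Suc k))) \<le> (\<Sum>k<n. \<phi> (s k))"
    by (intro sum_mono lower L s) (auto simp: s01 sS)
  moreover have "(\<Sum>k<n. \<phi> (s k)) \<le> (\<Sum>k<n. c (L k))"
    by (intro sum_mono upper L) (use s s01 sub in \<open>auto simp: subordinate_def\<close>)
  ultimately show "(\<Sum>k<n. c (L (Suc k))) \<le> n * \<phi> f" "n * \<phi> f \<le> (\<Sum>k<n. c (L k))" by auto
qed

text \<open>\<open>layer_bounds\<close> applies to \<open>\<phi>\<close> and to the integral with
  the same \<open>c\<close>, the measure of compact sets. Hence \<open>n\<close> times either number
  lies between the same two sums, whose difference telescopes and is at most the measure of the
  support, for every \<open>n\<close>. Dividing by \<open>n\<close> forces equality.\<close>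

lemma integral_riesz_measure_unit:
  assumes f: "f \<in> Cc" "\<And>x. 0 \<le> f x" "\<And>x. f x \<le> 1"
  shows "integral\<^sup>L riesz_measure f = \<phi> f"
proof -
  let ?M = riesz_measure
  interpret I: positive_functional "integral\<^sup>L ?M"
    by (rule positive_functional_integral) (use lc emeasure_riesz_measure_compact in auto)
  define c where "c = measure ?M"
  have int: "integrable ?M g" if "g \<in> Cc" for g
    by (rule integrable_Cc) (use emeasure_riesz_measure_compact that in auto)
  have oc: "outer_content K = ennreal (c K)" if "compact K" for K
    using emeasure_riesz_measure_compact[OF that] emeasure_riesz_measure[of K] that
    by (metis borel_closed c_def compact_imp_closed emeasure_eq_ennreal_measure infinity_ennreal_def
        order_less_irrefl)
  have c0: "0 \<le> c K" for K by (simp add: c_def)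
  have u1: "\<phi> g \<le> c K" if "compact K" "g \<in> subordinate K" for g K
    using le_outer_content[OF that(2)] oc[OF that(1)] c0 by simp
  have l1: "c K \<le> \<phi> g" if "compact K" "g \<in> Cc" "\<And>x. 0 \<le> g x" "\<And>x. x \<in> K \<Longrightarrow> 1 \<le> g x" for g K
    using outer_content_compact_le[OF that(2-4), of K] oc[OF that(1)] c0[of K] nonneg[OF that(2,3)] by simp
  have intK: "integrable ?M (indicator K :: 'a \<Rightarrow> real)" "integral\<^sup>L ?M (indicator K) = c K" if "compact K" for K
    using emeasure_riesz_measure_compact[OF that] compact_imp_closed[OF that] by (auto simp: c_def borel_closed)
  have u2: "integral\<^sup>L ?M g \<le> c K" if "compact K" "g \<in> I.subordinate K" for g K
  proof -
    have "g x \<le> indicator K x" for x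
      using I.subordinateD[OF that(2)] support_subsetD[OF I.subordinateD(4)[OF that(2)], of x]
      by (cases "g x = 0") auto
    then have "integral\<^sup>L ?M g \<le> integral\<^sup>L ?M (indicator K)"
      by (intro integral_mono int intK that I.subordinateD[OF that(2)])
    then show ?thesis using intK that by simp
  qed
  have l2: "c K \<le> integral\<^sup>L ?M g" if "compact K" "g \<in> Cc" "\<And>x. 0 \<le> g x" "\<And>x. x \<in> K \<Longrightarrow> 1 \<le> g x" for g K
  proof -
    have "indicator K x \<le> g x" for x
      using that by (cases "x \<in> K") auto
    then have "integral\<^sup>L ?M (indicator K) \<le> integral\<^sup>L ?M g"
      by (intro integral_mono int intK that)
    then show ?thesis using intK that by simp
  qed
  define L where "L n k = closure {x. f x \<noteq> 0} \<inter> {x. real k / real n \<le> f x}" for n k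
  have "\<bar>integral\<^sup>L ?M f - \<phi> f\<bar> * n \<le> c (L n 0)" if n: "0 < n" for n
  proof -
    have 1: "(\<Sum>k<n. c (L n (Suc k))) \<le> n * \<phi> f" "n * \<phi> f \<le> (\<Sum>k<n. c (L n k))"
      unfolding L_def by (rule layer_bounds[OF f n, where c = c]; rule u1 l1; assumption)+
    have 2: "(\<Sum>k<n. c (L n (Suc k))) \<le> n * integral\<^sup>L ?M f" "n * integral\<^sup>L ?M f \<le> (\<Sum>k<n. c (L n k))"
      unfolding L_def by (rule I.layer_bounds[OF f n, where c = c]; rule u2 l2; assumption)+
    have "(\<Sum>k<n. c (L n k)) - (\<Sum>k<n. c (L n (Suc k))) = c (L n 0) - c (L n n)"
      by (subst sum_subtractf[symmetric]) (rule sum_lessThan_telescope')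
    then have "\<bar>n * integral\<^sup>L ?M f - n * \<phi> f\<bar> \<le> c (L n 0)"
      using 1 2 c0[of "L n n"] by linarith
    moreover have "n * integral\<^sup>L ?M f - n * \<phi> f = n * (integral\<^sup>L ?M f - \<phi> f)"
      by (simp add: algebra_simps)
    ultimately show ?thesis by (simp add: abs_mult mult.commute)
  qed
  moreover have "L n 0 = closure {x. f x \<noteq> 0}" for n
    using f by (auto simp: L_def)
  ultimately have *: "\<bar>integral\<^sup>L ?M f - \<phi> f\<bar> * n \<le> c (closure {x. f x \<noteq> 0})" if "0 < n" for n :: nat
    using that by metis
  show ?thesis
  proof (rule ccontr)
    assume "integral\<^sup>L ?M f \<noteq> \<phi> f"
    then have "0 < \<bar>integral\<^sup>L ?M f - \<phi> f\<bar>" by simp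
    then obtain n :: nat where "c (closure {x. f x \<noteq> 0}) < n * \<bar>integral\<^sup>L ?M f - \<phi> f\<bar>"
      using reals_Archimedean3 by metis
    then show False
      using *[of n] c0[of "closure {x. f x \<noteq> 0}"] by (cases "n = 0") (auto simp: mult.commute)
  qed
qed

lemma integral_riesz_measure:
  assumes f: "f \<in> Cc"
  shows "integral\<^sup>L riesz_measure f = \<phi> f"
proof -
  interpret I: positive_functional "integral\<^sup>L riesz_measure"
    by (rule positive_functional_integral) (use lc emeasure_riesz_measure_compact in auto)
  obtain B where B: "0 \<le> B" "\<And>x. \<bar>f x\<bar> \<le> B" using Cc_bounded f by metis
  \<comment> \<open>The added 1 keeps the divisor positive also when \<open>f\<close> vanishes;
    \<open>p\<close> and \<open>q\<close> are the positive and negative parts of \<open>f\<close>,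
    scaled into [0, 1].\<close>
  define b where "b = B + 1"
  have b: "b > 0" "\<And>x. \<bar>f x\<bar> \<le> b" using B by (auto simp: b_def add_increasing2)
  define p q where "p = (\<lambda>x. (1/b) * max (f x) 0)" and "q = (\<lambda>x. (1/b) * max (- f x) 0)"
  have "p \<in> Cc"
    unfolding p_def
    by (rule Cc_comp[OF f, of "\<lambda>t. (1/b) * max t 0"]) (intro continuous_intros, simp)
  then have p: "p \<in> Cc" "\<And>x. 0 \<le> p x" "\<And>x. p x \<le> 1"
    using b abs_le_D1[OF b(2)] by (auto simp: p_def)
  have "q \<in> Cc"
    unfolding q_def
    by (rule Cc_comp[OF f, of "\<lambda>t. (1/b) * max (- t) 0"]) (intro continuous_intros, simp)
  then have q: "q \<in> Cc" "\<And>x. 0 \<le> q x" "\<And>x. q x \<le> 1"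
    using b abs_le_D2[OF b(2)] by (auto simp: q_def)
  have "f = (\<lambda>x. b * (p x - q x))"
    using b by (auto simp: p_def q_def max_def)
  moreover have "integral\<^sup>L riesz_measure (\<lambda>x. b * (p x - q x)) = \<phi> (\<lambda>x. b * (p x - q x))"
    by (simp only: scale I.scale diff I.diff Cc_diff p(1) q(1) integral_riesz_measure_unit[OF p]
        integral_riesz_measure_unit[OF q])
  ultimately show ?thesis by simp
qed

text \<open>Outer regularity is built into \<open>outer_content\<close>. For inner regularity on
  open sets the approximating compact sets are the supports of subordinate functions, by
  \<open>le_outer_content\<close>.\<close>

lemma regular_riesz_measure: "regular_borel_measure riesz_measure"
proof -
  have "outer_content U \<le> (SUP K\<in>{K. compact K \<and> K \<subseteq> U}. outer_content K)" if "open U" for U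
    unfolding outer_content_open[OF that] open_content_def[of U]
  proof (rule SUP_least)
    fix g assume g: "g \<in> subordinate U"
    then have "g \<in> subordinate (closure {x. g x \<noteq> 0})" by (simp add: subordinate_def)
    then have "ennreal (\<phi> g) \<le> outer_content (closure {x. g x \<noteq> 0})" by (rule le_outer_content)
    also have "\<dots> \<le> (SUP K\<in>{K. compact K \<and> K \<subseteq> U}. outer_content K)"
      by (rule SUP_upper) (use subordinateD[OF g] Cc_compact_support in auto)
    finally show "ennreal (\<phi> g) \<le> (SUP K\<in>{K. compact K \<and> K \<subseteq> U}. outer_content K)" .
  qed
  then have inner: "outer_content U = (SUP K\<in>{K. compact K \<and> K \<subseteq> U}. outer_content K)" if "open U" for U
    using that by (intro antisym SUP_least outer_content_mono) auto
  have outer: "outer_content A = (INF U\<in>{U. open U \<and> A \<subseteq> U}. outer_content U)" for A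
    unfolding outer_content_def[of A] by (rule INF_cong) (auto simp: outer_content_open)
  have 1: "emeasure riesz_measure A = (INF U\<in>{U. open U \<and> A \<subseteq> U}. emeasure riesz_measure U)"
    if "A \<in> sets borel" for A
    unfolding emeasure_riesz_measure[OF that] outer[of A]
    by (rule INF_cong) (auto simp: emeasure_riesz_measure)
  have 2: "emeasure riesz_measure U = (SUP K\<in>{K. compact K \<and> K \<subseteq> U}. emeasure riesz_measure K)"
    if "open U" for U
    using that inner[OF that]
    by (auto simp: emeasure_riesz_measure borel_closed compact_imp_closed intro!: SUP_cong)
  show ?thesis
    unfolding regular_borel_measure_def
    using 1 2 emeasure_riesz_measure_compact by auto
qed

end

section \<open>Interchanging a positive functional and an integral\<close>

lemma continuous_on_realI:
  fixes f :: "'b::topological_space \<Rightarrow> real"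
  assumes "\<And>x e. x \<in> S \<Longrightarrow> 0 < e \<Longrightarrow> \<exists>X. open X \<and> x \<in> X \<and> (\<forall>z\<in>X \<inter> S. \<bar>f z - f x\<bar> < e)"
  shows "continuous_on S f"
  unfolding continuous_on_def tendsto_iff eventually_at_topological dist_real_def
  using assms by (meson IntI)

text \<open>Supplies the cells and sample points of a Riemann sum on a compact space that need not
  be metrizable: a finite subcover by the prescribed neighbourhoods, made disjoint.\<close>

lemma compact_sampling:
  fixes T :: "'b::t2_space set"
  assumes T: "compact T" and X: "\<And>s. s \<in> T \<Longrightarrow> open (X s)" "\<And>s. s \<in> T \<Longrightarrow> s \<in> X s"
  obtains n :: nat and s B where "\<And>i. i < n \<Longrightarrow> s i \<in> T" "\<And>i. i < n \<Longrightarrow> B i \<in> sets borel"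
    "\<And>i. i < n \<Longrightarrow> B i \<subseteq> X (s i)" "disjoint_family B" "(\<Union>i<n. B i) = T"
proof -
  have "T \<subseteq> (\<Union>s\<in>T. X s)" using X(2) by blast
  then obtain D where D: "D \<subseteq> T" "finite D" "T \<subseteq> (\<Union>s\<in>D. X s)"
    by (rule compactE_image[OF T X(1), rotated]) 
  obtain n :: nat and s where s: "D = s ` {i. i < n}"
    using finite_imp_nat_seg_image_inj_on[OF D(2)] by blast
  \<comment> \<open>\<open>disjointed\<close> works on a sequence indexed by all naturals, so the
    indices from \<open>n\<close> on receive the empty set.\<close>
  define B where "B i = T \<inter> disjointed (\<lambda>i. if i < n then X (s i) else {}) i" for i
  have sT: "s i \<in> T" if "i < n" for i using D(1) s that by auto
  have op: "open (if i < n then X (s i) else {})" for i using X(1) sT by simp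
  show thesis
  proof
    show "B i \<in> sets borel" if "i < n" for i
      unfolding B_def disjointed_def using T op
      by (intro sets.Int sets.Diff sets.finite_UN) (auto simp: borel_closed compact_imp_closed intro: borel_open)
    show "B i \<subseteq> X (s i)" if "i < n" for i
      using disjointed_subset[of "\<lambda>i. if i < n then X (s i) else {}" i] that by (auto simp: B_def)
    show "disjoint_family B"
      using disjoint_family_disjointed[of "\<lambda>i. if i < n then X (s i) else {}"]
      by (fastforce simp: B_def disjoint_family_on_def)
    have "(\<Union>i<n. B i) = T \<inter> (\<Union>i\<in>{0..<n}. disjointed (\<lambda>i. if i < n then X (s i) else {}) i)"
      by (auto simp: B_def)
    also have "\<dots> = T \<inter> (\<Union>i\<in>{0..<n}. if i < n then X (s i) else {})"
      by (simp only: finite_UN_disjointed_eq)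
    also have "(\<Union>i\<in>{0..<n}. if i < n then X (s i) else {}) = (\<Union>s\<in>D. X s)"
      by (auto simp: s)
    also have "T \<inter> (\<Union>s\<in>D. X s) = T" using D(3) by (rule Int_absorb2)
    finally show "(\<Union>i<n. B i) = T" .
  qed (use sT in auto)
qed

lemma integrable_indicator_continuous:
  fixes f :: "'b::t2_space \<Rightarrow> real"
  assumes "finite_measure \<rho>" and \<rho>: "sets \<rho> = sets borel" and T: "compact T" and f: "continuous_on T f"
  shows "integrable \<rho> (\<lambda>t. indicator T t * f t)"
proof -
  interpret finite_measure \<rho> by fact
  obtain B where B: "\<And>t. t \<in> T \<Longrightarrow> norm (f t) \<le> B"
    using compact_imp_bounded[OF compact_continuous_image[OF f T]] by (auto simp: bounded_iff)
  have "(\<lambda>t. indicator T t *\<^sub>R f t) \<in> borel_measurable borel"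
    by (rule borel_measurable_continuous_on_indicator) (use T f in \<open>auto simp: borel_closed compact_imp_closed\<close>)
  then have "(\<lambda>t. indicator T t * f t) \<in> borel_measurable \<rho>"
    by (simp add: measurable_cong_sets[OF \<rho> refl])
  moreover have "norm (indicator T t * f t) \<le> \<bar>B\<bar>" for t
    using B[of t] by (cases "t \<in> T") auto
  ultimately show ?thesis by (intro integrable_const_bound[of _ "\<bar>B\<bar>"]) auto
qed

lemma sampling_error:
  fixes f :: "'b::t2_space \<Rightarrow> real" and n :: nat
  assumes fin: "finite_measure \<rho>" and \<rho>: "sets \<rho> = sets borel" and T: "compact T" and f: "continuous_on T f"
    and B: "\<And>i. i < n \<Longrightarrow> B i \<in> sets borel" "disjoint_family B" "(\<Union>i<n. B i) = T"
    and v: "\<And>i t. i < n \<Longrightarrow> t \<in> B i \<Longrightarrow> \<bar>f t - v i\<bar> \<le> \<epsilon>"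
  shows "\<bar>(\<integral>t. indicator T t * f t \<partial>\<rho>) - (\<Sum>i<n. measure \<rho> (B i) * v i)\<bar> \<le> \<epsilon> * measure \<rho> T"
proof -
  interpret finite_measure \<rho> by fact
  let ?S = "\<lambda>t. \<Sum>i<n. indicator (B i) t * v i"
  have sp: "space \<rho> = UNIV" using sets_eq_imp_space_eq[OF \<rho>] by simp
  have Tm: "T \<in> sets \<rho>" using T \<rho> by (simp add: borel_closed compact_imp_closed)
  have iB: "integrable \<rho> (\<lambda>t. indicator (B i) t * v i)" if "i < n" for i
    using B(1)[OF that] \<rho> by (intro integrable_mult_left integrable_real_indicator) (auto simp: less_top[symmetric])
  then have iS: "integrable \<rho> ?S" by (intro Bochner_Integration.integrable_sum) auto
  have "integral\<^sup>L \<rho> ?S = (\<Sum>i<n. measure \<rho> (B i) * v i)"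
    using iB B(1) \<rho> sp by (subst Bochner_Integration.integral_sum) (auto simp: Int_absorb2)
  moreover have if': "integrable \<rho> (\<lambda>t. indicator T t * f t)"
    by (rule integrable_indicator_continuous) fact+
  ultimately have "(\<integral>t. indicator T t * f t \<partial>\<rho>) - (\<Sum>i<n. measure \<rho> (B i) * v i)
      = (\<integral>t. indicator T t * f t - ?S t \<partial>\<rho>)"
    using iS by (subst Bochner_Integration.integral_diff) auto
  also have "\<bar>\<dots>\<bar> \<le> (\<integral>t. \<bar>indicator T t * f t - ?S t\<bar> \<partial>\<rho>)"
    by (rule integral_abs_bound)
  also have "\<dots> \<le> (\<integral>t. \<epsilon> * indicator T t \<partial>\<rho>)"
  proof (rule integral_mono)
    show "integrable \<rho> (\<lambda>t. \<bar>indicator T t * f t - ?S t\<bar>)" using if' iS by simp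
    show "integrable \<rho> (\<lambda>t. \<epsilon> * indicator T t)"
      using Tm by (intro integrable_mult_right integrable_real_indicator) (auto simp: less_top[symmetric])
    fix t
    show "\<bar>indicator T t * f t - ?S t\<bar> \<le> \<epsilon> * indicator T t"
    proof (cases "t \<in> T")
      case True
      then obtain i where i: "i < n" "t \<in> B i" using B(3) by blast
      have "indicator (B j) t = (if j = i then 1 else 0 :: real)" for j
        using i(2) B(2) by (auto simp: disjoint_family_on_def indicator_def)
      then have "?S t = v i" using i(1) by (simp add: if_distrib[of "\<lambda>x. x * _"] cong: if_cong)
      then show ?thesis using v[OF i] True by simp
    next
      case False
      then have "?S t = 0" using B(3) by (intro sum.neutral) auto
      then show ?thesis using False by simp
    qed
  qed
  also have "\<dots> = \<epsilon> * measure \<rho> T" using Tm sp by (simp add: Int_absorb2)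
  finally show ?thesis .
qed

text \<open>The tube lemma over the compact set \<open>T\<close> gives closeness uniform in
  \<open>t\<close>. Dominated convergence would speak about sequences, which do not detect
  continuity on a general Hausdorff space.\<close>

lemma continuous_integral_indicator:
  fixes G :: "'b::t2_space \<Rightarrow> 'a::topological_space \<Rightarrow> real"
  assumes fin: "finite_measure \<rho>" and \<rho>: "sets \<rho> = sets borel" and T: "compact T"
    and G: "continuous_on UNIV (\<lambda>(t, y). G t y)"
  shows "continuous_on UNIV (\<lambda>y. \<integral>t. indicator T t * G t y \<partial>\<rho>)" (is "continuous_on UNIV ?u")
proof (rule continuous_on_realI)
  interpret finite_measure \<rho> by fact
  have cG2: "continuous_on A (\<lambda>t. G t y)" for y A
    using continuous_on_compose2[OF G continuous_on_Pair[OF continuous_on_id continuous_on_const]] by simp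
  have iG: "integrable \<rho> (\<lambda>t. indicator T t * G t y)" for y
    by (rule integrable_indicator_continuous[OF fin \<rho> T cG2])
  have sp: "space \<rho> = UNIV" using sets_eq_imp_space_eq[OF \<rho>] by simp
  have Tm: "T \<in> sets \<rho>" using T \<rho> by (simp add: borel_closed compact_imp_closed)
  fix y and e :: real assume e: "0 < e"
  \<comment> \<open>The added 1 covers the case that \<open>T\<close> is a null set and makes the
    final estimate strict.\<close>
  define \<epsilon> where "\<epsilon> = e / (measure \<rho> T + 1)"
  have \<epsilon>: "0 < \<epsilon>" using e by (simp add: \<epsilon>_def add_nonneg_pos)
  have "continuous_on UNIV (\<lambda>(y, t). G t y)"
    using continuous_on_compose2[OF G continuous_on_swap[of UNIV]] by (simp add: case_prod_beta)
  then have "continuous_on (UNIV \<times> T) (\<lambda>(y, t). G t y)" by (rule continuous_on_subset) simp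
  from continuous_on_prod_compactE[OF this T UNIV_I \<epsilon>, of y] obtain X where
    "y \<in> X" "open X" "\<forall>z\<in>X \<inter> UNIV. \<forall>t\<in>T. dist (case (z, t) of (y, t) \<Rightarrow> G t y) (case (y, t) of (y, t) \<Rightarrow> G t y) \<le> \<epsilon>" .
  then have X: "open X" "y \<in> X" "\<And>z t. z \<in> X \<Longrightarrow> t \<in> T \<Longrightarrow> \<bar>G t z - G t y\<bar> \<le> \<epsilon>"
    by (simp_all add: dist_real_def)
  have "\<bar>?u z - ?u y\<bar> < e" if "z \<in> X" for z
  proof -
    have "?u z - ?u y = (\<integral>t. indicator T t * G t z - indicator T t * G t y \<partial>\<rho>)"
      by (rule Bochner_Integration.integral_diff[symmetric]) (rule iG)+
    also have "\<bar>\<dots>\<bar> \<le> (\<integral>t. \<bar>indicator T t * G t z - indicator T t * G t y\<bar> \<partial>\<rho>)"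
      by (rule integral_abs_bound)
    also have "\<dots> \<le> (\<integral>t. \<epsilon> * indicator T t \<partial>\<rho>)"
    proof (rule integral_mono)
      show "integrable \<rho> (\<lambda>t. \<bar>indicator T t * G t z - indicator T t * G t y\<bar>)"
        by (intro integrable_abs Bochner_Integration.integrable_diff iG)
      show "integrable \<rho> (\<lambda>t. \<epsilon> * indicator T t)"
        using Tm by (intro integrable_mult_right integrable_real_indicator) (auto simp: less_top[symmetric])
    qed (use X(3) that in \<open>auto simp: indicator_def\<close>)
    also have "\<dots> = \<epsilon> * measure \<rho> T" using Tm sp by (simp add: Int_absorb2)
    also have "\<dots> < \<epsilon> * (measure \<rho> T + 1)" using \<epsilon> by simp
    also have "\<dots> = e" by (simp add: \<epsilon>_def add_nonneg_eq_0_iff)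
    finally show ?thesis .
  qed
  with X show "\<exists>X. open X \<and> y \<in> X \<and> (\<forall>z\<in>X \<inter> UNIV. \<bar>?u z - ?u y\<bar> < e)" by blast
qed

context positive_functional
begin

text \<open>A Fubini theorem in which one side is a mere functional. One Riemann sum approximates
  both sides: a function \<open>h\<close> equal to 1 on \<open>K\<close> turns a uniform error
  \<open>\<epsilon>\<close> on \<open>K\<close> into an error \<open>\<epsilon> * \<phi> h\<close>
  after applying \<open>\<phi>\<close>.\<close>

lemma interchange:
  fixes G :: "'b::t2_space \<Rightarrow> 'a \<Rightarrow> real"
  assumes fin: "finite_measure \<rho>" and \<rho>: "sets \<rho> = sets borel" and T: "compact T" and K: "compact K"
    and G: "continuous_on UNIV (\<lambda>(t, y). G t y)"
    and GK: "\<And>t y. t \<in> T \<Longrightarrow> y \<notin> K \<Longrightarrow> G t y = 0"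
  shows "(\<lambda>y. \<integral>t. indicator T t * G t y \<partial>\<rho>) \<in> Cc" (is "?u \<in> Cc")
    and "continuous_on T (\<lambda>t. \<phi> (G t))"
    and "\<phi> (\<lambda>y. \<integral>t. indicator T t * G t y \<partial>\<rho>) = (\<integral>t. indicator T t * \<phi> (G t) \<partial>\<rho>)"
proof -
  interpret finite_measure \<rho> by fact
  have cG1: "continuous_on UNIV (\<lambda>y. G t y)" for t
    using continuous_on_compose2[OF G continuous_on_Pair[OF continuous_on_const continuous_on_id]] by simp
  have cG2: "continuous_on A (\<lambda>t. G t y)" for y A
    using continuous_on_compose2[OF G continuous_on_Pair[OF continuous_on_id continuous_on_const]] by simp
  have GCc: "G t \<in> Cc" if "t \<in> T" for t
    using CcI[OF cG1 K] GK that by auto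
  have iG: "integrable \<rho> (\<lambda>t. indicator T t * G t y)" for y
    by (rule integrable_indicator_continuous[OF fin \<rho> T cG2])
  have sp: "space \<rho> = UNIV" using sets_eq_imp_space_eq[OF \<rho>] by simp
  have Tm: "T \<in> sets \<rho>" using T \<rho> by (simp add: borel_closed compact_imp_closed)
  obtain h W where h: "h \<in> Cc" "\<And>x. 0 \<le> h x" "K \<subseteq> W" "\<And>x. x \<in> W \<Longrightarrow> h x = 1"
    using Urysohn_Cc[OF lc K open_UNIV] by (metis subset_UNIV)
  have hK: "\<And>x. x \<in> K \<Longrightarrow> h x = 1" using h by blast
  have ph: "0 \<le> \<phi> h" using nonneg h by blast
  have bound: "\<bar>\<phi> f - \<phi> g\<bar> \<le> \<epsilon> * \<phi> h"
    if "f \<in> Cc" "g \<in> Cc" "\<And>y. y \<in> K \<Longrightarrow> \<bar>f y - g y\<bar> \<le> \<epsilon>" "\<And>y. y \<notin> K \<Longrightarrow> f y = 0" "\<And>y. y \<notin> K \<Longrightarrow> g y = 0"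
      "0 \<le> \<epsilon>" for f g \<epsilon>
  proof -
    have "\<bar>f y - g y\<bar> \<le> \<epsilon> * h y" for y
      by (cases "y \<in> K") (use that hK h(2) in auto)
    then show ?thesis using abs_le[OF Cc_diff[OF that(1,2)] h(1), of \<epsilon>] diff[OF that(1,2)] by simp
  qed
  have near: "\<exists>X. open X \<and> s \<in> X \<and> (\<forall>t\<in>X. \<forall>y\<in>K. \<bar>G t y - G s y\<bar> \<le> \<epsilon>)" if "0 < \<epsilon>" for s \<epsilon>
  proof -
    have "continuous_on (UNIV \<times> K) (\<lambda>(t, y). G t y)" using G by (rule continuous_on_subset) simp
    from continuous_on_prod_compactE[OF this K UNIV_I that, of s] obtain X where
      "s \<in> X" "open X" "\<forall>t\<in>X \<inter> UNIV. \<forall>y\<in>K. dist (case (t, y) of (t, y) \<Rightarrow> G t y) (case (s, y) of (t, y) \<Rightarrow> G t y) \<le> \<epsilon>" .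
    then show ?thesis by (intro exI[of _ X]) (simp add: dist_real_def)
  qed
  show c\<phi>: "continuous_on T (\<lambda>t. \<phi> (G t))"
  proof (rule continuous_on_realI)
    fix s and e :: real assume s: "s \<in> T" and e: "0 < e"
    then have e': "0 < e / (\<phi> h + 1)" using ph by simp
    obtain X where X: "open X" "s \<in> X" "\<forall>t\<in>X. \<forall>y\<in>K. \<bar>G t y - G s y\<bar> \<le> e / (\<phi> h + 1)"
      using near[OF e'] by blast
    have "\<bar>\<phi> (G t) - \<phi> (G s)\<bar> < e" if "t \<in> X \<inter> T" for t
    proof -
      have "\<bar>\<phi> (G t) - \<phi> (G s)\<bar> \<le> e / (\<phi> h + 1) * \<phi> h"
        by (rule bound) (use that s X e' GCc GK in auto)
      also have "\<dots> < e" using ph e by (simp add: field_simps)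
      finally show ?thesis .
    qed
    with X show "\<exists>X. open X \<and> s \<in> X \<and> (\<forall>t\<in>X \<inter> T. \<bar>\<phi> (G t) - \<phi> (G s)\<bar> < e)" by blast
  qed
  have uK: "?u y = 0" if "y \<notin> K" for y
  proof -
    have "(\<lambda>t. indicator T t * G t y) = (\<lambda>t. 0)" using GK that by (auto simp: indicator_def)
    then show ?thesis by simp
  qed
  show u: "?u \<in> Cc"
  proof (rule CcI[OF _ K])
    show "?u y = 0" if "y \<notin> K" for y
      by (rule uK[OF that])
    show "continuous_on UNIV ?u"
      by (rule continuous_integral_indicator[OF fin \<rho> T G])
  qed
  show "\<phi> ?u = (\<integral>t. indicator T t * \<phi> (G t) \<partial>\<rho>)"
  proof -
    have *: "\<bar>\<phi> ?u - (\<integral>t. indicator T t * \<phi> (G t) \<partial>\<rho>)\<bar> \<le> \<epsilon> * (2 * measure \<rho> T * \<phi> h)" if \<epsilon>: "0 < \<epsilon>" for \<epsilon>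
    proof -
      obtain X where X: "\<And>s. open (X s)" "\<And>s. s \<in> X s" "\<And>s t y. t \<in> X s \<Longrightarrow> y \<in> K \<Longrightarrow> \<bar>G t y - G s y\<bar> \<le> \<epsilon>"
        using near[OF \<epsilon>] by metis
      obtain n :: nat and s B where B: "\<And>i. i < n \<Longrightarrow> s i \<in> T" "\<And>i. i < n \<Longrightarrow> B i \<in> sets borel"
        "\<And>i. i < n \<Longrightarrow> B i \<subseteq> X (s i)" "disjoint_family B" "(\<Union>i<n. B i) = T"
        using compact_sampling[OF T, of X] X(1,2) by metis
      let ?w = "\<lambda>y. \<Sum>i<n. measure \<rho> (B i) * G (s i) y"
      have w: "?w \<in> Cc" by (intro Cc_sum Cc_scale GCc B) auto
      have "\<phi> ?w = (\<Sum>i<n. measure \<rho> (B i) * \<phi> (G (s i)))"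
        using B(1) by (subst sum) (auto intro!: Cc_scale GCc scale sum.cong)
      moreover have "\<bar>(\<integral>t. indicator T t * \<phi> (G t) \<partial>\<rho>) - (\<Sum>i<n. measure \<rho> (B i) * \<phi> (G (s i)))\<bar>
          \<le> (\<epsilon> * \<phi> h) * measure \<rho> T"
      proof (rule sampling_error[OF fin \<rho> T c\<phi> B(2,4,5)])
        fix i t assume i: "i < n" and t: "t \<in> B i"
        then have tT: "t \<in> T" and tX: "t \<in> X (s i)" using B(3,5) by blast+
        show "\<bar>\<phi> (G t) - \<phi> (G (s i))\<bar> \<le> \<epsilon> * \<phi> h"
          by (rule bound) (use tT B(1)[OF i] GCc GK X(3)[OF tX] \<epsilon> in auto)
      qed
      moreover have "\<bar>\<phi> ?u - \<phi> ?w\<bar> \<le> (\<epsilon> * measure \<rho> T) * \<phi> h"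
      proof (rule bound[OF u w])
        show "\<bar>?u y - ?w y\<bar> \<le> \<epsilon> * measure \<rho> T" if "y \<in> K" for y
        proof (rule sampling_error[OF fin \<rho> T cG2 B(2,4,5)])
          show "\<bar>G t y - G (s i) y\<bar> \<le> \<epsilon>" if "i < n" "t \<in> B i" for i t
            using X(3)[OF _ \<open>y \<in> K\<close>] B(3) that by blast
        qed
        show "?u y = 0" if "y \<notin> K" for y by (rule uK[OF that])
        show "?w y = 0" if "y \<notin> K" for y using GK that B by (intro sum.neutral) auto
      qed (use \<epsilon> in auto)
      ultimately show ?thesis by (simp add: algebra_simps)
    qed
    define d c where "d = \<bar>\<phi> ?u - (\<integral>t. indicator T t * \<phi> (G t) \<partial>\<rho>)\<bar>" and "c = 2 * measure \<rho> T * \<phi> h"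
    have "0 \<le> c" using ph by (simp add: c_def)
    have "d \<le> 0 + e" if "0 < e" for e
    proof -
      have "d \<le> (e / (c + 1)) * c"
        using *[of "e / (c + 1)"] that \<open>0 \<le> c\<close> unfolding d_def[symmetric] c_def[symmetric] by simp
      also have "\<dots> \<le> e" using \<open>0 \<le> c\<close> that by (simp add: field_simps)
      finally show ?thesis by simp
    qed
    then have "d \<le> 0" by (rule field_le_epsilon)
    then show ?thesis by (simp add: d_def)
  qed
qed

end

section \<open>Hahn-Banach extension\<close>

definition sublinear_on :: "('x \<Rightarrow> real) set \<Rightarrow> (('x \<Rightarrow> real) \<Rightarrow> real) \<Rightarrow> bool" where
  "sublinear_on V q \<longleftrightarrow>
     (\<forall>f\<in>V. \<forall>g\<in>V. q (\<lambda>x. f x + g x) \<le> q f + q g) \<and>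
     (\<forall>f\<in>V. \<forall>c\<ge>0. q (\<lambda>x. c * f x) = c * q f)"

context
  fixes V :: "('x \<Rightarrow> real) set"
  assumes V_zero: "(\<lambda>x. 0) \<in> V"
    and V_add: "\<And>f g. f \<in> V \<Longrightarrow> g \<in> V \<Longrightarrow> (\<lambda>x. f x + g x) \<in> V"
    and V_scale: "\<And>f c. f \<in> V \<Longrightarrow> (\<lambda>x. c * f x) \<in> V"
begin

lemma sublinear_onD:
  assumes "sublinear_on V q" "f \<in> V"
  shows "g \<in> V \<Longrightarrow> q (\<lambda>x. f x + g x) \<le> q f + q g" and "0 \<le> c \<Longrightarrow> q (\<lambda>x. c * f x) = c * q f"
  using assms by (simp_all add: sublinear_on_def)

lemma sublinear_on_zero: "sublinear_on V q \<Longrightarrow> q (\<lambda>x. 0) = 0"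
  using V_zero unfolding sublinear_on_def by (auto dest!: bspec[of V _ "\<lambda>x. 0"] spec[of _ 0])

text \<open>The one-sided scaling inequality for the factor \<open>1 / c\<close> is the reverse
  inequality for \<open>c\<close>.\<close>

lemma sublinear_onI:
  assumes add: "\<And>f g. f \<in> V \<Longrightarrow> g \<in> V \<Longrightarrow> q (\<lambda>x. f x + g x) \<le> q f + q g"
    and le: "\<And>f c. f \<in> V \<Longrightarrow> 0 < c \<Longrightarrow> q (\<lambda>x. c * f x) \<le> c * q f" and zero: "q (\<lambda>x. 0) = 0"
  shows "sublinear_on V q"
proof -
  have "q (\<lambda>x. c * f x) = c * q f" if f: "f \<in> V" and c: "0 \<le> c" for f c
  proof (cases "c = 0")
    case False
    with c have c: "0 < c" by simp
    have "q f \<le> (1/c) * q (\<lambda>x. c * f x)"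
      using le[OF V_scale[OF f, of c], of "1/c"] c by simp
    then have "c * q f \<le> q (\<lambda>x. c * f x)" using c by (simp add: field_simps)
    with le[OF f c] show ?thesis by simp
  qed (use zero in simp)
  with add show ?thesis by (simp add: sublinear_on_def)
qed

lemma minus_le_sublinear:
  assumes "sublinear_on V q" "f \<in> V"
  shows "- q (\<lambda>x. - f x) \<le> q f"
proof -
  have "(\<lambda>x. - f x) \<in> V" using V_scale[OF assms(2), of "-1"] by simp
  then have "q (\<lambda>x. f x + - f x) \<le> q f + q (\<lambda>x. - f x)"
    by (rule sublinear_onD(1)[OF assms])
  then show ?thesis using sublinear_on_zero[OF assms(1)] by simp
qed

text \<open>The bound step for Zorn's lemma. Every sublinear \<open>q \<le> p\<close> is at least
  \<open>- p (- f)\<close> at \<open>f\<close>, so the infimum is finite. Subadditivity uses the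
  chain: of two members, the smaller one serves both arguments.\<close>

lemma sublinear_on_INF_chain:
  assumes C: "C \<noteq> {}" "\<And>q. q \<in> C \<Longrightarrow> sublinear_on V q"
    and chain: "\<And>q q'. q \<in> C \<Longrightarrow> q' \<in> C \<Longrightarrow> (\<forall>f\<in>V. q f \<le> q' f) \<or> (\<forall>f\<in>V. q' f \<le> q f)"
    and p: "\<And>q f. q \<in> C \<Longrightarrow> f \<in> V \<Longrightarrow> q f \<le> p f"
  shows "sublinear_on V (\<lambda>f. INF q\<in>C. q f)"
    and "\<And>f. f \<in> V \<Longrightarrow> bdd_below ((\<lambda>q. q f) ` C)"
proof -
  show bdd: "bdd_below ((\<lambda>q. q f) ` C)" if f: "f \<in> V" for f
  proof (rule bdd_belowI2)
    fix q assume q: "q \<in> C"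
    have "- p (\<lambda>x. - f x) \<le> - q (\<lambda>x. - f x)" using p[OF q] V_scale[OF f, of "-1"] by simp
    also have "\<dots> \<le> q f" by (rule minus_le_sublinear) (use C q f in auto)
    finally show "- p (\<lambda>x. - f x) \<le> q f" .
  qed
  have lower: "(INF q\<in>C. q f) \<le> q f" if "q \<in> C" "f \<in> V" for q f
    by (rule cINF_lower) (use bdd that in auto)
  show "sublinear_on V (\<lambda>f. INF q\<in>C. q f)"
  proof (rule sublinear_onI)
    fix f g assume f: "f \<in> V" and g: "g \<in> V"
    let ?s = "INF q\<in>C. q (\<lambda>x. f x + g x)"
    have *: "?s \<le> q1 f + q2 g" if q1: "q1 \<in> C" and q2: "q2 \<in> C" for q1 q2
    proof -
      obtain q where q: "q \<in> C" "q f \<le> q1 f" "q g \<le> q2 g"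
        using chain[OF q1 q2] q1 q2 f g by blast
      have "?s \<le> q (\<lambda>x. f x + g x)" by (intro lower q V_add f g)
      also have "\<dots> \<le> q f + q g" using C(2)[OF q(1)] f g by (simp add: sublinear_on_def)
      finally show ?thesis using q by simp
    qed
    have "?s - q1 f \<le> (INF q\<in>C. q g)" if "q1 \<in> C" for q1
      by (rule cINF_greatest[OF C(1)]) (use *[OF that] in \<open>simp add: algebra_simps\<close>)
    then have "?s - (INF q\<in>C. q g) \<le> (INF q\<in>C. q f)"
      by (intro cINF_greatest[OF C(1)]) (simp add: algebra_simps)
    then show "?s \<le> (INF q\<in>C. q f) + (INF q\<in>C. q g)" by simp
  next
    fix f and c :: real assume f: "f \<in> V" and c: "0 < c"
    have "(INF q\<in>C. q (\<lambda>x. c * f x)) / c \<le> (INF q\<in>C. q f)"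
    proof (rule cINF_greatest[OF C(1)])
      fix q assume q: "q \<in> C"
      have "(INF q\<in>C. q (\<lambda>x. c * f x)) \<le> q (\<lambda>x. c * f x)" by (intro lower q V_scale f)
      also have "\<dots> = c * q f" using C(2)[OF q] f c by (simp add: sublinear_on_def)
      finally show "(INF q\<in>C. q (\<lambda>x. c * f x)) / c \<le> q f" using c by (simp add: field_simps)
    qed
    then show "(INF q\<in>C. q (\<lambda>x. c * f x)) \<le> c * (INF q\<in>C. q f)" using c by (simp add: field_simps)
  next
    have "(INF q\<in>C. q (\<lambda>x. 0)) = (INF q\<in>C. 0)"
      by (rule INF_cong) (use sublinear_on_zero[OF C(2)] in auto)
    then show "(INF q\<in>C. q (\<lambda>x. 0)) = 0" using cINF_const[OF C(1)] by metis
  qed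
qed

text \<open>Taking \<open>t = 0\<close> shows \<open>r \<le> q\<close>, and \<open>t = 1\<close>
  gives \<open>r g \<le> q (g + h) - q h\<close>. If \<open>q\<close> is minimal then
  \<open>r = q\<close>, and the second inequality becomes superadditivity of
  \<open>q\<close>.\<close>

lemma sublinear_on_shift:
  assumes q: "sublinear_on V q" and h: "h \<in> V"
  defines "r \<equiv> \<lambda>g. INF t\<in>{0..}. q (\<lambda>x. g x + t * h x) - t * q h"
  shows "sublinear_on V r" "\<And>g t. g \<in> V \<Longrightarrow> 0 \<le> t \<Longrightarrow> r g \<le> q (\<lambda>x. g x + t * h x) - t * q h"
proof -
  note qadd = q[unfolded sublinear_on_def, THEN conjunct1, rule_format]
  note qscale = q[unfolded sublinear_on_def, THEN conjunct2, rule_format]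
  have bdd: "bdd_below ((\<lambda>t. q (\<lambda>x. g x + t * h x) - t * q h) ` {0..})" if g: "g \<in> V" for g
  proof (rule bdd_belowI2)
    fix t :: real assume t: "t \<in> {0..}"
    have "q (\<lambda>x. (g x + t * h x) + - g x) \<le> q (\<lambda>x. g x + t * h x) + q (\<lambda>x. - g x)"
      using V_scale[OF g, of "-1"] by (intro qadd V_add V_scale g h) simp
    then show "- q (\<lambda>x. - g x) \<le> q (\<lambda>x. g x + t * h x) - t * q h"
      using qscale[OF h, of t] t by simp
  qed
  show lower: "r g \<le> q (\<lambda>x. g x + t * h x) - t * q h" if "g \<in> V" "0 \<le> t" for g t
    unfolding r_def by (rule cINF_lower) (use bdd that in auto)
  have greatest: "m \<le> r g" if "\<And>t. 0 \<le> t \<Longrightarrow> m \<le> q (\<lambda>x. g x + t * h x) - t * q h" for m g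
    unfolding r_def by (rule cINF_greatest) (use that in auto)
  show "sublinear_on V r"
  proof (rule sublinear_onI)
    fix f g assume f: "f \<in> V" and g: "g \<in> V"
    have *: "r (\<lambda>x. f x + g x) \<le> (q (\<lambda>x. f x + s * h x) - s * q h) + (q (\<lambda>x. g x + t * h x) - t * q h)"
      if "0 \<le> s" "0 \<le> t" for s t
    proof -
      have "r (\<lambda>x. f x + g x) \<le> q (\<lambda>x. (f x + g x) + (s + t) * h x) - (s + t) * q h"
        by (rule lower) (use V_add f g that in auto)
      also have "(\<lambda>x. (f x + g x) + (s + t) * h x) = (\<lambda>x. (f x + s * h x) + (g x + t * h x))"
        by (auto simp: algebra_simps)
      also have "q (\<lambda>x. (f x + s * h x) + (g x + t * h x)) \<le> q (\<lambda>x. f x + s * h x) + q (\<lambda>x. g x + t * h x)"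
        by (intro qadd V_add V_scale f g h)
      finally show ?thesis by (simp add: algebra_simps)
    qed
    have "r (\<lambda>x. f x + g x) - (q (\<lambda>x. f x + s * h x) - s * q h) \<le> r g" if "0 \<le> s" for s
      by (rule greatest) (use *[OF that] in \<open>simp add: algebra_simps\<close>)
    then have "r (\<lambda>x. f x + g x) - r g \<le> r f"
      by (intro greatest) (simp add: algebra_simps)
    then show "r (\<lambda>x. f x + g x) \<le> r f + r g" by simp
  next
    fix f and c :: real assume f: "f \<in> V" and c: "0 < c"
    have "r (\<lambda>x. c * f x) / c \<le> r f"
    proof (rule greatest)
      fix t :: real assume t: "0 \<le> t"
      have "r (\<lambda>x. c * f x) \<le> q (\<lambda>x. c * f x + (c * t) * h x) - (c * t) * q h"
        by (rule lower) (use V_scale f c t in auto)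
      also have "(\<lambda>x. c * f x + (c * t) * h x) = (\<lambda>x. c * (f x + t * h x))"
        by (auto simp: algebra_simps)
      also have "q (\<lambda>x. c * (f x + t * h x)) = c * q (\<lambda>x. f x + t * h x)"
        by (intro qscale V_add V_scale f h) (use c in auto)
      finally show "r (\<lambda>x. c * f x) / c \<le> q (\<lambda>x. f x + t * h x) - t * q h"
        using c by (simp add: field_simps)
    qed
    then show "r (\<lambda>x. c * f x) \<le> c * r f" using c by (simp add: field_simps)
  next
    show "r (\<lambda>x. 0) = 0"
      unfolding r_def using qscale[OF h] by (simp cong: INF_cong_simp)
  qed
qed

text \<open>A minimal sublinear functional is linear.\<close>

theorem Hahn_Banach_sublinear:
  assumes p: "sublinear_on V p"
  obtains \<phi> where "\<And>f g. f \<in> V \<Longrightarrow> g \<in> V \<Longrightarrow> \<phi> (\<lambda>x. f x + g x) = \<phi> f + \<phi> g"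
    "\<And>f c. f \<in> V \<Longrightarrow> \<phi> (\<lambda>x. c * f x) = c * \<phi> f" "\<And>f. f \<in> V \<Longrightarrow> \<phi> f \<le> p f"
proof -
  define A where "A = {q. sublinear_on V q \<and> (\<forall>f\<in>V. q f \<le> p f) \<and> (\<forall>f. f \<notin> V \<longrightarrow> q f = 0)}"
  \<comment> \<open>The order is reversed, because Zorn's lemma produces a maximal element and a
    minimal functional is wanted.\<close>
  define P where "P = (\<lambda>q q' :: ('x \<Rightarrow> real) \<Rightarrow> real. \<forall>f. q' f \<le> q f)"
  define cut where "cut q f = (if f \<in> V then q f else 0)" for q :: "('x \<Rightarrow> real) \<Rightarrow> real" and f
  have cut: "cut q \<in> A" if "sublinear_on V q" "\<And>f. f \<in> V \<Longrightarrow> q f \<le> p f" for q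
    using that V_add V_scale by (auto simp: A_def cut_def sublinear_on_def)
  have "\<exists>m\<in>A. \<forall>a\<in>A. P m a \<longrightarrow> a = m"
  proof (rule predicate_Zorn)
    show "partial_order_on A (relation_of P A)"
      by (rule partial_order_on_relation_ofI) (auto simp: P_def fun_eq_iff intro: order_trans antisym)
    fix C assume C: "C \<in> Chains (relation_of P A)"
    then have CA: "C \<subseteq> A" and chain: "\<And>q q'. q \<in> C \<Longrightarrow> q' \<in> C \<Longrightarrow> P q q' \<or> P q' q"
      by (auto simp: Chains_def relation_of_def)
    show "\<exists>u\<in>A. \<forall>a\<in>C. P a u"
    proof (cases "C = {}")
      case True
      then show ?thesis using cut[OF p] by auto
    next
      case False
      let ?u = "\<lambda>f. INF q\<in>C. q f"
      have *: "sublinear_on V ?u" "\<And>f. f \<in> V \<Longrightarrow> bdd_below ((\<lambda>q. q f) ` C)"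
        by (rule sublinear_on_INF_chain[OF False, where p = p]; use CA chain in \<open>force simp: A_def P_def\<close>)+
      have le: "?u f \<le> q f" if "q \<in> C" "f \<in> V" for q f
        by (rule cINF_lower) (use * that in auto)
      have "?u f \<le> p f" if "f \<in> V" for f
      proof -
        obtain q where "q \<in> C" using False by blast
        then show ?thesis using le[OF _ that] CA that by (fastforce simp: A_def)
      qed
      then have "cut ?u \<in> A" using cut *(1) by blast
      moreover have "P q (cut ?u)" if "q \<in> C" for q
        using le[OF that] CA that by (auto simp: P_def cut_def A_def)
      ultimately show ?thesis by blast
    qed
  qed
  then obtain q where q: "q \<in> A" and min: "\<And>a. a \<in> A \<Longrightarrow> P q a \<Longrightarrow> a = q" by blast
  have sl: "sublinear_on V q" and qp: "\<And>f. f \<in> V \<Longrightarrow> q f \<le> p f" and q0: "\<And>f. f \<notin> V \<Longrightarrow> q f = 0"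
    using q by (auto simp: A_def)
  have add: "q (\<lambda>x. g x + h x) = q g + q h" if g: "g \<in> V" and h: "h \<in> V" for g h
  proof -
    define r where "r g = (INF t\<in>{0..}. q (\<lambda>x. g x + t * h x) - t * q h)" for g
    have r: "sublinear_on V r" "\<And>g t. g \<in> V \<Longrightarrow> 0 \<le> t \<Longrightarrow> r g \<le> q (\<lambda>x. g x + t * h x) - t * q h"
      using sublinear_on_shift[OF sl h] unfolding r_def by auto
    have rq: "r g \<le> q g" if "g \<in> V" for g using r(2)[OF that, of 0] by simp
    then have "cut r \<in> A" using cut[OF r(1)] qp by force
    moreover have "P q (cut r)" using rq q0 by (auto simp: P_def cut_def)
    ultimately have "cut r = q" by (rule min)
    then have "q g = r g" using g by (metis cut_def)
    also have "\<dots> \<le> q (\<lambda>x. g x + h x) - q h" using r(2)[OF g, of 1] by simp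
    finally have "q g + q h \<le> q (\<lambda>x. g x + h x)" by simp
    moreover have "q (\<lambda>x. g x + h x) \<le> q g + q h" using sl g h by (simp add: sublinear_on_def)
    ultimately show ?thesis by simp
  qed
  have "q (\<lambda>x. c * f x) = c * q f" if f: "f \<in> V" for f c
  proof (cases "0 \<le> c")
    case True then show ?thesis using sl f by (simp add: sublinear_on_def)
  next
    case False
    then have "q (\<lambda>x. (- c) * f x) = (- c) * q f" by (intro sublinear_onD(2)[OF sl f]) simp
    moreover have "q (\<lambda>x. c * f x + (- c) * f x) = q (\<lambda>x. c * f x) + q (\<lambda>x. (- c) * f x)"
      by (intro add V_scale f)
    ultimately show ?thesis using sublinear_on_zero[OF sl] by simp
  qed
  with add qp show thesis using that by blast
qed

end

section \<open>Non-negative Radon measures\<close>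

definition as_measure :: "('a::topological_space set \<Rightarrow> complex) \<Rightarrow> 'a measure" where
  "as_measure \<mu> = jordan_pos (\<lambda>A. Re (\<mu> A))"

lemma nonneg_radonD:
  assumes "\<mu> \<in> nonneg_radon_measures"
  shows "\<mu> \<in> radon_measures" "complex_borel_measure \<mu>" "0 \<le> Re (\<mu> A)" "Im (\<mu> A) = 0" "norm (\<mu> A) = Re (\<mu> A)"
  using assms by (auto simp: nonneg_radon_measures_def radon_measures_def less_eq_complex_def cmod_def complex_eq_iff)

lemma measure_space_Re:
  assumes \<mu>: "\<mu> \<in> nonneg_radon_measures"
  shows "measure_space UNIV (sets borel) (\<lambda>A. ennreal (Re (\<mu> A)))"
proof -
  note cm = nonneg_radonD(2)[OF \<mu>, unfolded complex_borel_measure_def, THEN conjunct2, rule_format]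
  \<comment> \<open>The constant sequence of empty sets is disjoint, and a constant series converges
    only if its term is 0.\<close>
  have "\<mu> {} = 0"
  proof -
    have "(\<lambda>n::nat. \<mu> {}) sums \<mu> (\<Union>n::nat. {})"
      by (rule cm) (auto simp: disjoint_family_on_def)
    then have "summable (\<lambda>n::nat. \<mu> {})" by (rule sums_summable)
    then show ?thesis using summable_const_iff by blast
  qed
  moreover have "(\<Sum>n. ennreal (Re (\<mu> (A n)))) = ennreal (Re (\<mu> (\<Union>n. A n)))"
    if "range A \<subseteq> sets borel" "disjoint_family A" for A :: "nat \<Rightarrow> 'a set"
    using sums_Re[OF cm[OF that]] nonneg_radonD(3)[OF \<mu>] by (intro suminf_ennreal_eq) auto
  ultimately show ?thesis
    using sets.sigma_algebra_axioms[of "borel :: 'a measure"]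
    by (auto simp: measure_space_def positive_def countably_additive_def)
qed

text \<open>Monotonicity of a non-negative measure makes the supremum in the Jordan positive part
  attained at the set itself.\<close>

lemma as_measure_eq:
  assumes \<mu>: "\<mu> \<in> nonneg_radon_measures"
  shows "as_measure \<mu> = measure_of UNIV (sets borel) (\<lambda>A. ennreal (Re (\<mu> A)))"
  unfolding as_measure_def jordan_pos_def
proof (rule measure_of_eq)
  let ?N = "measure_of UNIV (sets borel) (\<lambda>A. ennreal (Re (\<mu> A)))"
  have em: "emeasure ?N A = ennreal (Re (\<mu> A))" if "A \<in> sets borel" for A
    using measure_space_Re[OF \<mu>] that by (auto simp: measure_space_def intro!: emeasure_measure_of_sigma)
  have sN: "sets ?N = sets borel"
    using sets.sets_measure_of_eq[of "borel :: 'a measure"] by simp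
  show "(SUP B\<in>{B \<in> sets borel. B \<subseteq> A}. ennreal (Re (\<mu> B))) = ennreal (Re (\<mu> A))"
    if "A \<in> sigma_sets UNIV (sets borel)" for A
  proof -
    have A: "A \<in> sets borel" using that sets.sigma_sets_eq[of "borel :: 'a measure"] by simp
    have "ennreal (Re (\<mu> B)) \<le> ennreal (Re (\<mu> A))" if "B \<in> sets borel" "B \<subseteq> A" for B
      using emeasure_mono[OF that(2), of ?N] em[OF that(1)] em[OF A] A sN by simp
    then show ?thesis using A by (intro antisym SUP_least SUP_upper) auto
  qed
qed auto

lemma
  assumes \<mu>: "\<mu> \<in> nonneg_radon_measures"
  shows sets_as_measure: "sets (as_measure \<mu>) = sets borel"
    and space_as_measure: "space (as_measure \<mu>) = UNIV"
    and emeasure_as_measure: "A \<in> sets borel \<Longrightarrow> emeasure (as_measure \<mu>) A = ennreal (Re (\<mu> A))"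
    and measure_as_measure: "A \<in> sets borel \<Longrightarrow> measure (as_measure \<mu>) A = Re (\<mu> A)"
    and finite_as_measure: "finite_measure (as_measure \<mu>)"
proof -
  show 1: "sets (as_measure \<mu>) = sets borel"
    unfolding as_measure_eq[OF \<mu>] using sets.sets_measure_of_eq[of "borel :: 'a measure"] by simp
  show 2: "space (as_measure \<mu>) = UNIV" using sets_eq_imp_space_eq[OF 1] by simp
  show 3: "emeasure (as_measure \<mu>) A = ennreal (Re (\<mu> A))" if "A \<in> sets borel" for A
    unfolding as_measure_eq[OF \<mu>]
    using measure_space_Re[OF \<mu>] that by (auto simp: measure_space_def intro!: emeasure_measure_of_sigma)
  show "measure (as_measure \<mu>) A = Re (\<mu> A)" if "A \<in> sets borel" for A
    using 3[OF that] nonneg_radonD(3)[OF \<mu>] by (simp add: measure_def)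
  show "finite_measure (as_measure \<mu>)"
    using 3[of UNIV] by (intro finite_measureI) (simp add: 2)
qed

lemma measurable_as_measure:
  fixes f :: "'a::topological_space \<Rightarrow> 'b::topological_space"
  assumes "\<mu> \<in> nonneg_radon_measures" "continuous_on UNIV f"
  shows "f \<in> borel_measurable (as_measure \<mu>)"
  using borel_measurable_continuous_onI[OF assms(2)] by (simp add: measurable_cong_sets[OF sets_as_measure[OF assms(1)] refl])

lemma integrable_as_measure:
  fixes f :: "'a::topological_space \<Rightarrow> 'b::{banach, second_countable_topology}"
  assumes "\<mu> \<in> nonneg_radon_measures" "continuous_on UNIV f" "\<And>x. norm (f x) \<le> B"
  shows "integrable (as_measure \<mu>) f"
  by (rule finite_measure.integrable_const_bound[OF finite_as_measure])
    (use assms measurable_as_measure in auto)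

lemma integral_jordan_pos_nonpos:
  fixes f :: "'a::topological_space \<Rightarrow> complex"
  assumes "\<And>A. \<phi> A \<le> 0"
  shows "integral\<^sup>L (jordan_pos \<phi>) f = 0"
proof -
  have "(SUP B\<in>{B \<in> sets borel. B \<subseteq> A}. ennreal (\<phi> B)) = 0" for A
    using assms by (auto simp: ennreal_neg intro!: antisym SUP_least)
  then have "jordan_pos \<phi> = null_measure borel"
    by (simp add: jordan_pos_def null_measure_def)
  then show ?thesis by simp
qed

lemma cintegral_eq:
  assumes \<mu>: "\<mu> \<in> nonneg_radon_measures"
  shows "cintegral \<mu> f = integral\<^sup>L (as_measure \<mu>) f"
proof -
  have "integral\<^sup>L (jordan_pos (\<lambda>A. - Re (\<mu> A))) f = 0" "integral\<^sup>L (jordan_pos (\<lambda>A. Im (\<mu> A))) f = 0"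
    "integral\<^sup>L (jordan_pos (\<lambda>A. - Im (\<mu> A))) f = 0"
    by (rule integral_jordan_pos_nonpos; simp add: nonneg_radonD(3,4)[OF \<mu>])+
  then show ?thesis by (simp add: cintegral_def as_measure_def)
qed

lemma cintegral_of_real:
  assumes \<mu>: "\<mu> \<in> nonneg_radon_measures"
  shows "cintegral \<mu> (\<lambda>x. of_real (g x)) = of_real (integral\<^sup>L (as_measure \<mu>) g)"
  by (simp add: cintegral_eq[OF \<mu>])

lemma total_variation_eq:
  assumes \<mu>: "\<mu> \<in> nonneg_radon_measures" and A: "A \<in> sets borel"
  shows "total_variation \<mu> A = emeasure (as_measure \<mu>) A"
  unfolding total_variation_def
proof (rule antisym[OF SUP_least])
  let ?M = "as_measure \<mu>"
  have em: "emeasure ?M B = ennreal (norm (\<mu> B))" if "B \<in> sets borel" for B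
    using emeasure_as_measure[OF \<mu> that] nonneg_radonD(5)[OF \<mu>] by simp
  fix P assume "P \<in> {P. finite P \<and> P \<subseteq> sets borel \<and> disjoint P \<and> \<Union> P \<subseteq> A}"
  then have P: "finite P" "P \<subseteq> sets borel" "disjoint P" "\<Union> P \<subseteq> A" by auto
  have "(\<Sum>B\<in>P. ennreal (norm (\<mu> B))) = (\<Sum>B\<in>P. emeasure ?M B)"
    using P em by (intro sum.cong) auto
  also have "\<dots> = emeasure ?M (\<Union>B\<in>P. B)"
    using P by (intro sum_emeasure) (auto simp: sets_as_measure[OF \<mu>] disjoint_family_on_def disjoint_def)
  also have "\<dots> \<le> emeasure ?M A"
    using P A by (intro emeasure_mono) (auto simp: sets_as_measure[OF \<mu>])
  finally show "(\<Sum>B\<in>P. ennreal (norm (\<mu> B))) \<le> emeasure ?M A" .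
next
  have "emeasure (as_measure \<mu>) A = (\<Sum>B\<in>{A}. ennreal (norm (\<mu> B)))"
    using emeasure_as_measure[OF \<mu> A] nonneg_radonD(5)[OF \<mu>] by simp
  also have "\<dots> \<le> (SUP P\<in>{P. finite P \<and> P \<subseteq> sets borel \<and> disjoint P \<and> \<Union> P \<subseteq> A}. \<Sum>B\<in>P. ennreal (norm (\<mu> B)))"
    by (rule SUP_upper) (use A in auto)
  finally show "emeasure (as_measure \<mu>) A \<le> (SUP P\<in>{P. finite P \<and> P \<subseteq> sets borel \<and> disjoint P \<and> \<Union> P \<subseteq> A}. \<Sum>B\<in>P. ennreal (norm (\<mu> B)))" .
qed

lemma measure_norm_eq: "\<mu> \<in> nonneg_radon_measures \<Longrightarrow> measure_norm \<mu> = ennreal (Re (\<mu> UNIV))"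
  by (simp add: measure_norm_def total_variation_eq emeasure_as_measure)

lemma nonneg_radonI:
  fixes \<mu> :: "'a::t2_space set \<Rightarrow> complex"
  assumes "complex_borel_measure \<mu>" "\<And>A. 0 \<le> \<mu> A"
    and reg: "\<And>A \<epsilon>. A \<in> sets borel \<Longrightarrow> 0 < \<epsilon> \<Longrightarrow>
      \<exists>K U. compact K \<and> open U \<and> K \<subseteq> A \<and> A \<subseteq> U \<and> total_variation \<mu> (U - K) < \<epsilon>"
  shows "\<mu> \<in> nonneg_radon_measures"
  using assms by (simp add: nonneg_radon_measures_def radon_measures_def)

lemma radon_regular:
  assumes "\<mu> \<in> radon_measures" "A \<in> sets borel" "0 < \<epsilon>"
  obtains K U where "compact K" "open U" "K \<subseteq> A" "A \<subseteq> U" "total_variation \<mu> (U - K) < \<epsilon>"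
proof -
  have "\<exists>K U. compact K \<and> open U \<and> K \<subseteq> A \<and> A \<subseteq> U \<and> total_variation \<mu> (U - K) < \<epsilon>"
    using assms unfolding radon_measures_def mem_Collect_eq by blast
  then show thesis using that by blast
qed

lemma total_variation_mono: "A \<subseteq> B \<Longrightarrow> total_variation \<mu> A \<le> total_variation \<mu> B"
  unfolding total_variation_def by (rule SUP_subset_mono) auto

lemma total_variation_linear_le:
  "total_variation (\<lambda>A. c * \<mu> A + d * \<nu> A) A \<le> ennreal (norm c) * total_variation \<mu> A + ennreal (norm d) * total_variation \<nu> A"
  unfolding total_variation_def[of "\<lambda>A. c * \<mu> A + d * \<nu> A"]
proof (rule SUP_least)
  fix P assume P: "P \<in> {P. finite P \<and> P \<subseteq> sets borel \<and> disjoint P \<and> \<Union> P \<subseteq> A}"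
  have "ennreal (norm (c * \<mu> B + d * \<nu> B)) \<le> ennreal (norm c) * ennreal (norm (\<mu> B)) + ennreal (norm d) * ennreal (norm (\<nu> B))" for B
    using norm_triangle_ineq[of "c * \<mu> B" "d * \<nu> B"]
    by (simp add: norm_mult ennreal_mult[symmetric] ennreal_plus[symmetric] del: ennreal_plus) 
  then have "(\<Sum>B\<in>P. ennreal (norm (c * \<mu> B + d * \<nu> B)))
      \<le> (\<Sum>B\<in>P. ennreal (norm c) * ennreal (norm (\<mu> B)) + ennreal (norm d) * ennreal (norm (\<nu> B)))"
    by (rule sum_mono)
  also have "\<dots> = ennreal (norm c) * (\<Sum>B\<in>P. ennreal (norm (\<mu> B))) + ennreal (norm d) * (\<Sum>B\<in>P. ennreal (norm (\<nu> B)))"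
    by (simp only: sum.distrib sum_distrib_left)
  also have "\<dots> \<le> ennreal (norm c) * total_variation \<mu> A + ennreal (norm d) * total_variation \<nu> A"
    unfolding total_variation_def using P by (intro add_mono mult_left_mono SUP_upper) auto
  finally show "(\<Sum>B\<in>P. ennreal (norm (c * \<mu> B + d * \<nu> B))) \<le> ennreal (norm c) * total_variation \<mu> A + ennreal (norm d) * total_variation \<nu> A" .
qed

lemma nonneg_radon_linear:
  fixes \<mu> \<nu> :: "'a::t2_space set \<Rightarrow> complex"
  assumes \<mu>: "\<mu> \<in> nonneg_radon_measures" and \<nu>: "\<nu> \<in> nonneg_radon_measures" and c: "0 \<le> c" and d: "0 \<le> d"
  shows "(\<lambda>A. of_real c * \<mu> A + of_real d * \<nu> A) \<in> nonneg_radon_measures" (is "?\<rho> \<in> _")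
proof (rule nonneg_radonI)
  show "complex_borel_measure ?\<rho>"
    using nonneg_radonD(2)[OF \<mu>] nonneg_radonD(2)[OF \<nu>]
    by (auto simp: complex_borel_measure_def intro!: sums_add sums_mult)
  show "0 \<le> ?\<rho> A" for A
    using nonneg_radonD(3,4)[OF \<mu>, of A] nonneg_radonD(3,4)[OF \<nu>, of A] c d by (simp add: less_eq_complex_def)
  fix A :: "'a set" and \<epsilon> :: ennreal assume A: "A \<in> sets borel" and \<epsilon>: "0 < \<epsilon>"
  \<comment> \<open>The tolerance is an extended real and may be infinite, so a positive real number
    below it is fixed first.\<close>
  obtain e where e: "0 < e" "ennreal e \<le> \<epsilon>"
  proof (cases \<epsilon>)
    case (real r) then show thesis using \<epsilon> that[of r] by auto
  next
    case top then show thesis using that[of 1] by auto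
  qed
  define \<delta> where "\<delta> = e / (c + d + 1)"
  have \<delta>: "0 < \<delta>" using e c d by (simp add: \<delta>_def)
  obtain K U where 1: "compact K" "open U" "K \<subseteq> A" "A \<subseteq> U" "total_variation \<mu> (U - K) < ennreal \<delta>"
    using radon_regular[OF nonneg_radonD(1)[OF \<mu>] A, of "ennreal \<delta>"] \<delta> by auto
  obtain K' U' where 2: "compact K'" "open U'" "K' \<subseteq> A" "A \<subseteq> U'" "total_variation \<nu> (U' - K') < ennreal \<delta>"
    using radon_regular[OF nonneg_radonD(1)[OF \<nu>] A, of "ennreal \<delta>"] \<delta> by auto
  let ?D = "(U \<inter> U') - (K \<union> K')"
  have "total_variation \<mu> ?D \<le> ennreal \<delta>"
    using 1(5) total_variation_mono[of ?D "U - K" \<mu>] by (auto intro: order_trans less_imp_le)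
  moreover have "total_variation \<nu> ?D \<le> ennreal \<delta>"
    using 2(5) total_variation_mono[of ?D "U' - K'" \<nu>] by (auto intro: order_trans less_imp_le)
  moreover have "total_variation ?\<rho> ?D \<le> ennreal c * total_variation \<mu> ?D + ennreal d * total_variation \<nu> ?D"
    using total_variation_linear_le[of "of_real c" \<mu> "of_real d" \<nu> ?D] c d by simp
  ultimately have "total_variation ?\<rho> ?D \<le> ennreal c * ennreal \<delta> + ennreal d * ennreal \<delta>"
    by (meson add_mono mult_left_mono order_trans zero_le)
  also have "\<dots> = ennreal ((c + d) * \<delta>)" using c d \<delta> by (simp add: ennreal_mult ring_distribs)
  also have "\<dots> < ennreal e" using c d e by (intro ennreal_lessI) (auto simp: \<delta>_def field_simps)
  finally have "total_variation ?\<rho> ?D < \<epsilon>" using e by simp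
  then show "\<exists>K U. compact K \<and> open U \<and> K \<subseteq> A \<and> A \<subseteq> U \<and> total_variation ?\<rho> (U - K) < \<epsilon>"
    using 1 2 by (intro exI[of _ "K \<union> K'"] exI[of _ "U \<inter> U'"]) auto
qed

lemma nonneg_radon_zero: "(\<lambda>A :: 'a::t2_space set. 0) \<in> nonneg_radon_measures"
proof (rule nonneg_radonI)
  show "complex_borel_measure (\<lambda>A :: 'a set. 0)" by (simp add: complex_borel_measure_def)
  have "total_variation (\<lambda>A. 0) B = 0" for B :: "'a set"
    by (auto simp: total_variation_def intro!: antisym SUP_least)
  then show "\<exists>K U. compact K \<and> open U \<and> K \<subseteq> A \<and> A \<subseteq> U \<and> total_variation (\<lambda>A. 0) (U - K) < \<epsilon>"
    if "0 < \<epsilon>" for A :: "'a set" and \<epsilon>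
    using that by (intro exI[of _ "{}"] exI[of _ UNIV]) auto
qed simp

lemma nn_integral_linear_measure:
  assumes s: "sets M = sets N" "sets L = sets N"
    and em: "\<And>A. A \<in> sets N \<Longrightarrow> emeasure L A = c * emeasure M A + d * emeasure N A"
    and f: "f \<in> borel_measurable N"
  shows "nn_integral L f = c * nn_integral M f + d * nn_integral N f"
proof -
  have sp: "space M = space N" "space L = space N" using s by (auto dest: sets_eq_imp_space_eq)
  have b[simp]: "borel_measurable M = borel_measurable N" "borel_measurable L = borel_measurable N"
    using measurable_cong_sets[OF s(1) refl] measurable_cong_sets[OF s(2) refl] by blast+
  from f show ?thesis
  proof (induction f rule: borel_measurable_induct)
    case (cong f g)
    then show ?case using nn_integral_cong[of L f g] nn_integral_cong[of M f g] nn_integral_cong[of N f g] sp by simp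
  next
    case (set A)
    then show ?case using s em by simp
  next
    case (mult u k)
    then show ?case by (simp add: nn_integral_cmult ring_distribs mult_ac)
  next
    case (add u v)
    then show ?case by (simp add: nn_integral_add ring_distribs add_ac)
  next
    case (seq U)
    have "(\<integral>\<^sup>+x. (SUP i. U i x) \<partial>L) = (SUP i. nn_integral L (U i))"
      "(\<integral>\<^sup>+x. (SUP i. U i x) \<partial>M) = (SUP i. nn_integral M (U i))"
      "(\<integral>\<^sup>+x. (SUP i. U i x) \<partial>N) = (SUP i. nn_integral N (U i))"
      using seq by (intro nn_integral_monotone_convergence_SUP; simp)+
    moreover have "(SUP i. c * nn_integral M (U i) + d * nn_integral N (U i))
        = (SUP i. c * nn_integral M (U i)) + (SUP i. d * nn_integral N (U i))"
      using seq(3) by (intro ennreal_SUP_add) (auto simp: incseq_def le_fun_def intro!: mult_left_mono nn_integral_mono)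
    ultimately show ?case
      using seq by (simp add: SUP_mult_left_ennreal image_comp SUP_apply[abs_def])
  qed
qed

lemma integral_linear_as_measure:
  fixes \<mu> \<nu> :: "'a::t2_space set \<Rightarrow> complex" and f :: "'a \<Rightarrow> real"
  assumes \<mu>: "\<mu> \<in> nonneg_radon_measures" and \<nu>: "\<nu> \<in> nonneg_radon_measures" and c: "0 \<le> c" and d: "0 \<le> d"
    and f: "continuous_on UNIV f" "\<And>x. 0 \<le> f x" "\<And>x. f x \<le> B"
  shows "integral\<^sup>L (as_measure (\<lambda>A. of_real c * \<mu> A + of_real d * \<nu> A)) f
    = c * integral\<^sup>L (as_measure \<mu>) f + d * integral\<^sup>L (as_measure \<nu>) f"
proof -
  let ?\<rho> = "\<lambda>A. of_real c * \<mu> A + of_real d * \<nu> A"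
  have \<rho>: "?\<rho> \<in> nonneg_radon_measures" by (rule nonneg_radon_linear) fact+
  have *: "ennreal (integral\<^sup>L (as_measure \<kappa>) f) = nn_integral (as_measure \<kappa>) f" if "\<kappa> \<in> nonneg_radon_measures" for \<kappa>
    using nn_integral_eq_integral[OF integrable_as_measure[OF that f(1), of B]] f by simp
  have "nn_integral (as_measure ?\<rho>) f = ennreal c * nn_integral (as_measure \<mu>) f + ennreal d * nn_integral (as_measure \<nu>) f"
    by (rule nn_integral_linear_measure)
      (use \<mu> \<nu> \<rho> c d nonneg_radonD(3)[OF \<mu>] nonneg_radonD(3)[OF \<nu>] measurable_as_measure[OF \<nu> f(1)] in
        \<open>auto simp: sets_as_measure emeasure_as_measure ennreal_mult\<close>)
  then have "ennreal (integral\<^sup>L (as_measure ?\<rho>) f) = ennreal (c * integral\<^sup>L (as_measure \<mu>) f + d * integral\<^sup>L (as_measure \<nu>) f)"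
    using c d f(2) by (simp add: *[OF \<mu>, symmetric] *[OF \<nu>, symmetric] *[OF \<rho>, symmetric] ennreal_mult[symmetric] ennreal_plus[symmetric] del: ennreal_plus)
  then show ?thesis using c d f(2) by (subst (asm) ennreal_inj) auto
qed

lemma measure_supp_iff:
  assumes "\<mu> \<in> nonneg_radon_measures"
  shows "x \<in> measure_supp \<mu> \<longleftrightarrow> (\<forall>U. open U \<and> x \<in> U \<longrightarrow> emeasure (as_measure \<mu>) U \<noteq> 0)"
  using total_variation_eq[OF assms] by (auto simp: measure_supp_def)

lemma closed_measure_supp: "closed (measure_supp \<mu>)"
  unfolding closed_def
proof (subst open_subopen, intro ballI)
  fix x assume "x \<in> - measure_supp \<mu>"
  then obtain U where "open U" "x \<in> U" "total_variation \<mu> U = 0" by (auto simp: measure_supp_def)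
  then show "\<exists>T. open T \<and> x \<in> T \<and> T \<subseteq> - measure_supp \<mu>"
    by (intro exI[of _ U]) (auto simp: measure_supp_def)
qed

text \<open>The complement of the support is a union of possibly uncountably many open null sets, so
  countable subadditivity does not suffice. Its compact subsets are covered by finitely many of
  them, and regularity leaves a remainder of mass less than \<open>e\<close>.\<close>

lemma emeasure_Compl_measure_supp:
  fixes \<mu> :: "'a::t2_space set \<Rightarrow> complex"
  assumes \<mu>: "\<mu> \<in> nonneg_radon_measures"
  shows "emeasure (as_measure \<mu>) (- measure_supp \<mu>) = 0"
proof -
  let ?M = "as_measure \<mu>"
  let ?S = "- measure_supp \<mu>"
  have S: "?S \<in> sets borel" by (intro borel_open open_Compl closed_measure_supp)
  have s: "sets ?M = sets borel" by (rule sets_as_measure[OF \<mu>])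
  have null: "emeasure ?M K = 0" if K: "compact K" "K \<subseteq> ?S" for K
  proof -
    have "\<forall>x\<in>K. \<exists>U. open U \<and> x \<in> U \<and> emeasure ?M U = 0"
      using K(2) measure_supp_iff[OF \<mu>] by blast
    then obtain U where U: "\<And>x. x \<in> K \<Longrightarrow> open (U x)" "\<And>x. x \<in> K \<Longrightarrow> x \<in> U x" "\<And>x. x \<in> K \<Longrightarrow> emeasure ?M (U x) = 0"
      by metis
    have "K \<subseteq> (\<Union>x\<in>K. U x)" using U(2) by blast
    then obtain D where D: "D \<subseteq> K" "finite D" "K \<subseteq> (\<Union>x\<in>D. U x)"
      by (rule compactE_image[OF K(1) U(1), rotated])
    have "emeasure ?M K \<le> emeasure ?M (\<Union>x\<in>D. U x)"
      using D U(1) by (intro emeasure_mono) (auto simp: s intro!: borel_open)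
    also have "\<dots> \<le> (\<Sum>x\<in>D. emeasure ?M (U x))"
      using D U(1) by (intro emeasure_subadditive_finite) (auto simp: s)
    also have "\<dots> = 0" using D U(3) by (intro sum.neutral) auto
    finally show ?thesis by simp
  qed
  have "emeasure ?M ?S \<le> 0 + ennreal e" if "0 < e" for e
  proof -
    obtain K U where K: "compact K" "open U" "K \<subseteq> ?S" "?S \<subseteq> U" "total_variation \<mu> (U - K) < ennreal e"
      using radon_regular[OF nonneg_radonD(1)[OF \<mu>] S, of "ennreal e"] \<open>0 < e\<close> by auto
    have KU: "K \<in> sets borel" "U \<in> sets borel" using K by (auto simp: borel_closed compact_imp_closed)
    have "emeasure ?M ?S \<le> emeasure ?M (K \<union> (U - K))"
      using K KU by (intro emeasure_mono) (auto simp: s)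
    also have "\<dots> \<le> emeasure ?M K + emeasure ?M (U - K)"
      using KU by (intro emeasure_subadditive) (auto simp: s)
    also have "\<dots> \<le> ennreal e"
    proof -
      have "total_variation \<mu> (U - K) = emeasure ?M (U - K)"
        by (rule total_variation_eq[OF \<mu>]) (use KU in blast)
      then show ?thesis using null[OF K(1,3)] K(5) by (simp add: less_imp_le)
    qed
    finally show ?thesis by simp
  qed
  then have "emeasure ?M ?S \<le> 0" by (rule ennreal_le_epsilon)
  then show ?thesis by simp
qed

section \<open>Translations on a hypergroup\<close>

definition Cb :: "('a::topological_space \<Rightarrow> real) set" where
  "Cb = {g. continuous_on UNIV g \<and> (\<exists>B. \<forall>x. \<bar>g x\<bar> \<le> B)}"

lemma CbI: "continuous_on UNIV g \<Longrightarrow> (\<And>x. \<bar>g x\<bar> \<le> B) \<Longrightarrow> g \<in> Cb"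
  by (auto simp: Cb_def)

lemma Cb_continuous: "g \<in> Cb \<Longrightarrow> continuous_on UNIV g"
  by (simp add: Cb_def)

lemma Cb_cases:
  assumes "g \<in> Cb" obtains B where "0 \<le> B" "\<And>x. \<bar>g x\<bar> \<le> B"
  using assms unfolding Cb_def by (auto intro: order_trans[OF abs_ge_zero])

lemma Cb_const: "(\<lambda>x. c) \<in> Cb"
  by (rule CbI[of _ "\<bar>c\<bar>"]) auto

lemma Cb_add:
  assumes "f \<in> Cb" "g \<in> Cb"
  shows "(\<lambda>x. f x + g x) \<in> Cb"
proof -
  obtain A B where "\<And>x. \<bar>f x\<bar> \<le> A" "\<And>x. \<bar>g x\<bar> \<le> B" using assms Cb_cases by metis
  then have "\<bar>f x + g x\<bar> \<le> A + B" for x by (meson abs_triangle_ineq add_mono order_trans)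
  then show ?thesis by (rule CbI[OF continuous_on_add[OF Cb_continuous[OF assms(1)] Cb_continuous[OF assms(2)]]])
qed

lemma Cb_scale:
  assumes "f \<in> Cb"
  shows "(\<lambda>x. c * f x) \<in> Cb"
proof -
  obtain A where "\<And>x. \<bar>f x\<bar> \<le> A" using assms Cb_cases by metis
  then have "\<bar>c * f x\<bar> \<le> \<bar>c\<bar> * A" for x by (simp add: abs_mult mult_left_mono)
  then show ?thesis by (rule CbI[OF continuous_on_mult[OF continuous_on_const Cb_continuous[OF assms]]])
qed

lemma Cc_Cb: "g \<in> Cc \<Longrightarrow> g \<in> Cb"
  using Cc_bounded Cc_continuous by (metis CbI)

lemma bcontfun_of_real:
  assumes "g \<in> Cb"
  shows "(\<lambda>x. complex_of_real (g x)) \<in> bcontfun"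
proof -
  obtain B where "\<And>x. \<bar>g x\<bar> \<le> B" using Cb_cases assms by metis
  then have "bounded (range (\<lambda>x. complex_of_real (g x)))" by (auto simp: bounded_iff)
  then show ?thesis using Cb_continuous[OF assms] by (auto simp: bcontfun_def intro!: continuous_intros)
qed

text \<open>A finite cover of \<open>F p\<close> still covers \<open>F q\<close> for all
  \<open>q\<close> near \<open>p\<close>, by upper semicontinuity; finitely many such neighbourhoods
  cover \<open>C\<close>.\<close>

lemma compact_UN_upper_semicontinuous:
  fixes F :: "'b::topological_space \<Rightarrow> 'a::topological_space set"
  assumes C: "compact C" and F: "\<And>p. compact (F p)" and up: "\<And>V. open V \<Longrightarrow> open {p. F p \<subseteq> V}"
  shows "compact (\<Union>p\<in>C. F p)"
proof (rule compactI)
  fix \<C> assume \<C>: "\<forall>t\<in>\<C>. open t" "(\<Union>p\<in>C. F p) \<subseteq> \<Union>\<C>"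
  have "\<exists>D\<subseteq>\<C>. finite D \<and> F p \<subseteq> \<Union>D" if "p \<in> C" for p
    using compactE[OF F[of p], of \<C>] \<C> that by (metis SUP_le_iff)
  then obtain D where D: "\<And>p. p \<in> C \<Longrightarrow> D p \<subseteq> \<C>" "\<And>p. p \<in> C \<Longrightarrow> finite (D p)" "\<And>p. p \<in> C \<Longrightarrow> F p \<subseteq> \<Union>(D p)"
    by metis
  have op: "open {q. F q \<subseteq> \<Union>(D p)}" if "p \<in> C" for p
    using D(1)[OF that] \<C>(1) by (intro up open_Union) blast
  have "C \<subseteq> (\<Union>p\<in>C. {q. F q \<subseteq> \<Union>(D p)})" using D(3) by blast
  then obtain P where P: "P \<subseteq> C" "finite P" "C \<subseteq> (\<Union>p\<in>P. {q. F q \<subseteq> \<Union>(D p)})"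
    by (rule compactE_image[OF C op, rotated])
  have "(\<Union>p\<in>C. F p) \<subseteq> \<Union>(\<Union>p\<in>P. D p)"
  proof (rule UN_least)
    fix q assume "q \<in> C"
    then obtain p where "p \<in> P" "F q \<subseteq> \<Union>(D p)" using P(3) by blast
    then show "F q \<subseteq> \<Union>(\<Union>p\<in>P. D p)" by blast
  qed
  moreover have "(\<Union>p\<in>P. D p) \<subseteq> \<C>" "finite (\<Union>p\<in>P. D p)" using P(1,2) D(1,2) by auto
  ultimately show "\<exists>\<C>'\<subseteq>\<C>. finite \<C>' \<and> (\<Union>p\<in>C. F p) \<subseteq> \<Union>\<C>'"
    by blast
qed

context hypergroup
begin

section \<open>Products of two point masses and the translates they define\<close>

definition pconv :: "'a \<Rightarrow> 'a \<Rightarrow> 'a set \<Rightarrow> complex" where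
  "pconv a y = conv (point_mass a) (point_mass y)"

definition pmeasure :: "'a \<Rightarrow> 'a \<Rightarrow> 'a measure" where
  "pmeasure a y = as_measure (pconv a y)"

definition psupp :: "'a \<Rightarrow> 'a \<Rightarrow> 'a set" where
  "psupp a y = measure_supp (pconv a y)"

text \<open>\<open>ltrans a g\<close> is the translate of \<open>g\<close> by the involute of \<open>a\<close>; this indexing avoids the involution
  in the composition law \<open>ltrans_ltrans\<close>.\<close>

definition ltrans :: "'a \<Rightarrow> ('a \<Rightarrow> real) \<Rightarrow> 'a \<Rightarrow> real" where
  "ltrans a g y = integral\<^sup>L (pmeasure a y) g"

lemma pconv_nonneg: "pconv a y \<in> nonneg_radon_measures" and pconv_UNIV: "pconv a y UNIV = 1"
  and compact_psupp: "compact (psupp a y)"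
  using conv_point_mass[of a y] by (auto simp: compact_probs_def pconv_def psupp_def)

lemma sets_pmeasure: "sets (pmeasure a y) = sets borel" and space_pmeasure: "space (pmeasure a y) = UNIV"
  and finite_pmeasure: "finite_measure (pmeasure a y)" and measure_pmeasure_UNIV: "measure (pmeasure a y) UNIV = 1"
  using sets_as_measure[OF pconv_nonneg] space_as_measure[OF pconv_nonneg] finite_as_measure[OF pconv_nonneg]
    measure_as_measure[OF pconv_nonneg, of UNIV]
  by (auto simp: pmeasure_def pconv_UNIV)

lemma integrable_pmeasure: "g \<in> Cb \<Longrightarrow> integrable (pmeasure a y) g"
  unfolding pmeasure_def using integrable_as_measure[OF pconv_nonneg Cb_continuous] by (metis Cb_cases real_norm_def)

text \<open>Regularity of a point mass is read off from the axioms: it equals its product with the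
  point mass at \<open>e\<close>, and products of point masses are Radon probability
  measures.\<close>

lemma point_mass_nonneg: "point_mass (x :: 'a) \<in> nonneg_radon_measures"
  using pconv_nonneg[of x e] identity(1)[of x] by (simp add: pconv_def)

lemma point_mass_radon: "point_mass (x :: 'a) \<in> radon_measures"
  using nonneg_radonD(1)[OF point_mass_nonneg] .

lemma integral_point_mass:
  fixes f :: "'a \<Rightarrow> 'c::{banach, second_countable_topology}"
  assumes f: "continuous_on UNIV f"
  shows "integral\<^sup>L (as_measure (point_mass x)) f = f x"
proof -
  let ?M = "as_measure (point_mass x)"
  have m: "{t. f t \<noteq> f x} \<in> sets borel"
    by (rule borel_open) (intro open_Collect_neq f continuous_on_const)
  have "emeasure ?M {t. f t \<noteq> f x} = 0"
    using emeasure_as_measure[OF point_mass_nonneg m] by (simp add: point_mass_def)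
  then have "AE t in ?M. f t = f x"
    using m by (intro AE_I[of _ _ "{t. f t \<noteq> f x}"]) (auto simp: sets_as_measure[OF point_mass_nonneg])
  then have "integral\<^sup>L ?M f = integral\<^sup>L ?M (\<lambda>t. f x)"
    using measurable_as_measure[OF point_mass_nonneg f] by (intro integral_cong_AE) auto
  also have "\<dots> = f x"
    by (simp add: measure_as_measure[OF point_mass_nonneg] space_as_measure[OF point_mass_nonneg])
      (simp add: point_mass_def)
  finally show ?thesis .
qed

lemma cintegral_point_mass:
  "continuous_on UNIV f \<Longrightarrow> cintegral (point_mass (x :: 'a)) f = f x"
  by (simp add: cintegral_eq[OF point_mass_nonneg] integral_point_mass)

lemma cintegral_pconv: "cintegral (pconv a y) (\<lambda>x. of_real (g x)) = of_real (ltrans a g y)"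
  by (simp add: cintegral_of_real[OF pconv_nonneg] ltrans_def pmeasure_def)

lemma continuous_cintegral_pconv:
  assumes f: "f \<in> bcontfun"
  shows "continuous_on UNIV (\<lambda>(a, y). cintegral (pconv a y) f)"
proof -
  have "continuous_map compact_probs_topology (product_topology (\<lambda>_. euclidean) bcontfun)
      ((\<lambda>\<mu>. \<lambda>f\<in>bcontfun. cintegral \<mu> f) :: ('a set \<Rightarrow> complex) \<Rightarrow> _)"
    unfolding compact_probs_topology_def
    using continuous_map_pullback[OF continuous_map_id] by simp
  from continuous_map_compose[OF continuous_map_compose[OF conv_continuous this]
      continuous_map_product_projection[OF f, of "\<lambda>_. euclidean"]]
  show ?thesis using f by (simp add: o_def pconv_def case_prod_beta)
qed

lemma continuous_ltrans_pair:
  assumes "g \<in> Cb"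
  shows "continuous_on UNIV (\<lambda>(a, y). ltrans a g y)"
proof -
  have "continuous_on UNIV (\<lambda>p. Re (case p of (a, y) \<Rightarrow> cintegral (pconv a y) (\<lambda>x. of_real (g x))))"
    by (intro continuous_on_Re continuous_cintegral_pconv bcontfun_of_real assms)
  then show ?thesis by (simp add: cintegral_pconv case_prod_beta)
qed

lemma continuous_ltrans: "g \<in> Cb \<Longrightarrow> continuous_on A (ltrans a g)"
  using continuous_on_compose2[OF continuous_ltrans_pair continuous_on_Pair[OF continuous_on_const continuous_on_id]] by simp

lemma continuous_ltrans_left: "g \<in> Cb \<Longrightarrow> continuous_on A (\<lambda>a. ltrans a g y)"
  using continuous_on_compose2[OF continuous_ltrans_pair continuous_on_Pair[OF continuous_on_id continuous_on_const]] by simp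

lemma ltrans_const: "ltrans a (\<lambda>x. c) y = c"
  by (simp add: ltrans_def space_pmeasure measure_pmeasure_UNIV)

lemma ltrans_mono:
  assumes "f \<in> Cb" "g \<in> Cb" "\<And>x. f x \<le> g x"
  shows "ltrans a f y \<le> ltrans a g y"
  unfolding ltrans_def by (rule integral_mono) (use assms integrable_pmeasure in auto)

lemma ltrans_nonneg: "(\<And>x. 0 \<le> g x) \<Longrightarrow> 0 \<le> ltrans a g y"
  unfolding ltrans_def by simp

lemma ltrans_add: "f \<in> Cb \<Longrightarrow> g \<in> Cb \<Longrightarrow> ltrans a (\<lambda>x. f x + g x) y = ltrans a f y + ltrans a g y"
  unfolding ltrans_def by (simp add: integrable_pmeasure)

lemma ltrans_scale: "ltrans a (\<lambda>x. c * g x) y = c * ltrans a g y"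
  unfolding ltrans_def by simp

lemma ltrans_sum:
  assumes "\<And>i. i \<in> I \<Longrightarrow> f i \<in> Cb"
  shows "ltrans a (\<lambda>x. \<Sum>i\<in>I. f i x) y = (\<Sum>i\<in>I. ltrans a (f i) y)"
  unfolding ltrans_def by (rule Bochner_Integration.integral_sum) (use assms integrable_pmeasure in auto)

lemma ltrans_abs_le:
  assumes "g \<in> Cb" "\<And>x. \<bar>g x\<bar> \<le> B"
  shows "\<bar>ltrans a g y\<bar> \<le> B"
proof -
  have "ltrans a g y \<le> ltrans a (\<lambda>x. B) y" "ltrans a (\<lambda>x. - B) y \<le> ltrans a g y"
    by (intro ltrans_mono assms Cb_const; use assms(2) abs_le_iff in \<open>metis minus_le_iff\<close>)+
  then show ?thesis by (simp add: ltrans_const)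
qed

lemma ltrans_Cb:
  assumes "g \<in> Cb"
  shows "ltrans a g \<in> Cb"
proof -
  obtain B where "\<And>x. \<bar>g x\<bar> \<le> B" using assms Cb_cases by metis
  then show ?thesis by (intro CbI[OF continuous_ltrans[OF assms] ltrans_abs_le[OF assms]])
qed

lemma ltrans_identity: "g \<in> Cb \<Longrightarrow> ltrans e g = g"
  using integral_point_mass[OF Cb_continuous] by (auto simp: ltrans_def pmeasure_def pconv_def identity)

lemma AE_pmeasure_psupp: "AE t in pmeasure a y. t \<in> psupp a y"
  unfolding pmeasure_def psupp_def
  by (rule AE_I[of _ _ "- measure_supp (pconv a y)"])
    (auto simp: sets_as_measure[OF pconv_nonneg] emeasure_Compl_measure_supp[OF pconv_nonneg]
      intro!: borel_open open_Compl closed_measure_supp)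

lemma psupp_sets: "psupp a y \<in> sets (pmeasure a y)"
  using compact_imp_closed[OF compact_psupp] by (simp add: sets_pmeasure borel_closed)

lemma integral_pmeasure_psupp:
  fixes g :: "'a \<Rightarrow> real"
  assumes "continuous_on UNIV g"
  shows "(\<integral>t. indicator (psupp a y) t * g t \<partial>pmeasure a y) = integral\<^sup>L (pmeasure a y) g"
proof (rule integral_cong_AE)
  show m: "g \<in> borel_measurable (pmeasure a y)"
    unfolding pmeasure_def by (rule measurable_as_measure[OF pconv_nonneg assms])
  show "(\<lambda>t. indicator (psupp a y) t * g t) \<in> borel_measurable (pmeasure a y)"
    by (intro borel_measurable_times borel_measurable_indicator m psupp_sets)
  show "AE t in pmeasure a y. indicator (psupp a y) t * g t = g t" using AE_pmeasure_psupp by eventually_elim simp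
qed

text \<open>The product of the point masses at \<open>b\<close>, \<open>a\<close> and
  \<open>y\<close>, in this order, is integrated against \<open>g\<close> under both bracketings.
  The product of \<open>b\<close> and \<open>a\<close> therefore appears with the order of the
  translations reversed.\<close>

lemma ltrans_ltrans:
  assumes g: "g \<in> Cb"
  shows "ltrans a (ltrans b g) y = (\<integral>z. ltrans z g y \<partial>pmeasure b a)"
proof -
  let ?f = "\<lambda>x. complex_of_real (g x)"
  let ?pm = "point_mass"
  have f: "?f \<in> bcontfun" by (rule bcontfun_of_real[OF g])
  have cc: "pconv x z \<in> radon_measures" for x z using nonneg_radonD(1)[OF pconv_nonneg] .
  have "complex_of_real (ltrans a (ltrans b g) y) = cintegral (pconv a y) (\<lambda>z. of_real (ltrans b g z))"
    by (simp add: cintegral_pconv)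
  also have "(\<lambda>z. of_real (ltrans b g z)) = (\<lambda>z. cintegral (?pm b) (\<lambda>x. cintegral (pconv x z) ?f))"
    by (simp add: cintegral_pconv cintegral_point_mass continuous_on_of_real continuous_ltrans_left[OF g])
  also have "cintegral (pconv a y) \<dots> = cintegral (conv (?pm b) (pconv a y)) ?f"
    unfolding pconv_def by (rule conv_weak[symmetric, OF point_mass_radon cc[unfolded pconv_def] f])
  also have "conv (?pm b) (pconv a y) = conv (pconv b a) (?pm y)"
    unfolding pconv_def by (rule conv_assoc[symmetric]) (rule point_mass_radon)+
  also have "cintegral \<dots> ?f = cintegral (?pm y) (\<lambda>y. cintegral (pconv b a) (\<lambda>x. cintegral (pconv x y) ?f))"
    unfolding pconv_def by (rule conv_weak[OF cc[unfolded pconv_def] point_mass_radon f])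
  also have "\<dots> = cintegral (?pm y) (\<lambda>y. of_real (\<integral>z. ltrans z g y \<partial>pmeasure b a))"
    by (simp add: cintegral_pconv) (simp add: ltrans_def)
  also have "\<dots> = of_real (\<integral>z. ltrans z g y \<partial>pmeasure b a)"
  proof (rule cintegral_point_mass)
    \<comment> \<open>\<open>cintegral_point_mass\<close> evaluates continuous functions, so the
      parameter integral must be shown continuous; restricting it to the compact support makes this
      possible.\<close>
    have "continuous_on UNIV (\<lambda>y. \<integral>z. indicator (psupp b a) z * ltrans z g y \<partial>pmeasure b a)"
      by (rule continuous_integral_indicator[OF finite_pmeasure sets_pmeasure compact_psupp continuous_ltrans_pair[OF g]])
    then have "continuous_on UNIV (\<lambda>y. \<integral>z. ltrans z g y \<partial>pmeasure b a)"
      by (simp add: integral_pmeasure_psupp continuous_ltrans_left[OF g])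
    then show "continuous_on UNIV (\<lambda>y. complex_of_real (\<integral>z. ltrans z g y \<partial>pmeasure b a))"
      by (rule continuous_on_of_real)
  qed
  finally show ?thesis by simp
qed

section \<open>Supports of products of point masses\<close>

lemma ltrans_pos:
  assumes g: "g \<in> Cb" "\<And>x. 0 \<le> g x" and z: "z \<in> psupp a y" "0 < g z"
  shows "0 < ltrans a g y"
proof -
  define U where "U = {x. g z / 2 < g x}"
  have "open U" unfolding U_def by (rule open_Collect_less[OF continuous_on_const Cb_continuous[OF g(1)]])
  then have U: "open U" "z \<in> U" using z by (auto simp: U_def)
  then have "emeasure (pmeasure a y) U \<noteq> 0"
    using z(1) measure_supp_iff[OF pconv_nonneg] by (auto simp: psupp_def pmeasure_def)
  then have mU: "0 < measure (pmeasure a y) U"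
    using finite_measure.emeasure_eq_measure[OF finite_pmeasure] by (metis ennreal_0 measure_nonneg order_less_le)
  have Us: "U \<in> sets (pmeasure a y)" using U by (simp add: sets_pmeasure)
  have "0 < g z / 2 * measure (pmeasure a y) U" using mU z by simp
  also have "\<dots> = (\<integral>x. g z / 2 * indicator U x \<partial>pmeasure a y)"
    using Us by (simp add: space_pmeasure)
  also have "\<dots> \<le> integral\<^sup>L (pmeasure a y) g"
  proof (rule integral_mono)
    show "integrable (pmeasure a y) (\<lambda>x. g z / 2 * indicator U x)"
      using Us finite_measure.emeasure_finite[OF finite_pmeasure]
      by (intro integrable_mult_right integrable_real_indicator) (auto simp: less_top[symmetric])
    show "g z / 2 * indicator U x \<le> g x" for x
      using g(2)[of x] by (cases "x \<in> U") (auto simp: U_def)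
  qed (rule integrable_pmeasure[OF g(1)])
  finally show ?thesis by (simp add: ltrans_def)
qed

lemma ltrans_zero:
  assumes g: "g \<in> Cb" and z: "\<And>x. x \<in> psupp a y \<Longrightarrow> g x = 0"
  shows "ltrans a g y = 0"
proof -
  have "ltrans a g y = (\<integral>t. indicator (psupp a y) t * g t \<partial>pmeasure a y)"
    by (simp add: ltrans_def integral_pmeasure_psupp Cb_continuous[OF g])
  also have "(\<lambda>t. indicator (psupp a y) t * g t) = (\<lambda>t. 0)" using z by (auto simp: indicator_def)
  finally show ?thesis by simp
qed

lemma psupp_nonempty: "psupp a y \<noteq> {}"
proof
  assume "psupp a y = {}"
  then have "ltrans a (\<lambda>x. 1) y = 0" by (intro ltrans_zero Cb_const) auto
  then show False by (simp add: ltrans_const)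
qed

text \<open>Upper semicontinuity of the supports. The basic Michael-open set is taken with
  \<open>UNIV\<close> as the set to be hit, a condition that holds because supports are
  non-empty.\<close>

lemma open_psupp_subset:
  assumes "open V"
  shows "open {p. psupp (fst p) (snd p) \<subseteq> V}"
proof -
  have "openin michael_topology {C. compact C \<and> C \<noteq> {} \<and> C \<inter> UNIV \<noteq> {} \<and> C \<subseteq> V}"
    unfolding michael_topology_def
    by (rule topology_generated_by_Basis) (use assms open_UNIV in blast)
  from openin_continuous_map_preimage[OF supp_continuous this]
  show ?thesis using psupp_nonempty compact_psupp by (simp add: psupp_def pconv_def case_prod_beta)
qed

lemma compact_UN_psupp:
  assumes "compact A" "compact B"
  shows "compact (\<Union>a\<in>A. \<Union>b\<in>B. psupp a b)"
proof -
  have "compact (\<Union>p\<in>A \<times> B. psupp (fst p) (snd p))"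
    by (rule compact_UN_upper_semicontinuous) (use assms compact_Times compact_psupp open_psupp_subset in auto)
  also have "(\<Union>p\<in>A \<times> B. psupp (fst p) (snd p)) = (\<Union>a\<in>A. \<Union>b\<in>B. psupp a b)" by (simp add: set_eq_iff)
  finally show ?thesis .
qed

lemma identity_in_psupp: "e \<in> psupp x y \<longleftrightarrow> y = invol x"
  using identity_in_supp by (simp add: psupp_def pconv_def)

text \<open>Both sides of the associativity law \<open>\<delta>\<^bsub>c\<^esub> * (\<delta>\<^bsub>a\<^esub> * \<delta>\<^bsub>b\<^esub>) = (\<delta>\<^bsub>c\<^esub> * \<delta>\<^bsub>a\<^esub>) * \<delta>\<^bsub>b\<^esub>\<close> are
  tested against functions concentrated near \<open>e\<close>, where \<open>c\<close> is the involute of \<open>z\<close>.\<close>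

lemma psupp_rotate:
  assumes z: "z \<in> psupp a b"
  shows "invol b \<in> psupp (invol z) a"
proof -
  define c where "c = invol z"
  define Q where "Q = (\<Union>t\<in>psupp c a. \<Union>u\<in>{b}. psupp t u)"
  have "compact Q" unfolding Q_def by (rule compact_UN_psupp[OF compact_psupp]) simp
  have "e \<in> Q"
  proof (rule ccontr)
    assume "e \<notin> Q"
    then have eQ: "{e} \<subseteq> - Q" by simp
    from Urysohn_Cc[OF locally_compact compact_sing open_Compl[OF compact_imp_closed[OF \<open>compact Q\<close>]] eQ]
    obtain h W where h: "h \<in> Cc" "\<And>x. 0 \<le> h x" "\<And>x. h x \<le> 1" "closure {x. h x \<noteq> 0} \<subseteq> - Q"
        "open W" "{e} \<subseteq> W" "\<And>x. x \<in> W \<Longrightarrow> h x = 1"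
      by metis
    have hb: "h \<in> Cb" by (rule Cc_Cb[OF h(1)])
    have "ltrans t h b = 0" if "t \<in> psupp c a" for t
    proof (rule ltrans_zero[OF hb])
      fix x assume "x \<in> psupp t b"
      then have "x \<in> Q" using that by (auto simp: Q_def)
      then show "h x = 0" using support_subsetD[OF h(4), of x] by blast
    qed
    then have "(\<lambda>t. indicator (psupp c a) t * ltrans t h b) = (\<lambda>t. 0)" by (auto simp: indicator_def)
    then have "ltrans a (ltrans c h) b = 0"
      using integral_pmeasure_psupp[OF continuous_ltrans_left[OF hb], of c a b] by (simp add: ltrans_ltrans[OF hb])
    \<comment> \<open>Since \<open>c\<close> is the involute of \<open>z\<close>, the point
      \<open>e\<close> belongs to \<open>psupp c z\<close>, and \<open>h\<close> is 1 at
      \<open>e\<close>. As \<open>z \<in> psupp a b\<close>, the other bracketing then gives a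
      positive value.\<close>
    moreover have "0 < ltrans c h z"
      by (rule ltrans_pos[OF hb h(2), of e]) (use h(6,7) in \<open>auto simp: identity_in_psupp c_def invol_invol\<close>)
    then have "0 < ltrans a (ltrans c h) b"
      by (intro ltrans_pos[OF ltrans_Cb[OF hb] _ z] ltrans_nonneg h(2))
    ultimately show False by simp
  qed
  then obtain t where "t \<in> psupp c a" "e \<in> psupp t b" by (auto simp: Q_def)
  then show ?thesis by (simp add: identity_in_psupp c_def invol_invol)
qed

lemma continuous_invol: "continuous_on A invol"
  using homeomorphic_imp_continuous_map[OF invol_homeomorphic] continuous_on_subset by auto

text \<open>If \<open>psupp a y\<close> meets the support of \<open>g\<close> at \<open>x\<close>,
  rotation puts the involute of \<open>y\<close> into the support of the product of
  \<open>invol x\<close> and \<open>a\<close>. All such points form a compact set, and one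
  \<open>K\<close> works for every \<open>a \<in> C\<close>; this uniformity is what
  \<open>interchange\<close> and \<open>orbit_ltrans_near\<close> require.\<close>

lemma ltrans_support:
  assumes g: "g \<in> Cc" and C: "compact C"
  obtains K where "compact K" "\<And>a y. a \<in> C \<Longrightarrow> y \<notin> K \<Longrightarrow> ltrans a g y = 0"
proof -
  obtain L where L: "compact L" "\<And>x. x \<notin> L \<Longrightarrow> g x = 0" using Cc_cases g by metis
  define K where "K = invol ` (\<Union>u\<in>invol ` L. \<Union>a\<in>C. psupp u a)"
  have "compact K"
    unfolding K_def by (intro compact_continuous_image continuous_invol compact_UN_psupp L C)
  moreover have "ltrans a g y = 0" if a: "a \<in> C" and y: "y \<notin> K" for a y
  proof (rule ltrans_zero[OF Cc_Cb[OF g]])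
    fix x assume x: "x \<in> psupp a y"
    show "g x = 0"
    proof (rule ccontr)
      assume "g x \<noteq> 0"
      then have "x \<in> L" using L by blast
      then have "invol y \<in> (\<Union>u\<in>invol ` L. \<Union>a\<in>C. psupp u a)" using psupp_rotate[OF x] a by blast
      then have "y \<in> K" unfolding K_def by (metis image_eqI invol_invol)
      with y show False ..
    qed
  qed
  ultimately show thesis using that by blast
qed

lemma ltrans_Cc:
  assumes "g \<in> Cc" shows "ltrans a g \<in> Cc"
proof -
  obtain K where K: "compact K" "\<And>b y. b \<in> {a} \<Longrightarrow> y \<notin> K \<Longrightarrow> ltrans b g y = 0"
    using ltrans_support[OF assms compact_sing[of a]] by metis
  show ?thesis by (rule CcI[OF continuous_ltrans[OF Cc_Cb[OF assms]] K(1)]) (simp add: K(2))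
qed

text \<open>Replaces solving for the left factor in a group: rotating any point \<open>u\<close> of
  \<open>psupp y (invol z)\<close> makes \<open>invol u\<close> the required
  \<open>x\<close>.\<close>

lemma psupp_transitive: "\<exists>x. z \<in> psupp x y"
proof -
  obtain u where "u \<in> psupp y (invol z)" using psupp_nonempty by blast
  from psupp_rotate[OF this] show ?thesis by (auto simp: invol_invol)
qed

text \<open>At every point some translate of \<open>f\<close> is positive, by
  \<open>psupp_transitive\<close>. Compactness leaves finitely many, and their sum has a positive
  minimum on \<open>K\<close>, whose reciprocal is \<open>c\<close>.\<close>

lemma translates_dominate:
  assumes f: "f \<in> Cc" "\<And>x. 0 \<le> f x" "f \<noteq> (\<lambda>x. 0)" and K: "compact K"
  obtains A c where "finite A" "0 \<le> c" "\<And>y. y \<in> K \<Longrightarrow> 1 \<le> c * (\<Sum>a\<in>A. ltrans a f y)"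
proof -
  obtain z where z: "0 < f z" using f(2,3) by (metis order_less_le)
  have fb: "f \<in> Cb" by (rule Cc_Cb[OF f(1)])
  have op: "open {y. 0 < ltrans a f y}" for a
    by (intro open_Collect_less continuous_on_const continuous_ltrans fb)
  have cov: "K \<subseteq> (\<Union>a\<in>UNIV. {y. 0 < ltrans a f y})"
    using psupp_transitive[of z] ltrans_pos[OF fb f(2) _ z] by blast
  obtain A where A: "finite A" "K \<subseteq> (\<Union>a\<in>A. {y. 0 < ltrans a f y})"
    by (rule compactE_image[OF K _ cov]) (use op in auto)
  define h where "h y = (\<Sum>a\<in>A. ltrans a f y)" for y
  have hpos: "0 < h y" if y: "y \<in> K" for y
  proof -
    obtain a where "a \<in> A" "0 < ltrans a f y" using A(2) y by blast
    then show ?thesis unfolding h_def using A(1) ltrans_nonneg[OF f(2)] by (auto intro: sum_pos2)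
  qed
  show thesis
  proof (cases "K = {}")
    case True then show thesis using that[of "{}" 0] by simp
  next
    case False
    have "continuous_on K h" unfolding h_def by (intro continuous_on_sum continuous_ltrans fb)
    then obtain y0 where y0: "y0 \<in> K" "\<And>y. y \<in> K \<Longrightarrow> h y0 \<le> h y"
      using continuous_attains_inf[OF K False] by blast
    have "1 \<le> (1 / h y0) * h y" if "y \<in> K" for y
      using y0(2)[OF that] hpos[OF y0(1)] by simp
    then show thesis using that[of A "1 / h y0"] A hpos[OF y0(1)] by (simp add: h_def)
  qed
qed

end

section \<open>From a Haar measure to positivity\<close>

lemma compactly_supportedD:
  fixes f :: "'a::t2_space \<Rightarrow> complex"
  assumes "f \<in> compactly_supported"
  shows "(\<lambda>x. Re (f x)) \<in> Cc" "(\<lambda>x. Im (f x)) \<in> Cc"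
proof -
  have f: "continuous_on UNIV f" "compact (closure {x. f x \<noteq> 0})"
    using assms by (auto simp: compactly_supported_def bcontfun_def)
  have z: "f x = 0" if "x \<notin> closure {x. f x \<noteq> 0}" for x
    using that by (rule zero_outside_closure)
  show "(\<lambda>x. Re (f x)) \<in> Cc"
    by (rule CcI[OF continuous_on_Re[OF f(1)] f(2)]) (drule z, simp)
  show "(\<lambda>x. Im (f x)) \<in> Cc"
    by (rule CcI[OF continuous_on_Im[OF f(1)] f(2)]) (drule z, simp)
qed

lemma compactly_supported_of_real:
  fixes g :: "'a::t2_space \<Rightarrow> real"
  assumes "g \<in> Cc"
  shows "(\<lambda>x. complex_of_real (g x)) \<in> compactly_supported"
  using bcontfun_of_real[OF Cc_Cb[OF assms]] Cc_compact_support[OF assms] by (simp add: compactly_supported_def)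

lemma nonneg_compactly_supportedD:
  fixes f :: "'a::t2_space \<Rightarrow> complex"
  assumes "f \<in> nonneg_compactly_supported"
  shows "(\<lambda>x. Re (f x)) \<in> Cc" "0 \<le> Re (f x)" "f = (\<lambda>x. complex_of_real (Re (f x)))"
  using assms compactly_supportedD(1)[of f]
  by (auto simp: nonneg_compactly_supported_def less_eq_complex_def complex_eq_iff fun_eq_iff)

lemma nonneg_compactly_supported_of_real:
  fixes g :: "'a::t2_space \<Rightarrow> real"
  assumes "g \<in> Cc" "\<And>x. 0 \<le> g x"
  shows "(\<lambda>x. complex_of_real (g x)) \<in> nonneg_compactly_supported"
  using assms compactly_supported_of_real by (simp add: nonneg_compactly_supported_def less_eq_complex_def)

lemma nonneg_radon_tight:
  fixes \<mu> :: "'a::t2_space set \<Rightarrow> complex"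
  assumes \<mu>: "\<mu> \<in> nonneg_radon_measures" and \<epsilon>: "0 < \<epsilon>"
  obtains K where "compact K" "measure (as_measure \<mu>) (- K) < \<epsilon>"
proof -
  obtain K U where K: "compact K" "open U" "UNIV \<subseteq> U" "total_variation \<mu> (U - K) < ennreal \<epsilon>"
    using radon_regular[OF nonneg_radonD(1)[OF \<mu>], of UNIV "ennreal \<epsilon>"] \<epsilon>
    by (metis ennreal_less_zero_iff sets.top space_borel)
  have "U - K = - K" using K(3) by auto
  moreover have "- K \<in> sets borel" using compact_imp_closed[OF K(1)] by (intro borel_open open_Compl)
  ultimately have "emeasure (as_measure \<mu>) (- K) < ennreal \<epsilon>"
    using K(4) total_variation_eq[OF \<mu>] by metis
  then have "measure (as_measure \<mu>) (- K) < \<epsilon>"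
    using \<epsilon> by (simp add: finite_measure.emeasure_eq_measure[OF finite_as_measure[OF \<mu>]] ennreal_less_iff)
  with K that show thesis by blast
qed

context hypergroup
begin

definition convolve :: "('a set \<Rightarrow> complex) \<Rightarrow> ('a \<Rightarrow> real) \<Rightarrow> 'a \<Rightarrow> real" where
  "convolve \<mu> g y = (\<integral>x. ltrans (invol x) g y \<partial>as_measure \<mu>)"

lemma translate_of_real:
  "translate conv invol x (\<lambda>x. complex_of_real (g x)) = (\<lambda>y. complex_of_real (ltrans (invol x) g y))"
  using cintegral_pconv by (simp add: translate_def pconv_def)

lemma conv_fun_of_real:
  "\<mu> \<in> nonneg_radon_measures \<Longrightarrow>
    conv_fun conv invol \<mu> (\<lambda>x. complex_of_real (g x)) y = complex_of_real (convolve \<mu> g y)"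
  by (simp add: conv_fun_def translate_of_real cintegral_of_real convolve_def)

lemma positivity_property_iff:
  "positivity_property conv invol (\<lambda>x. complex_of_real (g x)) \<longleftrightarrow>
    (\<forall>\<mu>\<in>nonneg_radon_measures. \<forall>\<nu>\<in>nonneg_radon_measures.
      (\<forall>y. convolve \<mu> g y \<le> convolve \<nu> g y) \<longrightarrow> Re (\<mu> UNIV) \<le> Re (\<nu> UNIV))"
  unfolding positivity_property_def
  by (simp add: conv_fun_of_real measure_norm_eq less_eq_complex_def nonneg_radonD(3) ennreal_le_iff)

lemma continuous_ltrans_invol: "g \<in> Cb \<Longrightarrow> continuous_on UNIV (\<lambda>(x, y). ltrans (invol x) g y)"
  using continuous_on_compose2[OF continuous_ltrans_pair continuous_on_Pair[OF
      continuous_on_compose2[OF continuous_invol continuous_on_fst[OF continuous_on_id]]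
      continuous_on_snd[OF continuous_on_id]], of g UNIV UNIV]
  by (simp add: case_prod_beta)

text \<open>The inequality cannot be integrated directly, since \<open>\<mu> * f\<close> need not
  have compact support. From \<open>\<mu>\<close> only a compact part \<open>A\<close> is kept,
  which lowers the left side. From \<open>\<nu>\<close> a compact part \<open>L\<close> is kept, and
  the small tail is absorbed into a multiple of \<open>h\<close>. Both parts lie in
  \<open>Cc\<close>, and \<open>interchange\<close> turns invariance into mass times
  \<open>\<phi> f\<close>.\<close>

lemma positivity_of_invariant_functional:
  assumes "positive_functional \<phi>" and inv: "\<And>a g. g \<in> Cc \<Longrightarrow> \<phi> (ltrans a g) = \<phi> g"
    and f: "f \<in> Cc" "\<And>x. 0 \<le> f x" "0 < \<phi> f"
    and \<mu>: "\<mu> \<in> nonneg_radon_measures" and \<nu>: "\<nu> \<in> nonneg_radon_measures"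
    and le: "\<And>y. convolve \<mu> f y \<le> convolve \<nu> f y"
  shows "Re (\<mu> UNIV) \<le> Re (\<nu> UNIV)"
proof -
  interpret positive_functional \<phi> by fact
  have fb: "f \<in> Cb" by (rule Cc_Cb[OF f(1)])
  obtain B where B: "0 \<le> B" "\<And>x. \<bar>f x\<bar> \<le> B" using Cb_cases[OF fb] by metis
  let ?G = "\<lambda>x y. ltrans (invol x) f y"
  have G: "0 \<le> ?G x y" "?G x y \<le> B" for x y
    using ltrans_nonneg[OF f(2)] ltrans_abs_le[OF fb B(2)] by (auto simp: abs_le_iff)
  have cG: "continuous_on UNIV (\<lambda>x. ?G x y)" for y
    using continuous_on_compose2[OF continuous_ltrans_invol[OF fb] continuous_on_Pair[OF continuous_on_id continuous_on_const]]
    by simp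
  have supp: "\<exists>K. compact K \<and> (\<forall>x\<in>A. \<forall>y. y \<notin> K \<longrightarrow> ?G x y = 0)" if "compact A" for A
    using ltrans_support[OF f(1) compact_continuous_image[OF continuous_invol that]] by (metis imageI)
  have part: "(\<lambda>y. \<integral>x. indicator A x * ?G x y \<partial>as_measure \<kappa>) \<in> Cc"
    "\<phi> (\<lambda>y. \<integral>x. indicator A x * ?G x y \<partial>as_measure \<kappa>) = measure (as_measure \<kappa>) A * \<phi> f"
    if A: "compact A" and \<kappa>: "\<kappa> \<in> nonneg_radon_measures" for A \<kappa>
  proof -
    obtain K where K: "compact K" "\<And>x y. x \<in> A \<Longrightarrow> y \<notin> K \<Longrightarrow> ?G x y = 0" using supp[OF A] by blast
    note ic = interchange[OF finite_as_measure[OF \<kappa>] sets_as_measure[OF \<kappa>] A K(1) continuous_ltrans_invol[OF fb] K(2)]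
    show "(\<lambda>y. \<integral>x. indicator A x * ?G x y \<partial>as_measure \<kappa>) \<in> Cc" by (rule ic(1))
    show "\<phi> (\<lambda>y. \<integral>x. indicator A x * ?G x y \<partial>as_measure \<kappa>) = measure (as_measure \<kappa>) A * \<phi> f"
      using ic(3) by (simp add: inv[OF f(1)] space_as_measure[OF \<kappa>])
  qed
  have iG: "integrable (as_measure \<kappa>) (\<lambda>x. ?G x y)" if "\<kappa> \<in> nonneg_radon_measures" for \<kappa> y
    by (rule integrable_as_measure[OF that cG]) (use G in auto)
  have iGA: "integrable (as_measure \<kappa>) (\<lambda>x. indicator A x * ?G x y)"
    if "\<kappa> \<in> nonneg_radon_measures" "A \<in> sets borel" for \<kappa> y A
    using integrable_real_mult_indicator[OF _ iG[OF that(1)], of A] that by (simp add: sets_as_measure mult.commute)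
  have compact_le: "measure (as_measure \<mu>) A \<le> Re (\<nu> UNIV)" if A: "compact A" for A
  proof -
    have Ab: "A \<in> sets borel" using compact_imp_closed[OF A] by (rule borel_closed)
    obtain K where K: "compact K" "\<And>x y. x \<in> A \<Longrightarrow> y \<notin> K \<Longrightarrow> ?G x y = 0" using supp[OF A] by blast
    obtain h W where h: "h \<in> Cc" "\<And>x. 0 \<le> h x" "K \<subseteq> W" "\<And>x. x \<in> W \<Longrightarrow> h x = 1"
      using Urysohn_Cc[OF lc K(1) open_UNIV] by (metis subset_UNIV)
    let ?u = "\<lambda>y. \<integral>x. indicator A x * ?G x y \<partial>as_measure \<mu>"
    \<comment> \<open>\<open>K\<close> and \<open>h\<close> depend on \<open>A\<close> and not on
      \<open>\<delta>\<close>, so \<open>B * \<phi> h\<close> stays fixed when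
      \<open>\<delta>\<close> tends to 0.\<close>
    have "measure (as_measure \<mu>) A * \<phi> f \<le> Re (\<nu> UNIV) * \<phi> f + \<delta> * (B * \<phi> h)" if \<delta>: "0 < \<delta>" for \<delta>
    proof -
      obtain L where L: "compact L" "measure (as_measure \<nu>) (- L) < \<delta>" using nonneg_radon_tight[OF \<nu> \<delta>] by metis
      have Lb: "L \<in> sets borel" "- L \<in> sets borel"
        using compact_imp_closed[OF L(1)] by (auto intro: borel_closed borel_open)
      let ?v = "\<lambda>y. \<integral>x. indicator L x * ?G x y \<partial>as_measure \<nu>"
      \<comment> \<open>Off \<open>K\<close> the left side is 0. On \<open>K\<close>, where
        \<open>h\<close> is 1, the tail of \<open>\<nu>\<close> outside \<open>L\<close> contributes
        at most \<open>\<delta> * B\<close>.\<close>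
      have pw: "?u y \<le> ?v y + (\<delta> * B) * h y" for y
      proof (cases "y \<in> K")
        case True
        have "?u y \<le> convolve \<mu> f y"
          unfolding convolve_def by (rule integral_mono) (use iG[OF \<mu>] iGA[OF \<mu> Ab] G in \<open>auto simp: indicator_def\<close>)
        also have "\<dots> \<le> convolve \<nu> f y" by (rule le)
        also have "\<dots> = (\<integral>x. indicator L x * ?G x y + indicator (- L) x * ?G x y \<partial>as_measure \<nu>)"
          unfolding convolve_def by (rule Bochner_Integration.integral_cong) (auto simp: indicator_def)
        also have "\<dots> = ?v y + (\<integral>x. indicator (- L) x * ?G x y \<partial>as_measure \<nu>)"
          by (rule Bochner_Integration.integral_add) (use iGA[OF \<nu>] Lb in auto)
        also have "(\<integral>x. indicator (- L) x * ?G x y \<partial>as_measure \<nu>) \<le> (\<integral>x. B * indicator (- L) x \<partial>as_measure \<nu>)"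
        proof (rule integral_mono)
          show "integrable (as_measure \<nu>) (\<lambda>x. B * indicator (- L) x)"
            using Lb finite_measure.emeasure_finite[OF finite_as_measure[OF \<nu>]]
            by (intro integrable_mult_right integrable_real_indicator) (auto simp: less_top[symmetric] sets_as_measure[OF \<nu>])
          show "integrable (as_measure \<nu>) (\<lambda>x. indicator (- L) x * ?G x y)" by (rule iGA[OF \<nu> Lb(2)])
        qed (use G B in \<open>auto simp: indicator_def\<close>)
        also have "\<dots> = B * measure (as_measure \<nu>) (- L)" using Lb by (simp add: space_as_measure[OF \<nu>])
        also have "\<dots> \<le> (\<delta> * B) * h y"
        proof -
          have "h y = 1" using h(3,4) True by blast
          then show ?thesis using mult_left_mono[OF less_imp_le[OF L(2)] B(1)] by (simp add: mult.commute)
        qed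
        finally show ?thesis by simp
      next
        case False
        then have "(\<lambda>x. indicator A x * ?G x y) = (\<lambda>x. 0)" using K(2) by (auto simp: indicator_def)
        then have "?u y = 0" by simp
        moreover have "0 \<le> ?v y" by (rule Bochner_Integration.integral_nonneg) (use G in auto)
        ultimately show ?thesis using h(2)[of y] \<delta> B(1) by simp
      qed
      have "\<phi> ?u \<le> \<phi> (\<lambda>y. ?v y + (\<delta> * B) * h y)"
        by (rule mono[OF part(1)[OF A \<mu>] Cc_add[OF part(1)[OF L(1) \<nu>] Cc_scale[OF h(1)]] pw])
      also have "\<dots> = measure (as_measure \<nu>) L * \<phi> f + (\<delta> * B) * \<phi> h"
        by (simp only: add[OF part(1)[OF L(1) \<nu>] Cc_scale[OF h(1)]] scale[OF h(1)] part(2)[OF L(1) \<nu>])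
      also have "measure (as_measure \<nu>) L * \<phi> f \<le> Re (\<nu> UNIV) * \<phi> f"
        using finite_measure.finite_measure_mono[OF finite_as_measure[OF \<nu>], of L UNIV] f(3)
        by (simp add: measure_as_measure[OF \<nu>] sets_as_measure[OF \<nu>])
      finally show ?thesis by (simp add: part(2)[OF A \<mu>] algebra_simps)
    qed
    note * = this
    define c where "c = B * \<phi> h"
    have c: "0 \<le> c" using B(1) nonneg[OF h(1,2)] by (simp add: c_def)
    have "measure (as_measure \<mu>) A * \<phi> f \<le> Re (\<nu> UNIV) * \<phi> f + \<eta>" if "0 < \<eta>" for \<eta>
    proof -
      have "measure (as_measure \<mu>) A * \<phi> f \<le> Re (\<nu> UNIV) * \<phi> f + (\<eta> / (c + 1)) * c"
        using *[of "\<eta> / (c + 1)"] c that unfolding c_def[symmetric] by simp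
      moreover have "(\<eta> / (c + 1)) * c \<le> \<eta>" using c that by (simp add: field_simps)
      ultimately show ?thesis by linarith
    qed
    then have "measure (as_measure \<mu>) A * \<phi> f \<le> Re (\<nu> UNIV) * \<phi> f" by (rule field_le_epsilon)
    then show ?thesis using f(3) by simp
  qed
  show ?thesis
  proof (rule field_le_epsilon)
    fix \<epsilon> :: real assume "0 < \<epsilon>"
    then obtain A where A: "compact A" "measure (as_measure \<mu>) (- A) < \<epsilon>" using nonneg_radon_tight[OF \<mu>] by metis
    have "A \<in> sets borel" using compact_imp_closed[OF A(1)] by (rule borel_closed)
    then have "measure (as_measure \<mu>) (- A) = Re (\<mu> UNIV) - measure (as_measure \<mu>) A"
      using finite_measure.finite_measure_compl[OF finite_as_measure[OF \<mu>], of A]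
      by (simp add: space_as_measure[OF \<mu>] sets_as_measure[OF \<mu>] measure_as_measure[OF \<mu>] Compl_eq_Diff_UNIV)
    then show "Re (\<mu> UNIV) \<le> Re (\<nu> UNIV) + \<epsilon>" using A(2) compact_le[OF A(1)] by linarith
  qed
qed

text \<open>For strict positivity: if the integral of \<open>f\<close> were 0, so would be that of
  each translate. Finite sums of translates dominate the indicator of any compact set, so all
  compact sets would be null and, by inner regularity, the whole space too.\<close>

lemma haar_functional:
  assumes M: "left_haar_measure conv invol M"
  shows "positive_functional (integral\<^sup>L M)"
    and "\<And>a g. g \<in> Cc \<Longrightarrow> integral\<^sup>L M (ltrans a g) = integral\<^sup>L M g"
    and "\<And>f. f \<in> Cc \<Longrightarrow> (\<And>x. 0 \<le> f x) \<Longrightarrow> f \<noteq> (\<lambda>x. 0) \<Longrightarrow> 0 < integral\<^sup>L M f"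
proof -
  have s: "sets M = sets borel" and fin: "\<And>K. compact K \<Longrightarrow> emeasure M K < \<infinity>"
    and inner: "\<And>U. open U \<Longrightarrow> emeasure M U = (SUP K\<in>{K. compact K \<and> K \<subseteq> U}. emeasure M K)"
    and nz: "emeasure M UNIV \<noteq> 0"
    and inv: "\<And>f x. f \<in> compactly_supported \<Longrightarrow> integral\<^sup>L M (translate conv invol x f) = integral\<^sup>L M f"
    using M by (auto simp: left_haar_measure_def regular_borel_measure_def)
  show pf: "positive_functional (integral\<^sup>L M)"
    by (rule positive_functional_integral[OF locally_compact s fin])
  then interpret positive_functional "integral\<^sup>L M" .
  show inv': "integral\<^sup>L M (ltrans a g) = integral\<^sup>L M g" if g: "g \<in> Cc" for a g
  proof -
    have "complex_of_real (integral\<^sup>L M (ltrans a g)) = integral\<^sup>L M (translate conv invol (invol a) (\<lambda>x. complex_of_real (g x)))"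
      by (simp add: translate_of_real invol_invol)
    also have "\<dots> = complex_of_real (integral\<^sup>L M g)"
      by (simp add: inv[OF compactly_supported_of_real[OF g]])
    finally show ?thesis by simp
  qed
  show "0 < integral\<^sup>L M f" if f: "f \<in> Cc" "\<And>x. 0 \<le> f x" "f \<noteq> (\<lambda>x. 0)" for f
  proof (rule ccontr)
    assume "\<not> 0 < integral\<^sup>L M f"
    with nonneg[OF f(1,2)] have z: "integral\<^sup>L M f = 0" by simp
    have "emeasure M C = 0" if C: "compact C" for C
    proof -
      obtain A c where A: "finite A" "0 \<le> c" "\<And>y. y \<in> C \<Longrightarrow> 1 \<le> c * (\<Sum>a\<in>A. ltrans a f y)"
        using translates_dominate[OF f C] by metis
      have Cs: "C \<in> sets M" using compact_imp_closed[OF C] s by (simp add: borel_closed)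
      have sp: "space M = UNIV" using sets_eq_imp_space_eq[OF s] by simp
      have TC: "(\<lambda>y. c * (\<Sum>a\<in>A. ltrans a f y)) \<in> Cc" by (intro Cc_scale Cc_sum ltrans_Cc f)
      have "measure M C = (\<integral>y. indicator C y \<partial>M)" using Cs sp by (simp add: Int_absorb2)
      also have "\<dots> \<le> (\<integral>y. c * (\<Sum>a\<in>A. ltrans a f y) \<partial>M)"
      proof (rule integral_mono)
        show "integrable M (indicator C :: 'a \<Rightarrow> real)" using Cs fin[OF C] by simp
        show "integrable M (\<lambda>y. c * (\<Sum>a\<in>A. ltrans a f y))" by (rule integrable_Cc[OF s fin TC])
        show "indicator C y \<le> c * (\<Sum>a\<in>A. ltrans a f y)" for y
          using A(3)[of y] A(2) ltrans_nonneg[OF f(2)] by (cases "y \<in> C") (auto intro!: mult_nonneg_nonneg sum_nonneg)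
      qed
      also have "\<dots> = c * (\<Sum>a\<in>A. integral\<^sup>L M (ltrans a f))"
        using scale[OF Cc_sum, of A "\<lambda>a. ltrans a f" c] sum[of A "\<lambda>a. ltrans a f"] ltrans_Cc[OF f(1)] by simp
      also have "\<dots> = 0" by (simp add: inv'[OF f(1)] z)
      finally have "measure M C = 0" using measure_nonneg[of M C] by simp
      then show ?thesis using fin[OF C] by (simp add: emeasure_eq_ennreal_measure less_top)
    qed
    then have "emeasure M UNIV = 0" using inner[OF open_UNIV] by (auto intro!: antisym SUP_least)
    with nz show False ..
  qed
qed

theorem haar_imp_positivity_property:
  assumes "left_haar_measure conv invol M" "f \<in> nonneg_compactly_supported" "f \<noteq> (\<lambda>_. 0)"
  shows "positivity_property conv invol f"
proof -
  note f = nonneg_compactly_supportedD[OF assms(2)]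
  note h = haar_functional[OF assms(1)]
  have "(\<lambda>x. Re (f x)) \<noteq> (\<lambda>x. 0)" using f(3) assms(3) by (metis of_real_0)
  then have "0 < integral\<^sup>L M (\<lambda>x. Re (f x))" using h(3) f by blast
  then have "positivity_property conv invol (\<lambda>x. complex_of_real (Re (f x)))"
    unfolding positivity_property_iff
    using positivity_of_invariant_functional[OF h(1,2) f(1,2)] by blast
  then show ?thesis using f(3) by simp
qed

text \<open>Without such a function the universal form of the positivity statement could hold
  vacuously and fail to give the existential one.\<close>

lemma exists_nonneg_compactly_supported:
  "\<exists>f\<in>nonneg_compactly_supported. f \<noteq> (\<lambda>_ :: 'a. 0)"
proof -
  from Urysohn_Cc[OF locally_compact compact_sing[of e] open_UNIV] obtain h :: "'a \<Rightarrow> real" and W where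
    h: "h \<in> Cc" "\<And>x. 0 \<le> h x" "{e} \<subseteq> W" "\<And>x. x \<in> W \<Longrightarrow> h x = 1"
    by (metis subset_UNIV)
  have "h e = 1" using h(3,4) by blast
  then have "(\<lambda>x. complex_of_real (h x)) \<noteq> (\<lambda>_. 0)" by (metis of_real_eq_0_iff zero_neq_one)
  then show ?thesis using nonneg_compactly_supported_of_real[OF h(1,2)] by blast
qed

end

section \<open>From positivity and a mean to a Haar measure\<close>

context hypergroup
begin

section \<open>Dependence of the convolution \<open>\<mu> * f\<close> on the measure\<close>

lemma convolve_linear:
  assumes f: "f \<in> Cb" "\<And>x. 0 \<le> f x"
    and \<mu>: "\<mu> \<in> nonneg_radon_measures" and \<nu>: "\<nu> \<in> nonneg_radon_measures" and c: "0 \<le> c" "0 \<le> d"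
  shows "convolve (\<lambda>A. of_real c * \<mu> A + of_real d * \<nu> A) f y = c * convolve \<mu> f y + d * convolve \<nu> f y"
proof -
  obtain B where B: "\<And>x. \<bar>f x\<bar> \<le> B" using Cb_cases[OF f(1)] by metis
  have "continuous_on UNIV (\<lambda>x. ltrans (invol x) f y)"
    using continuous_on_compose2[OF continuous_ltrans_invol[OF f(1)] continuous_on_Pair[OF continuous_on_id continuous_on_const]]
    by simp
  then show ?thesis
    unfolding convolve_def
    by (rule integral_linear_as_measure[OF \<mu> \<nu> c, of _ B]) (use ltrans_nonneg[OF f(2)] ltrans_abs_le[OF f(1) B] in \<open>auto simp: abs_le_iff\<close>)
qed

lemma convolve_add:
  assumes f: "f \<in> Cb" "\<And>x. 0 \<le> f x"
    and \<mu>: "\<mu> \<in> nonneg_radon_measures" and \<nu>: "\<nu> \<in> nonneg_radon_measures"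
  shows "(\<lambda>A. \<mu> A + \<nu> A) \<in> nonneg_radon_measures" "convolve (\<lambda>A. \<mu> A + \<nu> A) f y = convolve \<mu> f y + convolve \<nu> f y"
  using nonneg_radon_linear[OF \<mu> \<nu>, of 1 1] convolve_linear[OF f \<mu> \<nu>, of 1 1] by simp_all

lemma convolve_scale:
  assumes f: "f \<in> Cb" "\<And>x. 0 \<le> f x" and \<mu>: "\<mu> \<in> nonneg_radon_measures" and c: "0 \<le> c"
  shows "(\<lambda>A. of_real c * \<mu> A) \<in> nonneg_radon_measures" "convolve (\<lambda>A. of_real c * \<mu> A) f y = c * convolve \<mu> f y"
  using nonneg_radon_linear[OF \<mu> \<mu> c, of 0] convolve_linear[OF f \<mu> \<mu> c, of 0] by simp_all

lemma convolve_zero: "convolve (\<lambda>A. 0) f y = 0"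
proof -
  have "emeasure (as_measure (\<lambda>A. 0)) (UNIV :: 'a set) = 0"
    using emeasure_as_measure[OF nonneg_radon_zero, of UNIV] by simp
  then have "AE x in as_measure (\<lambda>A. 0). ltrans (invol x) f y = 0"
    by (intro AE_I[of _ _ UNIV]) (auto simp: sets_as_measure[OF nonneg_radon_zero])
  then show ?thesis unfolding convolve_def by (rule integral_eq_zero_AE)
qed

text \<open>The involution reverses products, so the measure on the left is the image of
  \<open>pmeasure b a\<close> under \<open>invol\<close>. This image cancels the involution inside
  \<open>convolve\<close>, and \<open>ltrans_ltrans\<close> finishes.\<close>

lemma convolve_pconv:
  assumes f: "f \<in> Cb"
  shows "convolve (pconv (invol a) (invol b)) f y = ltrans a (ltrans b f) y"
proof -
  have mi: "invol \<in> borel_measurable borel"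
    by (rule borel_measurable_continuous_onI[OF continuous_invol])
  \<comment> \<open>Both directions are used: point masses are 0 on non-Borel sets, so the preimage
    must be Borel exactly when the set is.\<close>
  have pre: "{x. invol x \<in> A} \<in> sets borel \<longleftrightarrow> A \<in> sets borel" for A
  proof -
    have 1: "{x. invol x \<in> B} \<in> sets borel" if "B \<in> sets borel" for B
      using measurable_sets[OF mi that] by (simp add: vimage_def)
    have "{x. invol x \<in> {x. invol x \<in> A}} = A" by (simp add: invol_invol)
    then show ?thesis using 1[of A] 1[of "{x. invol x \<in> A}"] by metis
  qed
  have pm: "(\<lambda>A. point_mass x {x. invol x \<in> A}) = point_mass (invol x)" for x
    by (auto simp: point_mass_def fun_eq_iff pre)
  have eq: "pconv (invol a) (invol b) A = pconv b a {x. invol x \<in> A}" for A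
    using fun_cong[OF invol_conv[OF point_mass_radon point_mass_radon, of b a], of A] by (simp add: pm pconv_def)
  have "as_measure (pconv (invol a) (invol b)) = distr (pmeasure b a) borel invol"
  proof (rule measure_eqI)
    show "sets (as_measure (pconv (invol a) (invol b))) = sets (distr (pmeasure b a) borel invol)"
      by (simp add: sets_as_measure[OF pconv_nonneg])
    fix A assume "A \<in> sets (as_measure (pconv (invol a) (invol b)))"
    then have A: "A \<in> sets borel" by (simp add: sets_as_measure[OF pconv_nonneg])
    have m: "invol \<in> measurable (pmeasure b a) borel" using mi by (simp add: measurable_cong_sets[OF sets_pmeasure refl])
    show "emeasure (as_measure (pconv (invol a) (invol b))) A = emeasure (distr (pmeasure b a) borel invol) A"
      unfolding emeasure_distr[OF m A] using A pre[of A]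
      by (simp add: emeasure_as_measure[OF pconv_nonneg] eq pmeasure_def vimage_def space_as_measure[OF pconv_nonneg])
  qed
  then have "convolve (pconv (invol a) (invol b)) f y = (\<integral>x. ltrans (invol x) f y \<partial>distr (pmeasure b a) borel invol)"
    by (simp add: convolve_def)
  also have "\<dots> = (\<integral>x. ltrans (invol (invol x)) f y \<partial>pmeasure b a)"
  proof (rule integral_distr)
    show "invol \<in> measurable (pmeasure b a) borel" using mi by (simp add: measurable_cong_sets[OF sets_pmeasure refl])
    show "(\<lambda>x. ltrans (invol x) f y) \<in> borel_measurable borel"
      by (rule borel_measurable_continuous_onI)
        (use continuous_on_compose2[OF continuous_ltrans_invol[OF f] continuous_on_Pair[OF continuous_on_id continuous_on_const]] in simp)
  qed
  finally show ?thesis by (simp add: invol_invol ltrans_ltrans[OF f])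
qed

section \<open>The sublinear functional of the positivity property and a linear functional below
  it\<close>

definition dominations :: "('a \<Rightarrow> real) \<Rightarrow> ('a \<Rightarrow> real) \<Rightarrow> real set" where
  "dominations f g = {Re (\<mu> UNIV) - Re (\<nu> UNIV) | \<mu> \<nu>. \<mu> \<in> nonneg_radon_measures \<and> \<nu> \<in> nonneg_radon_measures \<and>
     (\<forall>y. g y + convolve \<nu> f y \<le> convolve \<mu> f y)}"

lemma dominationsI:
  "\<mu> \<in> nonneg_radon_measures \<Longrightarrow> \<nu> \<in> nonneg_radon_measures \<Longrightarrow> (\<And>y. g y + convolve \<nu> f y \<le> convolve \<mu> f y) \<Longrightarrow>
    r = Re (\<mu> UNIV) - Re (\<nu> UNIV) \<Longrightarrow> r \<in> dominations f g"
  unfolding dominations_def by blast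

text \<open>The algebra is done on sets of admissible values, because the infimum is known to be
  finite only after these rules have been applied.\<close>

lemma dominations_add:
  assumes f: "f \<in> Cb" "\<And>x. 0 \<le> f x" and r: "r \<in> dominations f g" "s \<in> dominations f h"
  shows "r + s \<in> dominations f (\<lambda>x. g x + h x)"
proof -
  obtain \<mu> \<nu> where 1: "\<mu> \<in> nonneg_radon_measures" "\<nu> \<in> nonneg_radon_measures"
    "\<And>y. g y + convolve \<nu> f y \<le> convolve \<mu> f y" "r = Re (\<mu> UNIV) - Re (\<nu> UNIV)"
    using r(1) unfolding dominations_def by blast
  obtain \<mu>' \<nu>' where 2: "\<mu>' \<in> nonneg_radon_measures" "\<nu>' \<in> nonneg_radon_measures"
    "\<And>y. h y + convolve \<nu>' f y \<le> convolve \<mu>' f y" "s = Re (\<mu>' UNIV) - Re (\<nu>' UNIV)"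
    using r(2) unfolding dominations_def by blast
  show ?thesis
  proof (rule dominationsI)
    show "(g y + h y) + convolve (\<lambda>A. \<nu> A + \<nu>' A) f y \<le> convolve (\<lambda>A. \<mu> A + \<mu>' A) f y" for y
      using 1(3)[of y] 2(3)[of y] by (simp add: convolve_add[OF f] 1(1,2) 2(1,2))
  qed (use 1 2 convolve_add[OF f] in auto)
qed

lemma dominations_scale:
  assumes f: "f \<in> Cb" "\<And>x. 0 \<le> f x" and r: "r \<in> dominations f g" and c: "0 \<le> c"
  shows "c * r \<in> dominations f (\<lambda>x. c * g x)"
proof -
  obtain \<mu> \<nu> where 1: "\<mu> \<in> nonneg_radon_measures" "\<nu> \<in> nonneg_radon_measures"
    "\<And>y. g y + convolve \<nu> f y \<le> convolve \<mu> f y" "r = Re (\<mu> UNIV) - Re (\<nu> UNIV)"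
    using r unfolding dominations_def by blast
  show ?thesis
  proof (rule dominationsI)
    show "c * g y + convolve (\<lambda>A. of_real c * \<nu> A) f y \<le> convolve (\<lambda>A. of_real c * \<mu> A) f y" for y
      using mult_left_mono[OF 1(3)[of y] c] by (simp add: convolve_scale[OF f _ c] 1(1,2) ring_distribs)
  qed (use 1 convolve_scale[OF f _ c] in \<open>auto simp: right_diff_distrib\<close>)
qed

lemma dominations_nonpos:
  assumes "\<And>x. g x \<le> 0" shows "0 \<in> dominations f g"
  by (rule dominationsI[OF nonneg_radon_zero nonneg_radon_zero]) (use assms in \<open>auto simp: convolve_zero\<close>)

text \<open>The double translate is itself a convolution of a probability measure with
  \<open>f\<close>. Using that measure once as \<open>\<mu>\<close> and once as
  \<open>\<nu>\<close>, with 0 as the other measure, traps every linear minorant between 1 and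
  1.\<close>

lemma dominations_ltrans_ltrans:
  assumes f: "f \<in> Cb"
  shows "1 \<in> dominations f (ltrans a (ltrans b f))" "- 1 \<in> dominations f (\<lambda>y. - ltrans a (ltrans b f) y)"
  by (rule dominationsI[OF pconv_nonneg[of "invol a" "invol b"] nonneg_radon_zero],
      simp_all add: convolve_pconv[OF f] convolve_zero pconv_UNIV)
    (rule dominationsI[OF nonneg_radon_zero pconv_nonneg[of "invol a" "invol b"]],
      simp_all add: convolve_pconv[OF f] convolve_zero pconv_UNIV)

lemma dominations_sum:
  assumes f: "f \<in> Cb" "\<And>x. 0 \<le> f x" and A: "finite A"
  shows "real (card A) \<in> dominations f (\<lambda>y. \<Sum>a\<in>A. ltrans a f y)"
  using A
proof (induction A rule: finite_induct)
  case empty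
  then show ?case using dominations_nonpos[of "\<lambda>_. 0"] by simp
next
  case (insert a A)
  have "1 \<in> dominations f (ltrans a f)"
    using dominations_ltrans_ltrans(1)[OF f(1), of a e] by (simp add: ltrans_identity[OF f(1)])
  from dominations_add[OF f this insert.IH] show ?case using insert(1,2) by simp
qed

lemma dominations_mono:
  assumes "r \<in> dominations f h" "\<And>y. g y \<le> h y"
  shows "r \<in> dominations f g"
proof -
  obtain \<mu> \<nu> where 1: "\<mu> \<in> nonneg_radon_measures" "\<nu> \<in> nonneg_radon_measures"
    "\<And>y. h y + convolve \<nu> f y \<le> convolve \<mu> f y" "r = Re (\<mu> UNIV) - Re (\<nu> UNIV)"
    using assms(1) unfolding dominations_def by blast
  show ?thesis
    by (rule dominationsI[OF 1(1,2) _ 1(4)]) (use 1(3) assms(2) in \<open>meson add_right_mono order_trans\<close>)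
qed

text \<open>The order of quantifiers is the point: \<open>A\<close> and \<open>c\<close> are fixed
  before \<open>g\<close>, so the estimate is uniform over all functions vanishing off
  \<open>K\<close>.\<close>

lemma Cc_dominated:
  assumes f: "f \<in> Cc" "\<And>x. 0 \<le> f x" "f \<noteq> (\<lambda>x. 0)" and K: "compact K"
  obtains A c where "finite A" "0 \<le> c"
    "\<And>g B. 0 \<le> B \<Longrightarrow> (\<And>y. y \<notin> K \<Longrightarrow> g y = 0) \<Longrightarrow> (\<And>y. \<bar>g y\<bar> \<le> B) \<Longrightarrow> (\<And>y. \<bar>g y\<bar> \<le> (B * c) * (\<Sum>a\<in>A. ltrans a f y))"
proof -
  obtain A c where A: "finite A" "0 \<le> c" "\<And>y. y \<in> K \<Longrightarrow> 1 \<le> c * (\<Sum>a\<in>A. ltrans a f y)"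
    using translates_dominate[OF f K] by metis
  have "\<bar>g y\<bar> \<le> (B * c) * (\<Sum>a\<in>A. ltrans a f y)"
    if "0 \<le> B" "\<And>y. y \<notin> K \<Longrightarrow> g y = 0" "\<And>y. \<bar>g y\<bar> \<le> B" for g B y
  proof (cases "y \<in> K")
    case True
    have "\<bar>g y\<bar> \<le> B * 1" using that(3) by simp
    also have "\<dots> \<le> B * (c * (\<Sum>a\<in>A. ltrans a f y))" by (rule mult_left_mono[OF A(3)[OF True] that(1)])
    finally show ?thesis by (simp add: mult.assoc)
  next
    case False
    then show ?thesis using that(1,2) A(2) ltrans_nonneg[OF f(2)] by (auto intro!: mult_nonneg_nonneg sum_nonneg)
  qed
  with A(1,2) that show thesis by blast
qed

text \<open>Admissible values exist since finite sums of translates of \<open>f\<close> dominate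
  \<open>g\<close>. They are bounded below since adding a value for \<open>- g\<close> to one for
  \<open>g\<close> gives a value for 0. Positivity of the linear minorant follows because 0 is
  admissible for any non-positive function.\<close>

lemma positive_extension:
  assumes f: "f \<in> Cc" "\<And>x. 0 \<le> f x" "f \<noteq> (\<lambda>x. 0)"
    and pos: "\<And>\<mu> \<nu>. \<mu> \<in> nonneg_radon_measures \<Longrightarrow> \<nu> \<in> nonneg_radon_measures \<Longrightarrow>
      (\<And>y. convolve \<mu> f y \<le> convolve \<nu> f y) \<Longrightarrow> Re (\<mu> UNIV) \<le> Re (\<nu> UNIV)"
  obtains \<phi> where "positive_functional \<phi>" "\<And>a b. \<phi> (ltrans a (ltrans b f)) = 1"
proof -
  have fb: "f \<in> Cb" by (rule Cc_Cb[OF f(1)])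
  define p where "p g = Inf (dominations f g)" for g
  have nonempty: "dominations f g \<noteq> {}" if g: "g \<in> Cc" for g
  proof -
    obtain K where K: "compact K" "\<And>x. x \<notin> K \<Longrightarrow> g x = 0" using Cc_cases g by metis
    obtain B where B: "0 \<le> B" "\<And>x. \<bar>g x\<bar> \<le> B" using Cc_bounded g by metis
    obtain A c where A: "finite A" "0 \<le> c" "\<And>y. \<bar>g y\<bar> \<le> (B * c) * (\<Sum>a\<in>A. ltrans a f y)"
      using Cc_dominated[OF f K(1)] K(2) B by metis
    have "(B * c) * real (card A) \<in> dominations f (\<lambda>y. (B * c) * (\<Sum>a\<in>A. ltrans a f y))"
      by (intro dominations_scale[OF fb f(2)] dominations_sum[OF fb f(2)] A mult_nonneg_nonneg B)
    then have "(B * c) * real (card A) \<in> dominations f g"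
      by (rule dominations_mono) (use A(3) in \<open>auto simp: abs_le_iff\<close>)
    then show ?thesis by blast
  qed
  \<comment> \<open>For the function 0 admissibility reads \<open>\<nu> * f \<le> \<mu> * f\<close>,
    so this is exactly the positivity property.\<close>
  have zero_le: "0 \<le> r" if "r \<in> dominations f (\<lambda>x. 0)" for r
    using that pos unfolding dominations_def by auto
  have bdd: "bdd_below (dominations f g)" if g: "g \<in> Cc" for g
  proof -
    obtain s where s: "s \<in> dominations f (\<lambda>x. (-1) * g x)" using nonempty[OF Cc_scale[OF g]] by blast
    show ?thesis
    proof (rule bdd_belowI)
      fix r assume "r \<in> dominations f g"
      from dominations_add[OF fb f(2) this s] have "0 \<le> r + s" by (intro zero_le) simp
      then show "- s \<le> r" by simp
    qed
  qed
  have p_le: "p g \<le> r" if "r \<in> dominations f g" "g \<in> Cc" for r g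
    unfolding p_def by (rule cInf_lower[OF that(1) bdd[OF that(2)]])
  have p_ge: "m \<le> p g" if "\<And>r. r \<in> dominations f g \<Longrightarrow> m \<le> r" "g \<in> Cc" for m g
    unfolding p_def by (rule cInf_greatest[OF nonempty[OF that(2)] that(1)])
  have sl: "sublinear_on Cc p"
  proof (rule sublinear_onI)
    show "p (\<lambda>x. g x + h x) \<le> p g + p h" if g: "g \<in> Cc" and h: "h \<in> Cc" for g h
    proof -
      have "p (\<lambda>x. g x + h x) - r \<le> p h" if r: "r \<in> dominations f g" for r
      proof (rule p_ge[OF _ h])
        fix s assume "s \<in> dominations f h"
        from p_le[OF dominations_add[OF fb f(2) r this] Cc_add[OF g h]]
        show "p (\<lambda>x. g x + h x) - r \<le> s" by simp
      qed
      then have "p (\<lambda>x. g x + h x) - p h \<le> p g" by (intro p_ge[OF _ g]) (simp add: algebra_simps)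
      then show ?thesis by simp
    qed
    show "p (\<lambda>x. c * g x) \<le> c * p g" if g: "g \<in> Cc" and c: "0 < c" for g c
    proof -
      have "p (\<lambda>x. c * g x) / c \<le> p g"
      proof (rule p_ge[OF _ g])
        fix r assume "r \<in> dominations f g"
        from p_le[OF dominations_scale[OF fb f(2) this less_imp_le[OF c]] Cc_scale[OF g]]
        show "p (\<lambda>x. c * g x) / c \<le> r" using c by (simp add: field_simps)
      qed
      then show ?thesis using c by (simp add: field_simps)
    qed
    show "p (\<lambda>x. 0) = 0"
      by (intro antisym p_le[OF dominations_nonpos Cc_zero] p_ge[OF zero_le Cc_zero]) auto
  qed (use Cc_zero Cc_add Cc_scale in auto)
  have "\<exists>\<phi>. (\<forall>f\<in>Cc. \<forall>g\<in>Cc. \<phi> (\<lambda>x. f x + g x) = \<phi> f + \<phi> g) \<and>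
      (\<forall>f\<in>Cc. \<forall>c. \<phi> (\<lambda>x. c * f x) = c * \<phi> f) \<and> (\<forall>f\<in>Cc. \<phi> f \<le> p f)"
    by (rule Hahn_Banach_sublinear[OF Cc_zero Cc_add Cc_scale sl]) (assumption+, intro exI conjI ballI allI, assumption+)
  then obtain \<phi> where \<phi>': "\<forall>f\<in>Cc. \<forall>g\<in>Cc. \<phi> (\<lambda>x. f x + g x) = \<phi> f + \<phi> g"
      "\<forall>f\<in>Cc. \<forall>c. \<phi> (\<lambda>x. c * f x) = c * \<phi> f" "\<forall>f\<in>Cc. \<phi> f \<le> p f"
    by (elim exE conjE)
  note \<phi> = \<phi>'[rule_format]
  have \<phi>_le: "\<phi> g \<le> r" if "r \<in> dominations f g" "g \<in> Cc" for r g
    using \<phi>(3)[OF that(2)] p_le[OF that] by simp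
  have neg: "\<phi> (\<lambda>x. - g x) = - \<phi> g" if "g \<in> Cc" for g
    using \<phi>(2)[OF that, of "-1"] by simp
  have Cneg: "(\<lambda>x. - g x) \<in> Cc" if "g \<in> Cc" for g :: "'a \<Rightarrow> real"
    using Cc_scale[OF that, of "-1"] by simp
  have "positive_functional \<phi>"
  proof
    show "0 \<le> \<phi> g" if "g \<in> Cc" "\<And>x. 0 \<le> g x" for g
      using \<phi>_le[OF dominations_nonpos Cneg[OF that(1)]] that neg[OF that(1)] by simp
  qed (use locally_compact \<phi> in auto)
  moreover have "\<phi> (ltrans a (ltrans b f)) = 1" for a b
  proof -
    have C: "ltrans a (ltrans b f) \<in> Cc" by (intro ltrans_Cc f)
    show ?thesis
      using \<phi>_le[OF dominations_ltrans_ltrans(1)[OF fb] C] \<phi>_le[OF dominations_ltrans_ltrans(2)[OF fb] Cneg[OF C]] neg[OF C] by simp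
  qed
  ultimately show thesis using that by blast
qed

end

lemma integral_Complex_Cc:
  fixes p q :: "'a::t2_space \<Rightarrow> real"
  assumes "sets M = sets borel" "\<And>K. compact K \<Longrightarrow> emeasure M K < \<infinity>" "p \<in> Cc" "q \<in> Cc"
  shows "integral\<^sup>L M (\<lambda>x. Complex (p x) (q x)) = Complex (integral\<^sup>L M p) (integral\<^sup>L M q)"
proof -
  have "integrable M p" "integrable M q" using integrable_Cc[OF assms(1,2)] assms(3,4) by auto
  then show ?thesis by (simp add: Complex_eq)
qed

section \<open>Weak continuity of translation from norm continuity\<close>

context hypergroup
begin

lemma dual_space_bound:
  assumes \<Lambda>: "\<Lambda> \<in> dual_space"
  obtains C where "0 \<le> C" "\<And>u B. u \<in> bcontfun \<Longrightarrow> 0 < B \<Longrightarrow> (\<And>x::'a. norm (u x) \<le> B) \<Longrightarrow> norm (\<Lambda> u) \<le> C * B"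
proof -
  have lin: "\<And>c u. u \<in> bcontfun \<Longrightarrow> \<Lambda> (\<lambda>x. c * u x) = c * \<Lambda> u" and fin: "functional_norm bcontfun \<Lambda> < \<infinity>"
    using \<Lambda> by (auto simp: dual_space_def linear_functional_on_def)
  define C where "C = enn2real (functional_norm bcontfun \<Lambda>)"
  have "norm (\<Lambda> u) \<le> C * B" if u: "u \<in> bcontfun" and B: "0 < B" "\<And>x. norm (u x) \<le> B" for u B
  proof -
    let ?v = "\<lambda>x. complex_of_real (1 / B) * u x"
    have "bounded (range ?v)"
      using B by (auto simp: bounded_iff norm_mult norm_divide field_simps intro!: exI[of _ 1])
    then have v: "?v \<in> bcontfun"
      using u unfolding bcontfun_def by (intro CollectI conjI continuous_on_mult continuous_on_const) auto
    have "sup_norm ?v \<le> 1"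
      unfolding sup_norm_def by (rule cSUP_least) (use B in \<open>auto simp: norm_mult norm_divide field_simps\<close>)
    then have "ennreal (norm (\<Lambda> ?v)) \<le> functional_norm bcontfun \<Lambda>"
      unfolding functional_norm_def using v by (intro SUP_upper) auto
    also have "\<dots> = ennreal C" using fin by (simp add: C_def)
    finally have "norm (\<Lambda> ?v) \<le> C" by (simp add: C_def ennreal_le_iff)
    moreover have "norm (\<Lambda> ?v) = norm (\<Lambda> u) / B"
      using B(1) by (subst lin[OF u]) (simp add: norm_mult norm_divide)
    ultimately have "norm (\<Lambda> u) / B \<le> C" by (simp only:)
    then show ?thesis using B(1) by (simp add: field_simps)
  qed
  moreover have "0 \<le> C" by (simp add: C_def)
  ultimately show thesis using that by blast
qed

text \<open>Elements of the dual are bounded, so norm continuity of the translates, which is what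
  \<open>near\<close> states, implies weak continuity.\<close>

lemma WUCB_rI:
  assumes u: "u \<in> Cb"
    and near: "\<And>a \<epsilon>. 0 < \<epsilon> \<Longrightarrow> \<exists>X. open X \<and> a \<in> X \<and> (\<forall>x\<in>X. \<forall>t. \<bar>ltrans x u t - ltrans a u t\<bar> \<le> \<epsilon>)"
  shows "(\<lambda>x. complex_of_real (u x)) \<in> WUCB_r conv invol"
proof -
  let ?tr = "\<lambda>x. translate conv invol x (\<lambda>x. complex_of_real (u x))"
  have tr: "?tr x \<in> bcontfun" for x
    unfolding translate_of_real by (intro bcontfun_of_real ltrans_Cb u)
  have cont: "continuous_on UNIV (\<lambda>x. \<Lambda> (?tr x))" if \<Lambda>: "\<Lambda> \<in> dual_space" for \<Lambda>
  proof -
    obtain C where C: "0 \<le> C" "\<And>u B. u \<in> bcontfun \<Longrightarrow> 0 < B \<Longrightarrow> (\<And>x::'a. norm (u x) \<le> B) \<Longrightarrow> norm (\<Lambda> u) \<le> C * B"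
      using dual_space_bound[OF \<Lambda>] by metis
    have add: "\<And>u v. u \<in> bcontfun \<Longrightarrow> v \<in> bcontfun \<Longrightarrow> \<Lambda> (\<lambda>x. u x + v x) = \<Lambda> u + \<Lambda> v"
      and scale: "\<And>c u. u \<in> bcontfun \<Longrightarrow> \<Lambda> (\<lambda>x. c * u x) = c * \<Lambda> u"
      using \<Lambda> by (auto simp: dual_space_def linear_functional_on_def)
    have "\<exists>X. open X \<and> a \<in> X \<and> (\<forall>x\<in>X. dist (\<Lambda> (?tr x)) (\<Lambda> (?tr a)) < \<epsilon>)"
      if \<epsilon>: "0 < \<epsilon>" for a \<epsilon>
    proof -
      define \<delta> where "\<delta> = \<epsilon> / (C + 1)"
      have \<delta>: "0 < \<delta>" using \<epsilon> C by (simp add: \<delta>_def)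
      obtain X where X: "open X" "invol a \<in> X" "\<And>x t. x \<in> X \<Longrightarrow> \<bar>ltrans x u t - ltrans (invol a) u t\<bar> \<le> \<delta>"
        using near[OF \<delta>, of "invol a"] by blast
      have "dist (\<Lambda> (?tr x)) (\<Lambda> (?tr a)) < \<epsilon>" if x: "invol x \<in> X" for x
      proof -
        let ?d = "\<lambda>y. ltrans (invol x) u y - ltrans (invol a) u y"
        have d: "?d \<in> Cb"
          using Cb_add[OF ltrans_Cb[OF u] Cb_scale[OF ltrans_Cb[OF u]], of "invol x" "-1" "invol a"] by simp
        have "\<Lambda> (\<lambda>y. ?tr x y + (-1) * ?tr a y) = \<Lambda> (?tr x) + \<Lambda> (\<lambda>y. (-1) * ?tr a y)"
          using Cb_scale[OF ltrans_Cb[OF u], of "-1" "invol a"]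
          by (intro add[OF tr]) (metis (no_types, lifting) bcontfun_of_real ext of_real_1 of_real_minus of_real_mult translate_of_real)
        also have "\<dots> = \<Lambda> (?tr x) - \<Lambda> (?tr a)" by (subst scale[OF tr]) simp
        also have "(\<lambda>y. ?tr x y + (-1) * ?tr a y) = (\<lambda>y. complex_of_real (?d y))"
          by (simp add: translate_of_real)
        finally have "dist (\<Lambda> (?tr x)) (\<Lambda> (?tr a)) = norm (\<Lambda> (\<lambda>y. complex_of_real (?d y)))"
          by (simp add: dist_norm)
        also have "\<dots> \<le> C * \<delta>"
          by (rule C(2)[OF bcontfun_of_real[OF d] \<delta>]) (use X(3)[OF x] in \<open>simp add: norm_of_real del: of_real_diff\<close>)
        also have "\<dots> < \<epsilon>" using \<epsilon> C(1) by (simp add: \<delta>_def field_simps)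
        finally show ?thesis .
      qed
      \<comment> \<open>\<open>translate\<close> at \<open>x\<close> is \<open>ltrans\<close> at
        \<open>invol x\<close>, so the neighbourhood is pulled back along the involution.\<close>
      moreover have "open {x. invol x \<in> X}"
        using open_vimage[OF X(1) continuous_invol] by (simp add: vimage_def)
      ultimately show ?thesis using X(2) by (intro exI[of _ "{x. invol x \<in> X}"]) auto
    qed
    then show ?thesis
      unfolding continuous_on_def tendsto_iff eventually_at_topological by (metis UNIV_I)
  qed
  have "continuous_map euclidean weak_topology ?tr"
    unfolding weak_topology_def
  proof (rule continuous_map_pullback')
    show "continuous_map euclidean (product_topology (\<lambda>_. euclidean) dual_space) ((\<lambda>f. \<lambda>\<phi>\<in>dual_space. \<phi> f) \<circ> ?tr)"
      unfolding continuous_map_componentwise using cont by (auto simp: o_def)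
    show "topspace euclidean \<subseteq> ?tr -` bcontfun" using tr by auto
  qed
  then show ?thesis using bcontfun_of_real[OF u] by (simp add: WUCB_r_def)
qed

section \<open>Orbit functions of the linear functional\<close>

definition orbit :: "(('a \<Rightarrow> real) \<Rightarrow> real) \<Rightarrow> ('a \<Rightarrow> real) \<Rightarrow> 'a \<Rightarrow> real" where
  "orbit \<phi> g x = \<phi> (ltrans x g)"

context
  fixes \<phi> :: "('a \<Rightarrow> real) \<Rightarrow> real" and f :: "'a \<Rightarrow> real"
  assumes \<phi>: "positive_functional \<phi>"
    and f: "f \<in> Cc" "\<And>x. 0 \<le> f x" "f \<noteq> (\<lambda>x. 0)"
    and \<phi>_ltrans_ltrans: "\<And>a b. \<phi> (ltrans a (ltrans b f)) = 1"
begin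

interpretation pf: positive_functional \<phi> by (rule \<phi>)

lemma orbit_add: "g \<in> Cc \<Longrightarrow> h \<in> Cc \<Longrightarrow> orbit \<phi> (\<lambda>y. g y + h y) x = orbit \<phi> g x + orbit \<phi> h x"
proof -
  assume g: "g \<in> Cc" and h: "h \<in> Cc"
  have "ltrans x (\<lambda>y. g y + h y) = (\<lambda>y. ltrans x g y + ltrans x h y)"
    using ltrans_add[OF Cc_Cb[OF g] Cc_Cb[OF h]] by blast
  then show ?thesis using pf.add[OF ltrans_Cc[OF g] ltrans_Cc[OF h]] by (simp add: orbit_def)
qed

lemma orbit_scale: "g \<in> Cc \<Longrightarrow> orbit \<phi> (\<lambda>y. c * g y) x = c * orbit \<phi> g x"
proof -
  assume g: "g \<in> Cc"
  have "ltrans x (\<lambda>y. c * g y) = (\<lambda>y. c * ltrans x g y)" using ltrans_scale by blast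
  then show ?thesis using pf.scale[OF ltrans_Cc[OF g]] by (simp add: orbit_def)
qed

lemma orbit_diff: "g \<in> Cc \<Longrightarrow> h \<in> Cc \<Longrightarrow> orbit \<phi> (\<lambda>y. g y - h y) x = orbit \<phi> g x - orbit \<phi> h x"
  using orbit_add[OF _ Cc_scale, of g h "-1" x] orbit_scale[of h "-1" x] by simp

lemma orbit_nonneg: "g \<in> Cc \<Longrightarrow> (\<And>y. 0 \<le> g y) \<Longrightarrow> 0 \<le> orbit \<phi> g x"
  unfolding orbit_def by (intro pf.nonneg ltrans_Cc ltrans_nonneg)

lemma orbit_normalized: "orbit \<phi> f x = 1"
  using \<phi>_ltrans_ltrans[of x e] by (simp add: orbit_def ltrans_identity Cc_Cb[OF f(1)])

text \<open>Translating the domination by \<open>x\<close> leaves a sum of double translates of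
  \<open>f\<close>. Each has value 1 under \<open>\<phi>\<close>, so the bound is a multiple of
  \<open>card A\<close> and independent of \<open>x\<close>.\<close>

lemma orbit_bound:
  assumes K: "compact K"
  obtains C where "0 \<le> C" "\<And>g B x. g \<in> Cc \<Longrightarrow> 0 \<le> B \<Longrightarrow> (\<And>y. y \<notin> K \<Longrightarrow> g y = 0) \<Longrightarrow> (\<And>y. \<bar>g y\<bar> \<le> B) \<Longrightarrow>
    \<bar>orbit \<phi> g x\<bar> \<le> C * B"
proof (rule Cc_dominated[OF f K])
  fix A c assume A: "finite A" "0 \<le> c"
    "\<And>g B y. 0 \<le> B \<Longrightarrow> (\<And>y. y \<notin> K \<Longrightarrow> g y = 0) \<Longrightarrow> (\<And>y. \<bar>g y\<bar> \<le> B) \<Longrightarrow> \<bar>g y\<bar> \<le> (B * c) * (\<Sum>a\<in>A. ltrans a f y)"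
  have fb: "f \<in> Cb" by (rule Cc_Cb[OF f(1)])
  have "\<bar>orbit \<phi> g x\<bar> \<le> (c * card A) * B"
    if g: "g \<in> Cc" and B: "0 \<le> B" "\<And>y. y \<notin> K \<Longrightarrow> g y = 0" "\<And>y. \<bar>g y\<bar> \<le> B" for g B x
  proof -
    let ?h = "\<lambda>y. \<Sum>a\<in>A. ltrans a f y"
    have h: "?h \<in> Cc" by (intro Cc_sum ltrans_Cc f)
    have le: "\<bar>g y\<bar> \<le> (B * c) * ?h y" for y by (rule A(3)[OF B])
    have "\<bar>ltrans x g y\<bar> \<le> (B * c) * ltrans x ?h y" for y
    proof -
      have "ltrans x g y \<le> ltrans x (\<lambda>y. (B * c) * ?h y) y"
        by (rule ltrans_mono[OF Cc_Cb[OF g] Cb_scale[OF Cc_Cb[OF h]]]) (use le in \<open>auto simp: abs_le_iff\<close>)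
      moreover have "ltrans x (\<lambda>y. (-1) * g y) y \<le> ltrans x (\<lambda>y. (B * c) * ?h y) y"
        by (rule ltrans_mono[OF Cb_scale[OF Cc_Cb[OF g]] Cb_scale[OF Cc_Cb[OF h]]]) (use le in \<open>auto simp: abs_le_iff\<close>)
      moreover have "ltrans x (\<lambda>y. (B * c) * ?h y) y = (B * c) * ltrans x ?h y" "ltrans x (\<lambda>y. (-1) * g y) y = (-1) * ltrans x g y"
        by (rule ltrans_scale)+
      ultimately show ?thesis by linarith
    qed
    then have "\<bar>\<phi> (ltrans x g)\<bar> \<le> (B * c) * \<phi> (ltrans x ?h)"
      by (rule pf.abs_le[OF ltrans_Cc[OF g] ltrans_Cc[OF h]])
    also have "ltrans x ?h = (\<lambda>y. \<Sum>a\<in>A. ltrans x (ltrans a f) y)"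
      using ltrans_sum[of A "\<lambda>a. ltrans a f" x] ltrans_Cb[OF fb] by blast
    also have "\<phi> \<dots> = (\<Sum>a\<in>A. \<phi> (ltrans x (ltrans a f)))"
      by (rule pf.sum) (intro ltrans_Cc f)
    also have "\<dots> = card A" by (simp add: \<phi>_ltrans_ltrans)
    finally show ?thesis by (simp add: orbit_def mult_ac)
  qed
  moreover have "0 \<le> c * card A" using A(2) by simp
  ultimately show thesis using that by blast
qed

text \<open>Translates by points near \<open>a\<close> vanish off a common compact \<open>K\<close>
  and are uniformly close on it, by the tube lemma. \<open>orbit_bound\<close> for this
  \<open>K\<close> carries the closeness over to orbit functions, uniformly in
  \<open>t\<close>.\<close>

lemma orbit_ltrans_near:
  assumes g: "g \<in> Cc" and \<epsilon>: "0 < \<epsilon>"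
  shows "\<exists>X. open X \<and> a \<in> X \<and> (\<forall>x\<in>X. \<forall>t. \<bar>orbit \<phi> (ltrans x g) t - orbit \<phi> (ltrans a g) t\<bar> < \<epsilon>)"
proof -
  have gb: "g \<in> Cb" by (rule Cc_Cb[OF g])
  have "\<exists>U C. open U \<and> compact C \<and> a \<in> U \<and> U \<subseteq> C"
    using locally_compact by (simp add: locally_compact_space_def)
  then obtain U C where U: "open U" "compact C" "a \<in> U" "U \<subseteq> C" by blast
  obtain K where K: "compact K" "\<And>x y. x \<in> C \<Longrightarrow> y \<notin> K \<Longrightarrow> ltrans x g y = 0"
    using ltrans_support[OF g U(2)] by metis
  obtain c where c: "0 \<le> c" "\<And>g B x. g \<in> Cc \<Longrightarrow> 0 \<le> B \<Longrightarrow> (\<And>y. y \<notin> K \<Longrightarrow> g y = 0) \<Longrightarrow> (\<And>y. \<bar>g y\<bar> \<le> B) \<Longrightarrow>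
    \<bar>orbit \<phi> g x\<bar> \<le> c * B"
    using orbit_bound[OF K(1)] by metis
  define \<delta> where "\<delta> = \<epsilon> / (c + 1)"
  have \<delta>: "0 < \<delta>" using \<epsilon> c by (simp add: \<delta>_def)
  have "continuous_on (UNIV \<times> K) (\<lambda>(x, y). ltrans x g y)"
    using continuous_ltrans_pair[OF gb] by (rule continuous_on_subset) simp
  from continuous_on_prod_compactE[OF this K(1) UNIV_I \<delta>, of a] obtain Y where
    "a \<in> Y" "open Y" "\<forall>x\<in>Y \<inter> UNIV. \<forall>y\<in>K. dist (case (x, y) of (x, y) \<Rightarrow> ltrans x g y) (case (a, y) of (x, y) \<Rightarrow> ltrans x g y) \<le> \<delta>" .
  then have Y: "open Y" "a \<in> Y" "\<And>x y. x \<in> Y \<Longrightarrow> y \<in> K \<Longrightarrow> \<bar>ltrans x g y - ltrans a g y\<bar> \<le> \<delta>"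
    by (simp_all add: dist_real_def)
  have "\<bar>orbit \<phi> (ltrans x g) t - orbit \<phi> (ltrans a g) t\<bar> < \<epsilon>" if x: "x \<in> Y \<inter> U" for x t
  proof -
    have xC: "x \<in> C" "a \<in> C" using U x by auto
    have "\<bar>orbit \<phi> (\<lambda>y. ltrans x g y - ltrans a g y) t\<bar> \<le> c * \<delta>"
    proof (rule c(2))
      show "(\<lambda>y. ltrans x g y - ltrans a g y) \<in> Cc" by (intro Cc_diff ltrans_Cc g)
      show "ltrans x g y - ltrans a g y = 0" if "y \<notin> K" for y using K(2) xC that by simp
      show "\<bar>ltrans x g y - ltrans a g y\<bar> \<le> \<delta>" for y
        using Y(3)[of x y] K(2)[OF xC(1), of y] K(2)[OF xC(2), of y] x \<delta> by (cases "y \<in> K") auto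
    qed (use \<delta> in simp)
    also have "c * \<delta> < \<epsilon>" using \<epsilon> c by (simp add: \<delta>_def field_simps)
    finally show ?thesis by (simp add: orbit_diff ltrans_Cc[OF g])
  qed
  then show ?thesis using Y U by (intro exI[of _ "Y \<inter> U"]) auto
qed

lemma orbit_Cb:
  assumes g: "g \<in> Cc"
  shows "orbit \<phi> g \<in> Cb"
proof -
  obtain K where K: "compact K" "\<And>x. x \<notin> K \<Longrightarrow> g x = 0" using Cc_cases g by metis
  obtain B where B: "0 \<le> B" "\<And>x. \<bar>g x\<bar> \<le> B" using Cc_bounded g by metis
  obtain c where c: "\<And>x. \<bar>orbit \<phi> g x\<bar> \<le> c * B"
    using orbit_bound[OF K(1)] g K(2) B by metis
  \<comment> \<open>At \<open>t = e\<close> the estimate for translated functions becomes ordinary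
    continuity of the orbit function.\<close>
  have e: "orbit \<phi> (ltrans x g) e = orbit \<phi> g x" for x
    by (simp add: orbit_def ltrans_identity ltrans_Cb Cc_Cb[OF g])
  have "continuous_on UNIV (orbit \<phi> g)"
  proof (rule continuous_on_realI)
    fix a :: 'a and \<epsilon> :: real assume "0 < \<epsilon>"
    from orbit_ltrans_near[OF g this, of a] show "\<exists>X. open X \<and> a \<in> X \<and> (\<forall>z\<in>X \<inter> UNIV. \<bar>orbit \<phi> g z - orbit \<phi> g a\<bar> < \<epsilon>)"
      unfolding e[symmetric] by blast
  qed
  then show ?thesis using c by (rule CbI)
qed

text \<open>Translating an orbit function averages \<open>\<phi> (ltrans z g)\<close> over the
  product of the point masses at \<open>a\<close> and \<open>x\<close>. Moving \<open>\<phi>\<close>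
  outside the integral leaves \<open>\<phi>\<close> of a double translate. In this way invariance of
  the mean will become invariance under translation of \<open>g\<close>, without invariance of
  \<open>\<phi>\<close>.\<close>

lemma ltrans_orbit:
  assumes g: "g \<in> Cc"
  shows "ltrans a (orbit \<phi> g) = orbit \<phi> (ltrans a g)"
proof
  fix x
  have gb: "g \<in> Cb" by (rule Cc_Cb[OF g])
  obtain K where K: "compact K" "\<And>z y. z \<in> psupp a x \<Longrightarrow> y \<notin> K \<Longrightarrow> ltrans z g y = 0"
    using ltrans_support[OF g compact_psupp] by metis
  have "ltrans a (orbit \<phi> g) x = (\<integral>z. indicator (psupp a x) z * \<phi> (ltrans z g) \<partial>pmeasure a x)"
    using integral_pmeasure_psupp[OF Cb_continuous[OF orbit_Cb[OF g]]] by (simp add: ltrans_def[of a "orbit \<phi> g"] orbit_def)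
  also have "\<dots> = \<phi> (\<lambda>y. \<integral>z. indicator (psupp a x) z * ltrans z g y \<partial>pmeasure a x)"
    by (rule pf.interchange(3)[OF finite_pmeasure sets_pmeasure compact_psupp K(1) continuous_ltrans_pair[OF gb] K(2), symmetric])
  also have "(\<lambda>y. \<integral>z. indicator (psupp a x) z * ltrans z g y \<partial>pmeasure a x) = ltrans x (ltrans a g)"
    by (simp add: integral_pmeasure_psupp[OF continuous_ltrans_left[OF gb]] ltrans_ltrans[OF gb] fun_eq_iff)
  finally show "ltrans a (orbit \<phi> g) x = orbit \<phi> (ltrans a g) x" by (simp only: orbit_def[of \<phi> "ltrans a g" x])
qed

text \<open>The constant is carried along because positivity of the mean is tested on 1 minus a
  multiple of an orbit function.\<close>

lemma orbit_WUCB_r: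
  assumes g: "g \<in> Cc"
  shows "(\<lambda>x. complex_of_real (c + orbit \<phi> g x)) \<in> WUCB_r conv invol"
proof (rule WUCB_rI[OF Cb_add[OF Cb_const orbit_Cb[OF g]]])
  fix a and \<epsilon> :: real assume "0 < \<epsilon>"
  have "ltrans x (\<lambda>y. c + orbit \<phi> g y) t = c + orbit \<phi> (ltrans x g) t" for x t
    by (simp add: ltrans_add[OF Cb_const orbit_Cb[OF g]] ltrans_const ltrans_orbit[OF g])
  then show "\<exists>X. open X \<and> a \<in> X \<and> (\<forall>x\<in>X. \<forall>t. \<bar>ltrans x (\<lambda>y. c + orbit \<phi> g y) t - ltrans a (\<lambda>y. c + orbit \<phi> g y) t\<bar> \<le> \<epsilon>)"
    using orbit_ltrans_near[OF g \<open>0 < \<epsilon>\<close>, of a] by (simp add: less_imp_le) (meson less_imp_le)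
qed

text \<open>A mean is normalised but not assumed positive or real on real functions. The real part
  makes \<open>\<psi>\<close> real, and positivity is extracted from the norm being 1.\<close>

lemma invariant_functional_of_mean:
  assumes m: "left_invariant_mean conv invol m"
  defines "\<psi> \<equiv> \<lambda>g. Re (m (\<lambda>x. complex_of_real (orbit \<phi> g x)))"
  shows "positive_functional \<psi>" "\<And>a g. g \<in> Cc \<Longrightarrow> \<psi> (ltrans a g) = \<psi> g" "\<psi> f = 1"
proof -
  let ?W = "WUCB_r conv invol"
  let ?o = "\<lambda>g x. complex_of_real (orbit \<phi> g x)"
  have add: "\<And>u v. u \<in> ?W \<Longrightarrow> v \<in> ?W \<Longrightarrow> m (\<lambda>x. u x + v x) = m u + m v"
    and scale: "\<And>c u. u \<in> ?W \<Longrightarrow> m (\<lambda>x. c * u x) = c * m u"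
    and norm: "functional_norm ?W m = 1" and one: "m (\<lambda>_. 1) = 1"
    and inv: "\<And>u x. u \<in> ?W \<Longrightarrow> m (translate conv invol x u) = m u"
    using m by (auto simp: left_invariant_mean_def linear_functional_on_def)
  have oW: "?o g \<in> ?W" if "g \<in> Cc" for g using orbit_WUCB_r[OF that, of 0] by simp
  have oneW: "(\<lambda>_. 1) \<in> ?W"
    using WUCB_rI[OF Cb_const[of 1]] by (auto simp: ltrans_const intro!: exI[of _ UNIV])
  have bound: "norm (m u) \<le> 1" if u: "u \<in> ?W" "\<And>x. norm (u x) \<le> 1" for u
  proof -
    have "sup_norm u \<le> 1" unfolding sup_norm_def by (rule cSUP_least) (use u in auto)
    then have "ennreal (norm (m u)) \<le> functional_norm ?W m"
      unfolding functional_norm_def using u by (intro SUP_upper) auto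
    then show ?thesis by (simp add: norm)
  qed
  show "positive_functional \<psi>"
  proof
    show "\<psi> (\<lambda>x. g x + h x) = \<psi> g + \<psi> h" if "g \<in> Cc" "h \<in> Cc" for g h
      using add[OF oW[OF that(1)] oW[OF that(2)]] by (simp add: \<psi>_def orbit_add that)
    show \<psi>_scale: "\<psi> (\<lambda>x. c * g x) = c * \<psi> g" if "g \<in> Cc" for g c
      using scale[OF oW[OF that], of "of_real c"] by (simp add: \<psi>_def orbit_scale that)
    show "0 \<le> \<psi> g" if g: "g \<in> Cc" "\<And>x. 0 \<le> g x" for g
    proof -
      obtain B where B: "0 \<le> B" "\<And>x. \<bar>orbit \<phi> g x\<bar> \<le> B" using Cb_cases[OF orbit_Cb[OF g(1)]] by metis
      \<comment> \<open>With this positive factor \<open>1 - c * orbit \<phi> g\<close> takes values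
        in [0, 1]. Its mean therefore has real part at most 1, which forces the real part of the
        mean of the orbit function to be non-negative.\<close>
      define c where "c = 1 / (B + 1)"
      have c: "0 < c" "c * orbit \<phi> g x \<le> 1" "0 \<le> orbit \<phi> g x" for x
        using B(1) abs_le_D1[OF B(2)[of x]] orbit_nonneg[OF g] by (auto simp: c_def field_simps)
      let ?g = "\<lambda>x. (- c) * g x"
      have g': "?g \<in> Cc" by (rule Cc_scale[OF g(1)])
      have og: "orbit \<phi> ?g x = (- c) * orbit \<phi> g x" for x by (rule orbit_scale[OF g(1)])
      have "norm (m (\<lambda>x. complex_of_real (1 + orbit \<phi> ?g x))) \<le> 1"
      proof (rule bound[OF orbit_WUCB_r[OF g']])
        fix x
        have "0 \<le> 1 + orbit \<phi> ?g x" "1 + orbit \<phi> ?g x \<le> 1"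
          unfolding og using c(2)[of x] mult_nonneg_nonneg[OF less_imp_le[OF c(1)] c(3)[of x]] by linarith+
        then show "norm (complex_of_real (1 + orbit \<phi> ?g x)) \<le> 1" by (simp only: norm_of_real abs_of_nonneg)
      qed
      moreover have "m (\<lambda>x. complex_of_real (1 + orbit \<phi> ?g x)) = 1 + m (?o ?g)"
        using add[OF oneW oW[OF g']] one by simp
      ultimately have "Re (1 + m (?o ?g)) \<le> 1" using complex_Re_le_cmod order_trans by metis
      then have "\<psi> ?g \<le> 0" by (simp add: \<psi>_def)
      then have "0 \<le> c * \<psi> g" using \<psi>_scale[OF g(1), of "- c"] by simp
      then show ?thesis using c(1) by (simp add: zero_le_mult_iff)
    qed
  qed (rule locally_compact)
  show "\<psi> (ltrans a g) = \<psi> g" if g: "g \<in> Cc" for a g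
  proof -
    have "?o (ltrans a g) = translate conv invol (invol a) (?o g)"
      by (simp add: translate_of_real invol_invol ltrans_orbit[OF g])
    then show ?thesis using inv[OF oW[OF g], of "invol a"] by (simp add: \<psi>_def)
  qed
  show "\<psi> f = 1" by (simp add: \<psi>_def orbit_normalized one)
qed

end

text \<open>Invariance of the measure is demanded for complex functions; translation acts separately
  on real and imaginary parts, where \<open>\<psi>\<close> is the integral. The value at
  \<open>f\<close> rules out the zero measure.\<close>

lemma haar_of_invariant_functional:
  assumes "positive_functional \<psi>" and inv: "\<And>a g. g \<in> Cc \<Longrightarrow> \<psi> (ltrans a g) = \<psi> g"
    and f: "f \<in> Cc" "\<psi> f \<noteq> 0"
  shows "left_haar_measure conv invol (positive_functional.riesz_measure \<psi>)"
proof -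
  interpret positive_functional \<psi> by fact
  let ?M = riesz_measure
  have "integral\<^sup>L ?M (translate conv invol x u) = integral\<^sup>L ?M u" if u: "u \<in> compactly_supported" for u x
  proof -
    let ?p = "\<lambda>x. Re (u x)" and ?q = "\<lambda>x. Im (u x)"
    note pq = compactly_supportedD[OF u]
    have eq: "integral\<^sup>L ?M (\<lambda>x. Complex (g x) (h x)) = Complex (\<psi> g) (\<psi> h)" if "g \<in> Cc" "h \<in> Cc" for g h
      using integral_Complex_Cc[of ?M g h] emeasure_riesz_measure_compact that by (simp add: integral_riesz_measure)
    have "translate conv invol x u = (\<lambda>y. Complex (ltrans (invol x) ?p y) (ltrans (invol x) ?q y))"
    proof
      fix y
      have "integrable (pmeasure (invol x) y) (\<lambda>t. of_real (?p t) + \<i> * of_real (?q t))"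
        using integrable_pmeasure[OF Cc_Cb[OF pq(1)]] integrable_pmeasure[OF Cc_Cb[OF pq(2)]] by auto
      then have "integrable (pmeasure (invol x) y) u" by (simp add: complex_eq[symmetric])
      then show "translate conv invol x u y = Complex (ltrans (invol x) ?p y) (ltrans (invol x) ?q y)"
        using integral_Re[of "pmeasure (invol x) y" u] integral_Im[of "pmeasure (invol x) y" u]
        by (simp add: translate_def pconv_def[symmetric] cintegral_eq[OF pconv_nonneg] pmeasure_def[symmetric] ltrans_def complex_eq_iff)
    qed
    then have "integral\<^sup>L ?M (translate conv invol x u) = Complex (\<psi> (ltrans (invol x) ?p)) (\<psi> (ltrans (invol x) ?q))"
      using eq[OF ltrans_Cc[OF pq(1)] ltrans_Cc[OF pq(2)]] by simp
    also have "\<dots> = integral\<^sup>L ?M u" using eq[OF pq] inv pq by simp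
    finally show ?thesis .
  qed
  moreover have "emeasure ?M UNIV \<noteq> 0"
  proof
    assume "emeasure ?M UNIV = 0"
    then have "AE x in ?M. f x = 0" by (intro AE_I[of _ _ UNIV]) auto
    then have "integral\<^sup>L ?M f = 0" by (rule integral_eq_zero_AE)
    with f integral_riesz_measure[OF f(1)] show False by simp
  qed
  ultimately show ?thesis
    using regular_riesz_measure by (auto simp: left_haar_measure_def)
qed

theorem positivity_property_imp_haar:
  assumes m: "left_invariant_mean conv invol m"
    and f: "f \<in> nonneg_compactly_supported" "f \<noteq> (\<lambda>_. 0)" "positivity_property conv invol f"
  shows "\<exists>M. left_haar_measure conv invol M"
proof -
  let ?f = "\<lambda>x. Re (f x)"
  note fD = nonneg_compactly_supportedD[OF f(1)]
  have nz: "?f \<noteq> (\<lambda>x. 0)" using fD(3) f(2) by (metis of_real_0)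
  have "positivity_property conv invol (\<lambda>x. complex_of_real (?f x))" using f(3) fD(3) by simp
  then have pos: "Re (\<mu> UNIV) \<le> Re (\<nu> UNIV)"
    if "\<mu> \<in> nonneg_radon_measures" "\<nu> \<in> nonneg_radon_measures" "\<And>y. convolve \<mu> ?f y \<le> convolve \<nu> ?f y" for \<mu> \<nu>
    using that unfolding positivity_property_iff by blast
  have "\<exists>\<phi>. positive_functional \<phi> \<and> (\<forall>a b. \<phi> (ltrans a (ltrans b ?f)) = 1)"
  proof (rule positive_extension[OF fD(1,2) nz])
    show "Re (\<mu> UNIV) \<le> Re (\<nu> UNIV)"
      if "\<mu> \<in> nonneg_radon_measures" "\<nu> \<in> nonneg_radon_measures" "\<And>y. convolve \<mu> ?f y \<le> convolve \<nu> ?f y" for \<mu> \<nu>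
      using that by (rule pos)
    show "\<exists>\<phi>. positive_functional \<phi> \<and> (\<forall>a b. \<phi> (ltrans a (ltrans b ?f)) = 1)"
      if "positive_functional \<phi>" "\<And>a b. \<phi> (ltrans a (ltrans b ?f)) = 1" for \<phi>
      using that by blast
  qed
  then obtain \<phi> where \<phi>: "positive_functional \<phi>" "\<And>a b. \<phi> (ltrans a (ltrans b ?f)) = 1" by blast
  note inv = invariant_functional_of_mean[OF \<phi>(1) fD(1,2) nz \<phi>(2) m]
  show ?thesis
    using haar_of_invariant_functional[OF inv(1,2) fD(1)] inv(3) by auto
qed

end

theorem corollary4p6:
  fixes conv :: "('a::t2_space set \<Rightarrow> complex) \<Rightarrow> ('a set \<Rightarrow> complex) \<Rightarrow> ('a set \<Rightarrow> complex)"
    and e :: 'a and invol :: "'a \<Rightarrow> 'a"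
  assumes "hypergroup conv e invol"
    and "\<exists>m. left_invariant_mean conv invol m"
  shows "((\<exists>M. left_haar_measure conv invol M) \<longleftrightarrow>
          (\<forall>f\<in>nonneg_compactly_supported. f \<noteq> (\<lambda>_. 0) \<longrightarrow> positivity_property conv invol f)) \<and>
         ((\<forall>f\<in>nonneg_compactly_supported. f \<noteq> (\<lambda>_. 0) \<longrightarrow> positivity_property conv invol f) \<longleftrightarrow>
          (\<exists>f\<in>nonneg_compactly_supported. f \<noteq> (\<lambda>_. 0) \<and> positivity_property conv invol f))"
proof -
  interpret hypergroup conv e invol by fact
  show ?thesis
    using assms(2) haar_imp_positivity_property positivity_property_imp_haar exists_nonneg_compactly_supported
    by metis
qed

end
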